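(* Let $\Pi$ be an optimization problem on graphs which is a vertex selection or an edge selection problem. If the Weighted Rainbow-$\Pi$ problem parameterized by $k$ admits an FPT algorithm, then the $\Pi$-Discovery problem in the token sliding model parameterized by $k$ admits an FPT algorithm.
   Context: For an edge (resp. vertex) selection problem $\Pi$, a solution is a set of edges (resp. vertices) of the input graph satisfying certain requirements, and $k$ denotes the solution size. Weighted Rainbow-$\Pi$: given a graph $G$ whose edges (resp. vertices) carry colours and weights in $\mathbb{R}_+$, and integers $k$ and $b$, decide whether there is a solution of $\Pi$ of size $k$ whose elements have pairwise distinct colours and whose total weight is at most $b$. $\Pi$-Discovery in the token sliding model: given $G$, a set $S$ of $k$ edges (resp. vertices) and a non-negative integer $b$, decide whether there is a discovery sequence $C_0\dots C_\ell$ with $C_0=S$, $\ell\le b$, and $C_\ell$ a solution for $\Pi$; here each step replaces one element $y\in C$ by an element $x\notin C$ adjacent to $y$ (vertices joined by an edge, or edges sharing an endpoint). FPT means running time $f(k)\cdot N^{c}$ for computable $f$ and constant $c$. *)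

theory Defs
  imports Complex_Main
begin

section \<open>Model of computation\<close>

text \<open>
  Running times refer to the WHILE language over binary trees of N. D. Jones
  (Computability and Complexity from a Programming Perspective). It is Turing complete. With unit
  cost per elementary operation (a \<open>cons\<close> shares its arguments) and trees measured by their number
  of nodes, its running times agree with those of Turing machines up to a polynomial, so it yields
  the usual class FPT. The elementary operations build, copy and take apart trees; in particular
  there is no unit-cost arithmetic and no unit-cost comparison of trees.
\<close>

datatype data = Leaf | Node data data

primrec data_size :: "data \<Rightarrow> nat" where
  "data_size Leaf = 1"
| "data_size (Node a b) = 1 + data_size a + data_size b"

primrec left :: "data \<Rightarrow> data" where
  "left Leaf = Leaf"
| "left (Node a b) = a"

primrec right :: "data \<Rightarrow> data" where
  "right Leaf = Leaf"
| "right (Node a b) = b"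

datatype com =
    Clear nat
  | Copy nat nat
  | Cons nat nat nat
  | Left nat nat
  | Right nat nat
  | Seq com com
  | If nat com com
  | While nat com

type_synonym state = "nat \<Rightarrow> data"

text \<open>\<open>exec c s t s'\<close>: command \<open>c\<close>, started in \<open>s\<close>, halts in \<open>s'\<close> after \<open>t\<close> steps.\<close>

inductive exec :: "com \<Rightarrow> state \<Rightarrow> nat \<Rightarrow> state \<Rightarrow> bool" where
  Clear: "exec (Clear x) s 1 (s(x := Leaf))"
| Copy: "exec (Copy x y) s 1 (s(x := s y))"
| Cons: "exec (Cons x y z) s 1 (s(x := Node (s y) (s z)))"
| Left: "exec (Left x y) s 1 (s(x := left (s y)))"
| Right: "exec (Right x y) s 1 (s(x := right (s y)))"
| Seq: "exec c\<^sub>1 s t\<^sub>1 s' \<Longrightarrow> exec c\<^sub>2 s' t\<^sub>2 s'' \<Longrightarrow> exec (Seq c\<^sub>1 c\<^sub>2) s (t\<^sub>1 + t\<^sub>2) s''"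
| IfTrue: "s x \<noteq> Leaf \<Longrightarrow> exec c\<^sub>1 s t s' \<Longrightarrow> exec (If x c\<^sub>1 c\<^sub>2) s (1 + t) s'"
| IfFalse: "s x = Leaf \<Longrightarrow> exec c\<^sub>2 s t s' \<Longrightarrow> exec (If x c\<^sub>1 c\<^sub>2) s (1 + t) s'"
| WhileFalse: "s x = Leaf \<Longrightarrow> exec (While x c) s 1 s"
| WhileTrue: "s x \<noteq> Leaf \<Longrightarrow> exec c s t\<^sub>1 s' \<Longrightarrow> exec (While x c) s' t\<^sub>2 s''
    \<Longrightarrow> exec (While x c) s (1 + t\<^sub>1 + t\<^sub>2) s''"

text \<open>Variable 0 holds the input and the output; all other variables are initially \<open>Leaf\<close>.\<close>

definition runs :: "com \<Rightarrow> data \<Rightarrow> nat \<Rightarrow> data \<Rightarrow> bool" where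
  "runs p d t out \<longleftrightarrow> (\<exists>s'. exec p ((\<lambda>_. Leaf)(0 := d)) t s' \<and> s' 0 = out)"


section \<open>Encodings\<close>

definition enc_bool :: "bool \<Rightarrow> data" where
  "enc_bool b = (if b then Node Leaf Leaf else Leaf)"

text \<open>Binary, least significant bit first.\<close>

fun enc_nat :: "nat \<Rightarrow> data" where
  "enc_nat n = (if n = 0 then Leaf else Node (enc_bool (odd n)) (enc_nat (n div 2)))"

declare enc_nat.simps [simp del]

definition enc_int :: "int \<Rightarrow> data" where
  "enc_int i = Node (enc_bool (i < 0)) (enc_nat (nat \<bar>i\<bar>))"

definition enc_rat :: "rat \<Rightarrow> data" where
  "enc_rat r = (case quotient_of r of (p, q) \<Rightarrow> Node (enc_int p) (enc_int q))"

definition enc_prod :: "('a \<Rightarrow> data) \<Rightarrow> ('b \<Rightarrow> data) \<Rightarrow> 'a \<times> 'b \<Rightarrow> data" where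
  "enc_prod f g = (\<lambda>(x, y). Node (f x) (g y))"

definition enc_list :: "('a \<Rightarrow> data) \<Rightarrow> 'a list \<Rightarrow> data" where
  "enc_list f xs = foldr (\<lambda>x. Node (f x)) xs Leaf"


section \<open>Fixed-parameter tractability\<close>

definition computable :: "(nat \<Rightarrow> nat) \<Rightarrow> bool" where
  "computable f \<longleftrightarrow> (\<exists>p. \<forall>n. \<exists>t. runs p (enc_nat n) t (enc_nat (f n)))"

text \<open>
  A parameterized problem consists of its encoded instances, each together with its parameter and
  the correct answer. Trees that encode no instance are not constrained.
\<close>

type_synonym param_problem = "(data \<times> nat \<times> bool) set"

definition FPT :: "param_problem \<Rightarrow> bool" where
  "FPT P \<longleftrightarrow> (\<exists>p f c. computable f \<and>
     (\<forall>(d, k, answer) \<in> P. \<exists>t out. runs p d t out \<and> t \<le> f k * data_size d ^ c \<and>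
        (out \<noteq> Leaf \<longleftrightarrow> answer)))"


section \<open>Graphs and selection problems\<close>

datatype graph = Graph (verts: "nat set") (edges: "nat set set")

definition simple_graph :: "graph \<Rightarrow> bool" where
  "simple_graph G \<longleftrightarrow> finite (verts G) \<and> (\<forall>e \<in> edges G. e \<subseteq> verts G \<and> card e = 2)"

definition vertex_adj :: "graph \<Rightarrow> nat \<Rightarrow> nat \<Rightarrow> bool" where
  "vertex_adj G u v \<longleftrightarrow> {u, v} \<in> edges G"

definition edge_adj :: "graph \<Rightarrow> nat set \<Rightarrow> nat set \<Rightarrow> bool" where
  "edge_adj G e e' \<longleftrightarrow> e \<in> edges G \<and> e' \<in> edges G \<and> e \<noteq> e' \<and> e \<inter> e' \<noteq> {}"

text \<open>
  A selection problem is given by an arbitrary predicate saying which vertex (or edge) sets of a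
  graph are solutions. Only subsets of \<open>verts G\<close> (or \<open>edges G\<close>) are ever considered.
\<close>

datatype selection_problem =
    Vertex_Selection "graph \<Rightarrow> nat set \<Rightarrow> bool"
  | Edge_Selection "graph \<Rightarrow> nat set set \<Rightarrow> bool"

definition edge_of :: "nat \<times> nat \<Rightarrow> nat set" where
  "edge_of = (\<lambda>(u, v). {u, v})"

text \<open>
  A graph is presented by listing its vertices and its edges without repetition, in any order, each
  edge with its endpoints in any order.
\<close>

definition presents :: "nat list \<Rightarrow> (nat \<times> nat) list \<Rightarrow> graph \<Rightarrow> bool" where
  "presents vs es G \<longleftrightarrow> distinct vs \<and> set vs = verts G \<and>
     distinct (map edge_of es) \<and> set (map edge_of es) = edges G"

definition enc_edge :: "nat \<times> nat \<Rightarrow> data" where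
  "enc_edge = enc_prod enc_nat enc_nat"

definition enc_graph :: "nat list \<times> (nat \<times> nat) list \<Rightarrow> data" where
  "enc_graph = enc_prod (enc_list enc_nat) (enc_list enc_edge)"


section \<open>Weighted Rainbow\<close>

definition rainbow_solution ::
  "'x set \<Rightarrow> ('x set \<Rightarrow> bool) \<Rightarrow> ('x \<Rightarrow> nat) \<Rightarrow> ('x \<Rightarrow> real) \<Rightarrow> nat \<Rightarrow> int \<Rightarrow> 'x set \<Rightarrow> bool" where
  "rainbow_solution X sol colour weight k b C \<longleftrightarrow> C \<subseteq> X \<and> sol C \<and> card C = k \<and>
     inj_on colour C \<and> (\<Sum>x\<in>C. weight x) \<le> of_int b"

text \<open>
  The colours and weights are listed in the order in which the presentation of the graph lists
  the elements. In an encoded input the weights are nonnegative rationals, since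
  arbitrary reals have no finite encoding.
\<close>

definition enc_rainbow_input ::
  "nat list \<Rightarrow> (nat \<times> nat) list \<Rightarrow> (nat \<times> rat) list \<Rightarrow> nat \<Rightarrow> int \<Rightarrow> data" where
  "enc_rainbow_input vs es cws k b =
     enc_prod enc_graph (enc_prod (enc_list (enc_prod enc_nat enc_rat)) (enc_prod enc_nat enc_int))
       ((vs, es), cws, k, b)"

primrec weighted_rainbow :: "selection_problem \<Rightarrow> param_problem" where
  "weighted_rainbow (Vertex_Selection sol) =
     {(enc_rainbow_input vs es (map (\<lambda>v. (colour v, weight v)) vs) k b, k,
       \<exists>C. rainbow_solution (verts G) (sol G) colour (\<lambda>v. real_of_rat (weight v)) k b C)
      | G vs es colour weight k b.
        simple_graph G \<and> presents vs es G \<and> (\<forall>v \<in> verts G. 0 \<le> weight v)}"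
| "weighted_rainbow (Edge_Selection sol) =
     {(enc_rainbow_input vs es (map (\<lambda>e. (colour e, weight e)) (map edge_of es)) k b, k,
       \<exists>C. rainbow_solution (edges G) (sol G) colour (\<lambda>e. real_of_rat (weight e)) k b C)
      | G vs es colour weight k b.
        simple_graph G \<and> presents vs es G \<and> (\<forall>e \<in> edges G. 0 \<le> weight e)}"


section \<open>Discovery by token sliding\<close>

definition slide :: "('x \<Rightarrow> 'x \<Rightarrow> bool) \<Rightarrow> 'x set \<Rightarrow> 'x set \<Rightarrow> bool" where
  "slide adj C C' \<longleftrightarrow> (\<exists>y x. y \<in> C \<and> x \<notin> C \<and> adj y x \<and> C' = insert x (C - {y}))"

definition discovery_sequence ::
  "('x \<Rightarrow> 'x \<Rightarrow> bool) \<Rightarrow> ('x set \<Rightarrow> bool) \<Rightarrow> 'x set \<Rightarrow> nat \<Rightarrow> (nat \<Rightarrow> 'x set) \<Rightarrow> bool" where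
  "discovery_sequence adj sol S l C \<longleftrightarrow>
     C 0 = S \<and> (\<forall>i<l. slide adj (C i) (C (Suc i))) \<and> sol (C l)"

primrec discovery :: "selection_problem \<Rightarrow> param_problem" where
  "discovery (Vertex_Selection sol) =
     {(enc_prod enc_graph (enc_prod (enc_list enc_nat) enc_nat) ((vs, es), ss, b), card S,
       \<exists>l C. l \<le> b \<and> discovery_sequence (vertex_adj G) (sol G) S l C)
      | G vs es S ss b.
        simple_graph G \<and> presents vs es G \<and> S \<subseteq> verts G \<and> distinct ss \<and> set ss = S}"
| "discovery (Edge_Selection sol) =
     {(enc_prod enc_graph (enc_prod (enc_list enc_edge) enc_nat) ((vs, es), ss, b), card S,
       \<exists>l C. l \<le> b \<and> discovery_sequence (edge_adj G) (sol G) S l C)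
      | G vs es S ss b.
        simple_graph G \<and> presents vs es G \<and> S \<subseteq> edges G \<and>
        distinct (map edge_of ss) \<and> set (map edge_of ss) = S}"

end

theory Submission
  imports Defs
begin

text \<open>
  Tokens are indistinguishable, so whenever one blocks the way of another the two can exchange their
  targets. Hence a solution \<open>C\<close> is reachable from \<open>S\<close> within \<open>b\<close> slides iff some bijection from \<open>S\<close>
  to \<open>C\<close> has total distance at most \<open>b\<close>. If every element is coloured by the token that is to move
  there and weighted by its distance from that token, such a solution is exactly a rainbow solution
  of weight at most \<open>b\<close>.

  It remains to try few colourings, but enough of them to realise every bijection. Number the \<open>n\<close>
  elements in binary. Starting from the \<open>k\<close> constant colourings, take in each round all colourings
  that follow one of two earlier ones according to a fixed bit of the number of the element. Since
  distinct elements differ in some bit, after \<open>k\<close> rounds every colouring of \<open>k\<close> elements is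
  realised. There are at most \<open>(L (k + 1))^(2^k)\<close> of them, where \<open>L = log n + 2\<close>, and this is FPT
  because \<open>L^m \<le> m^m 2^L\<close>.
\<close>

subsection \<open>Programs as functions on trees\<close>

text \<open>The predicate for solutions is arbitrary and is never evaluated. Every query passes the
  graph on unchanged, with the same parameter, so only colours and weights can carry information,
  and the answer is the disjunction of the answers to all queries.

  Bits of element numbers are used for separation because the machine has no arithmetic: reading one
  bit of all numbers just takes the heads of lists. The price is that a bit may split a set very
  unevenly, so the number of rounds is linear in \<open>k\<close>, and each round squares the
  family. The resulting doubly exponential factor is harmless, but it has to be bounded by a
  function of \<open>k\<close> that is shown to be computable in the same language.

  The budget is written in binary and may be exponential in the input size, so no sequence of
  \<open>b\<close> slides can be simulated. Distances come from a search whose number of rounds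
  depends on the number of elements only, and the budget is used merely as a starting value that
  makes unreachable targets too expensive.\<close>

inductive_cases exec_SeqE: "exec (Seq c d) s t s'"
inductive_cases exec_IfE: "exec (If x c d) s t s'"
inductive_cases exec_WhileE: "exec (While x c) s t s'"

text \<open>Makes output and running time functions of the input, which
  \<open>computes_within_runs\<close> needs in order to treat a given program as a tree
  function.\<close>

lemma exec_deterministic:
  "exec c s t s' \<Longrightarrow> exec c s t2 s2 \<Longrightarrow> t2 = t \<and> s2 = s'"
proof (induction arbitrary: t2 s2 rule: exec.induct)
  case (Seq c1 s t1 s' c2 t2' s'')
  from Seq.prems obtain u1 u2 r where u: "t2 = u1 + u2" "exec c1 s u1 r" "exec c2 r u2 s2"
    by (rule exec_SeqE)
  from Seq.IH(1)[OF u(2)] have "u1 = t1" "r = s'" by auto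
  with u Seq.IH(2)[of u2 s2] show ?case by simp
next
  case (IfTrue s x c1 t s' c2)
  from IfTrue.prems IfTrue.hyps show ?case
    by (elim exec_IfE) (auto dest: IfTrue.IH)
next
  case (IfFalse s x c2 t s' c1)
  from IfFalse.prems IfFalse.hyps show ?case
    by (elim exec_IfE) (auto dest: IfFalse.IH)
next
  case (WhileFalse s x c)
  from WhileFalse.prems show ?case
    by (rule exec_WhileE) (use WhileFalse.hyps in simp_all)
next
  case (WhileTrue s x c t1 s' t2' s'')
  from WhileTrue.prems show ?case
  proof (rule exec_WhileE)
    fix u1 r u2 assume u: "t2 = Suc (u1 + u2)" "exec c s u1 r" "exec (While x c) r u2 s2"
    from WhileTrue.IH(1)[OF u(2)] have "u1 = t1" "r = s'" by auto
    with u WhileTrue.IH(2)[of u2 s2] show ?case by simp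
  qed (use WhileTrue.hyps in simp_all)
qed (erule exec.cases; force)+

primrec var_bound :: "com \<Rightarrow> nat" where
  "var_bound (Clear x) = Suc x"
| "var_bound (Copy x y) = Suc (max x y)"
| "var_bound (Cons x y z) = Suc (max x (max y z))"
| "var_bound (Left x y) = Suc (max x y)"
| "var_bound (Right x y) = Suc (max x y)"
| "var_bound (Seq c d) = max (var_bound c) (var_bound d)"
| "var_bound (If x c d) = max (Suc x) (max (var_bound c) (var_bound d))"
| "var_bound (While x c) = max (Suc x) (var_bound c)"

lemma exec_frame: "exec c s t s' \<Longrightarrow> var_bound c \<le> v \<Longrightarrow> s' v = s v"
  by (induction rule: exec.induct) auto

text \<open>A program only sees variables below its \<open>var_bound\<close>. So one that expects
  \<open>Leaf\<close> in its working variables can run inside another program, while the variables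
  beyond the bound hold live data.\<close>

lemma exec_agree:
  assumes "exec c s t s'" "var_bound c \<le> n" "\<And>v. v < n \<Longrightarrow> r v = s v"
  shows "\<exists>r'. exec c r t r' \<and> (\<forall>v<n. r' v = s' v)"
  using assms
proof (induction arbitrary: r rule: exec.induct)
  case (Clear x s)
  then show ?case by (intro exI[of _ "r(x := Leaf)"] conjI exec.Clear) auto
next
  case (Copy x y s)
  then show ?case
    by (intro exI[of _ "r(x := r y)"] conjI exec.Copy) auto
next
  case (Cons x y z s)
  then show ?case
    by (intro exI[of _ "r(x := Node (r y) (r z))"] conjI exec.Cons) auto
next
  case (Left x y s)
  then show ?case
    by (intro exI[of _ "r(x := left (r y))"] conjI exec.Left) auto
next
  case (Right x y s)
  then show ?case
    by (intro exI[of _ "r(x := right (r y))"] conjI exec.Right) auto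
next
  case (Seq c1 s t1 s' c2 t2 s'')
  obtain r1 where r1: "exec c1 r t1 r1" "\<forall>v<n. r1 v = s' v"
    using Seq.IH(1)[of r] Seq.prems by auto
  obtain r2 where "exec c2 r1 t2 r2" "\<forall>v<n. r2 v = s'' v"
    using Seq.IH(2)[of r1] Seq.prems r1 by auto
  with r1 show ?case by (blast intro: exec.Seq)
next
  case (IfTrue s x c1 t s' c2)
  obtain r1 where r1: "exec c1 r t r1" "\<forall>v<n. r1 v = s' v"
    using IfTrue.IH[of r] IfTrue.prems by auto
  have "r x \<noteq> Leaf" using IfTrue by auto
  with r1 show ?case by (blast intro: exec.IfTrue)
next
  case (IfFalse s x c2 t s' c1)
  obtain r1 where r1: "exec c2 r t r1" "\<forall>v<n. r1 v = s' v"
    using IfFalse.IH[of r] IfFalse.prems by auto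
  have "r x = Leaf" using IfFalse by auto
  with r1 show ?case by (blast intro: exec.IfFalse)
next
  case (WhileFalse s x c)
  have "r x = Leaf" using WhileFalse by auto
  then have "exec (While x c) r 1 r" by (rule exec.WhileFalse)
  then show ?case using WhileFalse by auto
next
  case (WhileTrue s x c t1 s' t2 s'')
  obtain r1 where r1: "exec c r t1 r1" "\<forall>v<n. r1 v = s' v"
    using WhileTrue.IH(1)[of r] WhileTrue.prems by auto
  obtain r2 where r2: "exec (While x c) r1 t2 r2" "\<forall>v<n. r2 v = s'' v"
    using WhileTrue.IH(2)[of r1] WhileTrue.prems r1 by auto
  have "r x \<noteq> Leaf" using WhileTrue by auto
  from exec.WhileTrue[OF this r1(1) r2(1)] r2(2) show ?case by blast
qed

text \<open>
  The program must work from every contents of its working variables and may only change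
  finitely many variables, so that programs can be composed without renaming.
\<close>

definition realizes :: "com \<Rightarrow> nat \<Rightarrow> (data \<Rightarrow> bool) \<Rightarrow> (data \<Rightarrow> data) \<Rightarrow> (data \<Rightarrow> nat) \<Rightarrow> bool" where
  "realizes c n P f T \<longleftrightarrow> (\<forall>s. P (s 0) \<longrightarrow>
     (\<exists>t s'. exec c s t s' \<and> t \<le> T (s 0) \<and> s' 0 = f (s 0) \<and> (\<forall>v\<ge>n. 0 < v \<longrightarrow> s' v = s v)))"

text \<open>The precondition matters because the given algorithm may diverge on trees that encode no
  instance.\<close>

definition computes_within :: "(data \<Rightarrow> bool) \<Rightarrow> (data \<Rightarrow> data) \<Rightarrow> (data \<Rightarrow> nat) \<Rightarrow> bool" where
  "computes_within P f T \<longleftrightarrow> (\<exists>c n. realizes c n P f T)"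

lemma realizesD:
  assumes "realizes c n P f T" "n \<le> m" "P (s 0)"
  shows "\<exists>t s'. exec c s t s' \<and> t \<le> T (s 0) \<and> s' 0 = f (s 0) \<and> (\<forall>v\<ge>m. 0 < v \<longrightarrow> s' v = s v)"
  using assms unfolding realizes_def by (blast intro: order.trans)

lemma computes_withinI:
  assumes "\<And>s. P (s 0) \<Longrightarrow>
    \<exists>t s'. exec c s t s' \<and> t \<le> T (s 0) \<and> s' 0 = f (s 0) \<and> (\<forall>v\<ge>n. 0 < v \<longrightarrow> s' v = s v)"
  shows "computes_within P f T"
  using assms unfolding computes_within_def realizes_def by blast

lemma computes_within_mono:
  assumes "computes_within P f T" "\<And>x. Q x \<Longrightarrow> P x" "\<And>x. Q x \<Longrightarrow> T x \<le> U x"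
  shows "computes_within Q f U"
proof -
  obtain c n where c: "realizes c n P f T"
    using assms(1) unfolding computes_within_def by blast
  show ?thesis
  proof (rule computes_withinI)
    fix s :: state assume Q: "Q (s 0)"
    obtain t s' where "exec c s t s'" "t \<le> T (s 0)" "s' 0 = f (s 0)"
        "\<forall>v\<ge>n. 0 < v \<longrightarrow> s' v = s v"
      using realizesD[OF c order.refl] assms(2)[OF Q] by blast
    then show "\<exists>t s'. exec c s t s' \<and> t \<le> U (s 0) \<and> s' 0 = f (s 0) \<and>
        (\<forall>v\<ge>n. 0 < v \<longrightarrow> s' v = s v)"
      using assms(3)[OF Q] order.trans by blast
  qed
qed

lemma computes_within_id: "computes_within P (\<lambda>x. x) (\<lambda>x. 1)"
proof (rule computes_withinI)
  fix s :: state
  show "\<exists>t s'. exec (Copy 0 0) s t s' \<and> t \<le> 1 \<and> s' 0 = s 0 \<and> (\<forall>v\<ge>0. 0 < v \<longrightarrow> s' v = s v)"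
    using exec.Copy[of 0 0 s] by auto
qed

lemma computes_within_Leaf: "computes_within P (\<lambda>x. Leaf) (\<lambda>x. 1)"
proof (rule computes_withinI)
  fix s :: state
  show "\<exists>t s'. exec (Clear 0) s t s' \<and> t \<le> 1 \<and> s' 0 = Leaf \<and> (\<forall>v\<ge>0. 0 < v \<longrightarrow> s' v = s v)"
    by (intro exI conjI, rule exec.Clear) auto
qed

lemma computes_within_left: "computes_within P left (\<lambda>x. 1)"
proof (rule computes_withinI)
  fix s :: state
  show "\<exists>t s'. exec (Left 0 0) s t s' \<and> t \<le> 1 \<and> s' 0 = left (s 0) \<and> (\<forall>v\<ge>0. 0 < v \<longrightarrow> s' v = s v)"
    by (intro exI conjI, rule exec.Left) auto
qed

lemma computes_within_right: "computes_within P right (\<lambda>x. 1)"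
proof (rule computes_withinI)
  fix s :: state
  show "\<exists>t s'. exec (Right 0 0) s t s' \<and> t \<le> 1 \<and> s' 0 = right (s 0) \<and> (\<forall>v\<ge>0. 0 < v \<longrightarrow> s' v = s v)"
    by (intro exI conjI, rule exec.Right) auto
qed

section \<open>Composition, pairing, branching and folding of programs\<close>

lemma computes_within_comp:
  assumes "computes_within Q g U" "computes_within P f T" "\<And>x. P x \<Longrightarrow> Q (f x)"
  shows "computes_within P (\<lambda>x. g (f x)) (\<lambda>x. T x + U (f x))"
proof -
  obtain c n where c: "realizes c n P f T"
    using assms(2) unfolding computes_within_def by blast
  obtain d m where d: "realizes d m Q g U"
    using assms(1) unfolding computes_within_def by blast
  show ?thesis
  proof (rule computes_withinI)
    fix s :: state assume P: "P (s 0)"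
    obtain t s' where 1: "exec c s t s'" "t \<le> T (s 0)" "s' 0 = f (s 0)"
        "\<forall>v\<ge>max n m. 0 < v \<longrightarrow> s' v = s v"
      using realizesD[OF c max.cobounded1, of s m] P by blast
    have "Q (s' 0)" using 1 P assms(3) by simp
    then obtain u s'' where 2: "exec d s' u s''" "u \<le> U (s' 0)" "s'' 0 = g (s' 0)"
        "\<forall>v\<ge>max n m. 0 < v \<longrightarrow> s'' v = s' v"
      using realizesD[OF d max.cobounded2, of s' n] by blast
    show "\<exists>t s''. exec (Seq c d) s t s'' \<and> t \<le> T (s 0) + U (f (s 0)) \<and> s'' 0 = g (f (s 0)) \<and>
        (\<forall>v\<ge>max n m. 0 < v \<longrightarrow> s'' v = s v)"
      by (rule exI[of _ "t + u"], rule exI[of _ s'']) (use 1 2 exec.Seq[OF 1(1) 2(1)] in auto)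
  qed
qed

lemma computes_within_Node:
  assumes "computes_within P f T" "computes_within P g U"
  shows "computes_within P (\<lambda>x. Node (f x) (g x)) (\<lambda>x. T x + U x + 4)"
proof -
  obtain c n where c: "realizes c n P f T"
    using assms(1) unfolding computes_within_def by blast
  obtain d m where d: "realizes d m P g U"
    using assms(2) unfolding computes_within_def by blast
  \<comment> \<open>\<open>N\<close> and \<open>N + 1\<close> lie beyond the working variables of
    both programs and keep the input and the first result. The \<open>Suc\<close> keeps
    \<open>N\<close> apart from variable 0.\<close>
  define N where "N = Suc (max n m)"
  have N: "n \<le> N" "m \<le> N" "0 < N" by (auto simp: N_def)
  show ?thesis
  proof (rule computes_withinI)
    fix s :: state assume P: "P (s 0)"
    let ?s1 = "s(N := s 0)"
    have "P (?s1 0)" using P N by simp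
    then obtain t s2 where 1: "exec c ?s1 t s2" "t \<le> T (s 0)" "s2 0 = f (s 0)"
        "\<forall>v\<ge>N. 0 < v \<longrightarrow> s2 v = ?s1 v"
      using realizesD[OF c N(1), of ?s1] N by auto
    let ?s3 = "s2(N+1 := s2 0)"
    let ?s4 = "?s3(0 := ?s3 N)"
    have s40: "?s4 0 = s 0" using 1 N by simp
    obtain u s5 where 2: "exec d ?s4 u s5" "u \<le> U (s 0)" "s5 0 = g (s 0)"
        "\<forall>v\<ge>N. 0 < v \<longrightarrow> s5 v = ?s4 v"
      using realizesD[OF d N(2), of ?s4] P s40 by auto
    let ?s6 = "s5(0 := Node (s5 (N+1)) (s5 0))"
    have "exec (Seq (Copy N 0) (Seq c (Seq (Copy (N+1) 0) (Seq (Copy 0 N) (Seq d (Cons 0 (N+1) 0))))))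
       s (1 + (t + (1 + (1 + (u + 1))))) ?s6"
      by (rule exec.Seq exec.Copy exec.Cons 1 2)+
    moreover have "?s6 0 = Node (f (s 0)) (g (s 0))" using 1 2 N by simp
    moreover have "\<forall>v\<ge>N+2. 0 < v \<longrightarrow> ?s6 v = s v" using 1 2 N by auto
    ultimately show "\<exists>t s''. exec (Seq (Copy N 0) (Seq c (Seq (Copy (N+1) 0) (Seq (Copy 0 N) (Seq d (Cons 0 (N+1) 0))))))
       s t s'' \<and> t \<le> T (s 0) + U (s 0) + 4 \<and> s'' 0 = Node (f (s 0)) (g (s 0)) \<and>
        (\<forall>v\<ge>N+2. 0 < v \<longrightarrow> s'' v = s v)"
      using 1 2 by (intro exI conjI) (assumption | simp)+
  qed
qed

definition cond :: "data \<Rightarrow> data \<Rightarrow> data \<Rightarrow> data" where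
  "cond b x y = (if b \<noteq> Leaf then x else y)"

lemma computes_within_cond:
  assumes "computes_within P b T" "computes_within P f U" "computes_within P g V"
  shows "computes_within P (\<lambda>x. cond (b x) (f x) (g x)) (\<lambda>x. T x + U x + V x + 4)"
proof -
  obtain e l where e: "realizes e l P b T"
    using assms(1) unfolding computes_within_def by blast
  obtain c n where c: "realizes c n P f U"
    using assms(2) unfolding computes_within_def by blast
  obtain d m where d: "realizes d m P g V"
    using assms(3) unfolding computes_within_def by blast
  define N where "N = Suc (max l (max n m))"
  have N: "l \<le> N" "n \<le> N" "m \<le> N" "0 < N" by (auto simp: N_def)
  let ?p = "Seq (Copy N 0) (Seq e (Seq (Copy (N+1) 0) (Seq (Copy 0 N) (If (N+1) c d))))"
  show ?thesis
  proof (rule computes_withinI)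
    fix s :: state assume P: "P (s 0)"
    let ?s1 = "s(N := s 0)"
    have "P (?s1 0)" using P N by simp
    then obtain t s2 where 1: "exec e ?s1 t s2" "t \<le> T (s 0)" "s2 0 = b (s 0)"
        "\<forall>v\<ge>N. 0 < v \<longrightarrow> s2 v = ?s1 v"
      using realizesD[OF e N(1), of ?s1] N by auto
    let ?s3 = "s2(N+1 := s2 0)"
    let ?s4 = "?s3(0 := ?s3 N)"
    have s40: "?s4 0 = s 0" using 1 N by simp
    have "\<exists>u s5. exec (If (N+1) c d) ?s4 u s5 \<and> u \<le> U (s 0) + V (s 0) + 1 \<and>
        s5 0 = cond (b (s 0)) (f (s 0)) (g (s 0)) \<and> (\<forall>v\<ge>N. 0 < v \<longrightarrow> s5 v = ?s4 v)"
    proof (cases "b (s 0) = Leaf")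
      case True
      obtain u s5 where 2: "exec d ?s4 u s5" "u \<le> V (s 0)" "s5 0 = g (s 0)"
          "\<forall>v\<ge>N. 0 < v \<longrightarrow> s5 v = ?s4 v"
        using realizesD[OF d N(3), of ?s4] P s40 by auto
      have "exec (If (N+1) c d) ?s4 (1 + u) s5"
        by (rule exec.IfFalse) (use True 1 2 in auto)
      with 2 True show ?thesis
        by (intro exI[of _ "1 + u"] exI[of _ s5]) (simp add: cond_def)
    next
      case False
      obtain u s5 where 2: "exec c ?s4 u s5" "u \<le> U (s 0)" "s5 0 = f (s 0)"
          "\<forall>v\<ge>N. 0 < v \<longrightarrow> s5 v = ?s4 v"
        using realizesD[OF c N(2), of ?s4] P s40 by auto
      have "exec (If (N+1) c d) ?s4 (1 + u) s5"
        by (rule exec.IfTrue) (use False 1 2 in auto)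
      with 2 False show ?thesis
        by (intro exI[of _ "1 + u"] exI[of _ s5]) (simp add: cond_def)
    qed
    then obtain u s5 where 2: "exec (If (N+1) c d) ?s4 u s5" "u \<le> U (s 0) + V (s 0) + 1"
        "s5 0 = cond (b (s 0)) (f (s 0)) (g (s 0))" "\<forall>v\<ge>N. 0 < v \<longrightarrow> s5 v = ?s4 v"
      by blast
    have "exec ?p s (1 + (t + (1 + (1 + u)))) s5"
      by (rule exec.Seq exec.Copy 1 2)+
    moreover have "\<forall>v\<ge>N+2. 0 < v \<longrightarrow> s5 v = s v" using 1 2 N by auto
    ultimately show "\<exists>t s''. exec ?p s t s'' \<and> t \<le> T (s 0) + U (s 0) + V (s 0) + 4 \<and>
       s'' 0 = cond (b (s 0)) (f (s 0)) (g (s 0)) \<and> (\<forall>v\<ge>N+2. 0 < v \<longrightarrow> s'' v = s v)"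
      using 1 2 by (intro exI conjI) (assumption | simp)+
  qed
qed

text \<open>Reading the right spine is a bijection between trees and lists of trees. No tree is
  malformed as a list, so list programs need no preconditions.\<close>

primrec to_list :: "data \<Rightarrow> data list" where
  "to_list Leaf = []"
| "to_list (Node a b) = a # to_list b"

definition foldd :: "(data \<Rightarrow> data \<Rightarrow> data) \<Rightarrow> data \<Rightarrow> data \<Rightarrow> data" where
  "foldd g l a = fold g (to_list l) a"

lemma foldd_simps [simp]:
  "foldd g Leaf a = a" "foldd g (Node y l) a = foldd g l (g y a)"
  by (simp_all add: foldd_def)

text \<open>The only loop from which the algorithm is built. The body receives the whole input along
  with entry and accumulator, because a program cannot capture an environment. Indexing the
  invariant by the round means that \<open>B\<close> has to bound the cost only at accumulators that
  really occur.\<close>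

lemma computes_within_foldd:
  assumes l: "computes_within P l T" and a: "computes_within P a U"
    and g: "computes_within Q (\<lambda>z. g (left z) (left (right z)) (right (right z))) V"
    and Inv_0: "\<And>x. P x \<Longrightarrow> Inv x 0 (a x)"
    and Inv_Suc: "\<And>x i r. P x \<Longrightarrow> i < length (to_list (l x)) \<Longrightarrow> Inv x i r \<Longrightarrow>
      Q (Node x (Node (to_list (l x) ! i) r)) \<and> V (Node x (Node (to_list (l x) ! i) r)) \<le> B x \<and>
      Inv x (Suc i) (g x (to_list (l x) ! i) r)"
  shows "computes_within P (\<lambda>x. foldd (g x) (l x) (a x))
    (\<lambda>x. T x + U x + 6 + length (to_list (l x)) * (B x + 6))"
proof -
  obtain cl nl where cl: "realizes cl nl P l T"
    using l unfolding computes_within_def by blast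
  obtain ca na where ca: "realizes ca na P a U"
    using a unfolding computes_within_def by blast
  obtain cg ng where cg: "realizes cg ng Q (\<lambda>z. g (left z) (left (right z)) (right (right z))) V"
    using g unfolding computes_within_def by blast
  define N where "N = Suc (max nl (max na ng))"
  have N: "nl \<le> N" "na \<le> N" "ng \<le> N" "0 < N" by (auto simp: N_def)
  let ?body = "Seq (Left 0 (N+1)) (Seq (Cons 0 0 (N+2)) (Seq (Cons 0 N 0)
     (Seq cg (Seq (Copy (N+2) 0) (Right (N+1) (N+1))))))"
  let ?p = "Seq (Copy N 0) (Seq cl (Seq (Copy (N+1) 0) (Seq (Copy 0 N) (Seq ca (Seq (Copy (N+2) 0)
     (Seq (While (N+1) ?body) (Copy 0 (N+2))))))))"
  have loop: "\<exists>t s'. exec (While (N+1) ?body) s t s' \<and>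
      t \<le> 1 + length (to_list d) * (B x + 6) \<and> s' (N+2) = foldd (g x) d r \<and>
      (\<forall>v\<ge>N+3. s' v = s v)"
    if "P x" "s N = x" "s (N+1) = d" "s (N+2) = r" "to_list d = drop i (to_list (l x))"
      "i \<le> length (to_list (l x))" "Inv x i r" for s x d r i
    using that
  proof (induction d arbitrary: s r i)
    case Leaf
    then have "exec (While (N+1) ?body) s 1 s"
      using exec.WhileFalse[of s "N+1"] by simp
    then show ?case using Leaf by (intro exI[of _ 1] exI[of _ s]) simp
  next
    case (Node y d)
    have i: "i < length (to_list (l x))" using Node.prems(5)
      by (metis drop_all leI list.distinct(1) to_list.simps(2))
    have y: "to_list (l x) ! i = y" and d: "to_list d = drop (Suc i) (to_list (l x))"
      using Node.prems(5) i by (auto simp: Cons_nth_drop_Suc[symmetric])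
    let ?z = "Node x (Node y r)"
    have z: "Q ?z" "V ?z \<le> B x" "Inv x (Suc i) (g x y r)"
      using Inv_Suc[OF Node.prems(1) i Node.prems(7)] y by auto
    let ?s1 = "s(0 := left (s (N+1)))"
    let ?s2 = "?s1(0 := Node (?s1 0) (?s1 (N+2)))"
    let ?s3 = "?s2(0 := Node (?s2 N) (?s2 0))"
    have s3: "?s3 0 = ?z" using Node.prems N by simp
    obtain u s4 where 4: "exec cg ?s3 u s4" "u \<le> V ?z" "s4 0 = g x y r"
        "\<forall>v\<ge>N. 0 < v \<longrightarrow> s4 v = ?s3 v"
      using realizesD[OF cg N(3), of ?s3] s3 z(1) by auto
    let ?s5 = "s4(N+2 := s4 0)"
    let ?s6 = "?s5(N+1 := right (?s5 (N+1)))"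
    \<comment> \<open>Five steps surround the body proper and the loop test is the sixth, hence the
      6 per round.\<close>
    have body: "exec ?body s (1 + (1 + (1 + (u + (1 + 1))))) ?s6"
      by (rule exec.Seq exec.Left exec.Cons exec.Copy exec.Right 4)+
    have fr: "\<forall>v\<ge>N+3. ?s6 v = s v" using 4(4) N by auto
    have "\<exists>t s'. exec (While (N+1) ?body) ?s6 t s' \<and>
      t \<le> 1 + length (to_list d) * (B x + 6) \<and> s' (N+2) = foldd (g x) d (g x y r) \<and>
      (\<forall>v\<ge>N+3. s' v = ?s6 v)"
      by (rule Node.IH(2)[where i = "Suc i"]) (use Node.prems 4 N i d z in auto)
    then obtain t s' where 5: "exec (While (N+1) ?body) ?s6 t s'"
      "t \<le> 1 + length (to_list d) * (B x + 6)" "s' (N+2) = foldd (g x) d (g x y r)"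
      "\<forall>v\<ge>N+3. s' v = ?s6 v" by blast
    have "exec (While (N+1) ?body) s (1 + (1 + (1 + (1 + (u + (1 + 1))))) + t) s'"
      by (rule exec.WhileTrue[OF _ body 5(1)]) (use Node.prems in simp)
    moreover have "1 + (1 + (1 + (1 + (u + (1 + 1))))) + t
        \<le> 1 + length (to_list (Node y d)) * (B x + 6)"
      using 4(2) 5(2) z(2) by simp
    moreover have "s' (N+2) = foldd (g x) (Node y d) r" using 5(3) by simp
    moreover have "\<forall>v\<ge>N+3. s' v = s v" using 5(4) fr by simp
    ultimately show ?case by blast
  qed
  show ?thesis
  proof (rule computes_withinI)
    fix s :: state assume P: "P (s 0)"
    let ?s1 = "s(N := s 0)"
    have "P (?s1 0)" using P N by simp
    then obtain t s2 where 1: "exec cl ?s1 t s2" "t \<le> T (s 0)" "s2 0 = l (s 0)"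
        "\<forall>v\<ge>N. 0 < v \<longrightarrow> s2 v = ?s1 v"
      using realizesD[OF cl N(1), of ?s1] N by auto
    let ?s3 = "s2(N+1 := s2 0)"
    let ?s4 = "?s3(0 := ?s3 N)"
    have s40: "?s4 0 = s 0" using 1 N by simp
    obtain u s5 where 2: "exec ca ?s4 u s5" "u \<le> U (s 0)" "s5 0 = a (s 0)"
        "\<forall>v\<ge>N. 0 < v \<longrightarrow> s5 v = ?s4 v"
      using realizesD[OF ca N(2), of ?s4] P s40 by auto
    let ?s6 = "s5(N+2 := s5 0)"
    have "\<exists>t s'. exec (While (N+1) ?body) ?s6 t s' \<and>
      t \<le> 1 + length (to_list (l (s 0))) * (B (s 0) + 6) \<and>
      s' (N+2) = foldd (g (s 0)) (l (s 0)) (a (s 0)) \<and> (\<forall>v\<ge>N+3. s' v = ?s6 v)"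
      by (rule loop[where i = 0]) (use P 1 2 N Inv_0 in auto)
    then obtain w s7 where 3: "exec (While (N+1) ?body) ?s6 w s7"
      "w \<le> 1 + length (to_list (l (s 0))) * (B (s 0) + 6)"
      "s7 (N+2) = foldd (g (s 0)) (l (s 0)) (a (s 0))" "\<forall>v\<ge>N+3. s7 v = ?s6 v" by blast
    let ?s8 = "s7(0 := s7 (N+2))"
    have "exec ?p s (1 + (t + (1 + (1 + (u + (1 + (w + 1))))))) ?s8"
      by (rule exec.Seq exec.Copy 1 2 3)+
    moreover have "?s8 0 = foldd (g (s 0)) (l (s 0)) (a (s 0))" using 3 by simp
    moreover have "\<forall>v\<ge>N+3. 0 < v \<longrightarrow> ?s8 v = s v" using 1 2 3 N by auto
    moreover have "1 + (t + (1 + (1 + (u + (1 + (w + 1))))))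
        \<le> T (s 0) + U (s 0) + 6 + length (to_list (l (s 0))) * (B (s 0) + 6)"
      using 1(2) 2(2) 3(2) by simp
    ultimately show "\<exists>t s''. exec ?p s t s'' \<and>
       t \<le> T (s 0) + U (s 0) + 6 + length (to_list (l (s 0))) * (B (s 0) + 6) \<and>
       s'' 0 = foldd (g (s 0)) (l (s 0)) (a (s 0)) \<and> (\<forall>v\<ge>N+3. 0 < v \<longrightarrow> s'' v = s v)"
      by blast
  qed
qed

text \<open>Restores the initial state that \<open>runs\<close> presupposes when a given program is
  started amid another computation. \<open>Copy 0 0\<close> serves as the empty command.\<close>

primrec clear_vars :: "nat \<Rightarrow> com" where
  "clear_vars 0 = Copy 0 0"
| "clear_vars (Suc n) = Seq (clear_vars n) (Clear (Suc n))"

lemma exec_clear_vars: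
  "exec (clear_vars n) s (Suc n) (\<lambda>v. if 0 < v \<and> v \<le> n then Leaf else s v)"
proof (induction n)
  case 0
  have "(\<lambda>v. if 0 < v \<and> v \<le> 0 then Leaf else s v) = s(0 := s 0)" by auto
  then show ?case using exec.Copy[of 0 0 s] by simp
next
  case (Suc n)
  have "exec (clear_vars (Suc n)) s (Suc n + 1)
      ((\<lambda>v. if 0 < v \<and> v \<le> n then Leaf else s v)(Suc n := Leaf))"
    unfolding clear_vars.simps by (rule exec.Seq[OF Suc exec.Clear])
  also have "((\<lambda>v. if 0 < v \<and> v \<le> n then Leaf else s v)(Suc n := Leaf))
      = (\<lambda>v. if 0 < v \<and> v \<le> Suc n then Leaf else s v)" by (auto simp: fun_eq_iff)
  finally show ?case by simp
qed

text \<open>By determinism the output and the exact time are definite descriptions, meaningful where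
  \<open>p\<close> halts. The constant \<open>n\<close> pays for clearing the working
  variables.\<close>

lemma computes_within_runs:
  "\<exists>f T n. computes_within (\<lambda>d. \<exists>t out. runs p d t out) f (\<lambda>d. T d + n) \<and>
     (\<forall>d t out. runs p d t out \<longrightarrow> f d = out \<and> T d = t)"
proof -
  define f where "f d = (THE out. \<exists>t. runs p d t out)" for d
  define T where "T d = (THE t. \<exists>out. runs p d t out)" for d
  have det: "t = t' \<and> out = out'" if "runs p d t out" "runs p d t' out'" for d t t' out out'
    using that exec_deterministic unfolding runs_def by blast
  have fT: "f d = out \<and> T d = t" if "runs p d t out" for d t out
    unfolding f_def T_def using that det by blast
  let ?n = "var_bound p"
  have "computes_within (\<lambda>d. \<exists>t out. runs p d t out) f (\<lambda>d. T d + Suc ?n)"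
  proof (rule computes_withinI)
    fix s :: state assume "\<exists>t out. runs p (s 0) t out"
    then obtain t out where r: "runs p (s 0) t out" by blast
    then obtain s' where s': "exec p ((\<lambda>_. Leaf)(0 := s 0)) t s'" "s' 0 = out"
      unfolding runs_def by blast
    let ?r = "\<lambda>v. if 0 < v \<and> v \<le> ?n then Leaf else s v"
    have agree: "?r v = ((\<lambda>_. Leaf)(0 := s 0)) v" if "v < Suc ?n" for v
      using that by auto
    have "\<exists>r'. exec p ?r t r' \<and> (\<forall>v<Suc ?n. r' v = s' v)"
      by (rule exec_agree[OF s'(1) _ agree]) simp_all
    then obtain r' where r': "exec p ?r t r'" "\<forall>v<Suc ?n. r' v = s' v"
      by blast
    have "exec (Seq (clear_vars ?n) p) s (Suc ?n + t) r'"
      by (rule exec.Seq[OF exec_clear_vars r'(1)])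
    moreover have "\<forall>v\<ge>Suc ?n. 0 < v \<longrightarrow> r' v = s v"
      using exec_frame[OF r'(1)] by auto
    moreover have "r' 0 = f (s 0)" "T (s 0) = t" using fT[OF r] r' s' by auto
    ultimately show "\<exists>t s'. exec (Seq (clear_vars ?n) p) s t s' \<and> t \<le> T (s 0) + Suc ?n \<and>
        s' 0 = f (s 0) \<and> (\<forall>v\<ge>Suc ?n. 0 < v \<longrightarrow> s' v = s v)"
      by (intro exI conjI) (assumption | simp)+
  qed
  with fT show ?thesis by blast
qed

lemma runs_computes_within:
  assumes "computes_within P f T"
  shows "\<exists>p. \<forall>d. P d \<longrightarrow> (\<exists>t. runs p d t (f d) \<and> t \<le> T d)"
proof -
  obtain c n where c: "realizes c n P f T"
    using assms unfolding computes_within_def by blast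
  show ?thesis
    using realizesD[OF c order.refl, of "(\<lambda>_. Leaf)(0 := d)" for d]
    unfolding runs_def by (intro exI[of _ c]) fastforce
qed

subsection \<open>Polynomial time\<close>

lemma data_size_pos [simp]: "0 < data_size x"
  by (cases x) auto

definition poly_bounded :: "(data \<Rightarrow> nat) \<Rightarrow> bool" where
  "poly_bounded T \<longleftrightarrow> (\<exists>c. \<forall>x. T x \<le> c * data_size x ^ c)"

text \<open>Factor and exponent merge into one constant because every tree has size at least
  1.\<close>

lemma poly_boundedI:
  assumes "\<And>x. T x \<le> a * data_size x ^ b"
  shows "poly_bounded T"
  unfolding poly_bounded_def
proof (intro exI allI)
  fix x
  have "T x \<le> a * data_size x ^ b" by (rule assms)
  also have "\<dots> \<le> (a + b) * data_size x ^ (a + b)"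
    by (intro mult_mono power_increasing) (simp_all add: Suc_leI)
  finally show "T x \<le> (a + b) * data_size x ^ (a + b)" .
qed

lemma poly_bounded_mono: "poly_bounded U \<Longrightarrow> (\<And>x. T x \<le> U x) \<Longrightarrow> poly_bounded T"
  unfolding poly_bounded_def by (meson le_trans)

lemma poly_bounded_const: "poly_bounded (\<lambda>x. n)"
  by (rule poly_boundedI[of _ n 0]) simp

lemma poly_bounded_size: "poly_bounded data_size"
  by (rule poly_boundedI[of _ 1 1]) simp

lemma poly_bounded_add:
  assumes "poly_bounded T" "poly_bounded U"
  shows "poly_bounded (\<lambda>x. T x + U x)"
proof -
  obtain c where c: "\<And>x. T x \<le> c * data_size x ^ c" using assms(1) unfolding poly_bounded_def by blast
  obtain d where d: "\<And>x. U x \<le> d * data_size x ^ d" using assms(2) unfolding poly_bounded_def by blast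
  show ?thesis
  proof (rule poly_boundedI)
    fix x
    have "c * data_size x ^ c \<le> c * data_size x ^ (c + d)"
      "d * data_size x ^ d \<le> d * data_size x ^ (c + d)"
      by (intro mult_mono power_increasing; simp add: Suc_leI)+
    with c[of x] d[of x] show "T x + U x \<le> (c + d) * data_size x ^ (c + d)"
      unfolding add_mult_distrib by linarith
  qed
qed

lemma poly_bounded_mult:
  assumes "poly_bounded T" "poly_bounded U"
  shows "poly_bounded (\<lambda>x. T x * U x)"
proof -
  obtain c where c: "\<And>x. T x \<le> c * data_size x ^ c" using assms(1) unfolding poly_bounded_def by blast
  obtain d where d: "\<And>x. U x \<le> d * data_size x ^ d" using assms(2) unfolding poly_bounded_def by blast
  show ?thesis
  proof (rule poly_boundedI)
    fix x
    have "T x * U x \<le> (c * data_size x ^ c) * (d * data_size x ^ d)"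
      by (intro mult_mono c d) auto
    then show "T x * U x \<le> (c * d) * data_size x ^ (c + d)"
      by (simp add: power_add mult_ac)
  qed
qed

lemma poly_bounded_power: "poly_bounded T \<Longrightarrow> poly_bounded (\<lambda>x. T x ^ n)"
  by (induction n) (auto intro: poly_bounded_mult poly_bounded_const)

lemma poly_bounded_comp:
  assumes "poly_bounded T" "poly_bounded (\<lambda>x. data_size (f x))"
  shows "poly_bounded (\<lambda>x. T (f x))"
proof -
  obtain c where c: "\<And>x. T x \<le> c * data_size x ^ c" using assms(1) unfolding poly_bounded_def by blast
  have "poly_bounded (\<lambda>x. c * data_size (f x) ^ c)"
    by (intro poly_bounded_mult poly_bounded_const poly_bounded_power assms(2))
  then show ?thesis by (rule poly_bounded_mono) (rule c)
qed

text \<open>The size of the output is bounded separately: \<open>Cons\<close> shares its arguments,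
  so repeated doubling builds a tree of exponential size in linear time.\<close>

definition poly_time :: "(data \<Rightarrow> data) \<Rightarrow> bool" where
  "poly_time f \<longleftrightarrow> (\<exists>T. computes_within (\<lambda>_. True) f T \<and> poly_bounded T) \<and>
     poly_bounded (\<lambda>x. data_size (f x))"

lemma poly_timeI:
  assumes "computes_within (\<lambda>_. True) f T" "poly_bounded T" "poly_bounded (\<lambda>x. data_size (f x))"
  shows "poly_time f"
  using assms unfolding poly_time_def by blast

lemma poly_timeE:
  assumes "poly_time f"
  obtains T where "computes_within (\<lambda>_. True) f T" "poly_bounded T"
    "poly_bounded (\<lambda>x. data_size (f x))"
  using assms unfolding poly_time_def by blast

lemma poly_time_size: "poly_time f \<Longrightarrow> poly_bounded (\<lambda>x. data_size (f x))"
  unfolding poly_time_def by blast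

lemma poly_time_comp:
  assumes "poly_time g" "poly_time f"
  shows "poly_time (\<lambda>x. g (f x))"
proof -
  obtain U where U: "computes_within (\<lambda>_. True) g U" "poly_bounded U"
    "poly_bounded (\<lambda>x. data_size (g x))" using assms(1) by (rule poly_timeE)
  obtain T where T: "computes_within (\<lambda>_. True) f T" "poly_bounded T"
    "poly_bounded (\<lambda>x. data_size (f x))" using assms(2) by (rule poly_timeE)
  show ?thesis
    by (rule poly_timeI[OF computes_within_comp[OF U(1) T(1)]])
      (auto intro!: poly_bounded_add T U poly_bounded_comp[OF U(2)] poly_bounded_comp[OF U(3)])
qed

lemma poly_time_id: "poly_time (\<lambda>x. x)"
  by (rule poly_timeI[OF computes_within_id]) (auto intro: poly_bounded_const poly_bounded_size)

lemma poly_time_left: "poly_time f \<Longrightarrow> poly_time (\<lambda>x. left (f x))"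
proof (rule poly_time_comp[of left])
  show "poly_time left"
  proof (rule poly_timeI[OF computes_within_left poly_bounded_const])
    have "data_size (left x) \<le> data_size x" for x by (cases x) auto
    then show "poly_bounded (\<lambda>x. data_size (left x))" by (rule poly_bounded_mono[OF poly_bounded_size])
  qed
qed

lemma poly_time_right: "poly_time f \<Longrightarrow> poly_time (\<lambda>x. right (f x))"
proof (rule poly_time_comp[of right])
  show "poly_time right"
  proof (rule poly_timeI[OF computes_within_right poly_bounded_const])
    have "data_size (right x) \<le> data_size x" for x by (cases x) auto
    then show "poly_bounded (\<lambda>x. data_size (right x))" by (rule poly_bounded_mono[OF poly_bounded_size])
  qed
qed

lemma poly_time_Node:
  assumes "poly_time f" "poly_time g"
  shows "poly_time (\<lambda>x. Node (f x) (g x))"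
proof -
  obtain T where T: "computes_within (\<lambda>_. True) f T" "poly_bounded T"
    "poly_bounded (\<lambda>x. data_size (f x))" using assms(1) by (rule poly_timeE)
  obtain U where U: "computes_within (\<lambda>_. True) g U" "poly_bounded U"
    "poly_bounded (\<lambda>x. data_size (g x))" using assms(2) by (rule poly_timeE)
  have "poly_bounded (\<lambda>x. 1 + data_size (f x) + data_size (g x))"
    by (intro poly_bounded_add poly_bounded_const T U)
  then show ?thesis
    by (intro poly_timeI[OF computes_within_Node[OF T(1) U(1)]])
      (auto intro!: poly_bounded_add poly_bounded_const T U)
qed

lemma poly_time_const: "poly_time (\<lambda>x. d)"
proof (induction d)
  case Leaf
  show ?case by (rule poly_timeI[OF computes_within_Leaf]) (rule poly_bounded_const)+
qed (rule poly_time_Node)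

lemma poly_time_cond:
  assumes "poly_time b" "poly_time f" "poly_time g"
  shows "poly_time (\<lambda>x. cond (b x) (f x) (g x))"
proof -
  obtain V where V: "computes_within (\<lambda>_. True) b V" "poly_bounded V"
    "poly_bounded (\<lambda>x. data_size (b x))" using assms(1) by (rule poly_timeE)
  obtain T where T: "computes_within (\<lambda>_. True) f T" "poly_bounded T"
    "poly_bounded (\<lambda>x. data_size (f x))" using assms(2) by (rule poly_timeE)
  obtain U where U: "computes_within (\<lambda>_. True) g U" "poly_bounded U"
    "poly_bounded (\<lambda>x. data_size (g x))" using assms(3) by (rule poly_timeE)
  have "poly_bounded (\<lambda>x. data_size (f x) + data_size (g x))"
    by (intro poly_bounded_add T U)
  then have "poly_bounded (\<lambda>x. data_size (cond (b x) (f x) (g x)))"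
    by (rule poly_bounded_mono) (simp add: cond_def)
  then show ?thesis
    by (intro poly_timeI[OF computes_within_cond[OF V(1) T(1) U(1)]] poly_bounded_add
        poly_bounded_const T U V)
qed

lemma size_nth_to_list: "i < length (to_list l) \<Longrightarrow> data_size (to_list l ! i) < data_size l"
proof (induction l arbitrary: i)
  case (Node a b)
  then show ?case by (cases i) (auto simp: less_SucI trans_less_add2)
qed simp

lemma length_to_list_le: "length (to_list l) \<le> data_size l"
  by (induction l) auto

lemma fold_invariant_nth:
  assumes "I 0 a" "\<And>i r. i < length ys \<Longrightarrow> I i r \<Longrightarrow> I (Suc i) (g (ys ! i) r)"
  shows "I (length ys) (fold g ys a)"
  using assms
proof (induction ys arbitrary: a I)
  case (Cons y ys)
  have "I (Suc 0) (g y a)" using Cons.prems(2)[of 0 a] Cons.prems(1) by simp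
  then have "(\<lambda>i. I (Suc i)) (length ys) (fold g ys (g y a))"
    using Cons.prems(2)[of "Suc i" for i] by (intro Cons.IH[of "\<lambda>i. I (Suc i)"]) simp_all
  then show ?case by simp
qed simp

text \<open>Iterating a polynomial-time body may lead out of polynomial time, since each round may
  enlarge the accumulator polynomially. The invariant must therefore bound all accumulators in terms
  of the input alone.\<close>

lemma poly_time_foldd_invariant:
  assumes l: "poly_time l" and a: "poly_time a"
    and g: "poly_time (\<lambda>z. g (left z) (left (right z)) (right (right z)))"
    and Inv_0: "\<And>x. Inv x 0 (a x)"
    and Inv_Suc: "\<And>x i r. i < length (to_list (l x)) \<Longrightarrow> Inv x i r \<Longrightarrow>
      Inv x (Suc i) (g x (to_list (l x) ! i) r)"
    and size: "\<And>x i r. i \<le> length (to_list (l x)) \<Longrightarrow> Inv x i r \<Longrightarrow> data_size r \<le> B x"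
    and B: "poly_bounded B"
  shows "poly_time (\<lambda>x. foldd (g x) (l x) (a x))"
proof -
  obtain T where T: "computes_within (\<lambda>_. True) l T" "poly_bounded T"
    "poly_bounded (\<lambda>x. data_size (l x))" using l by (rule poly_timeE)
  obtain U where U: "computes_within (\<lambda>_. True) a U" "poly_bounded U"
    "poly_bounded (\<lambda>x. data_size (a x))" using a by (rule poly_timeE)
  obtain V where V: "computes_within (\<lambda>_. True) (\<lambda>z. g (left z) (left (right z)) (right (right z))) V"
    "poly_bounded V" using g by (rule poly_timeE)
  obtain c where c: "\<And>x. V x \<le> c * data_size x ^ c" using V(2) unfolding poly_bounded_def by blast
  \<comment> \<open>The triple handed to the body has size 2 plus the sizes of the input, of an
    entry of \<open>l x\<close> and of the accumulator.\<close>
  define M where "M x = c * (2 + data_size x + data_size (l x) + B x) ^ c" for x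
  have M: "poly_bounded M" unfolding M_def
    by (intro poly_bounded_mult poly_bounded_const poly_bounded_power poly_bounded_add
        poly_bounded_size T B)
  have step: "V (Node x (Node (to_list (l x) ! i) r)) \<le> M x"
    if "i < length (to_list (l x))" "Inv x i r" for x i r
  proof -
    have "V (Node x (Node (to_list (l x) ! i) r)) \<le>
        c * data_size (Node x (Node (to_list (l x) ! i) r)) ^ c" by (rule c)
    also have "\<dots> \<le> M x" unfolding M_def
      using size_nth_to_list[OF that(1)] size[OF _ that(2)] that(1)
      by (intro mult_mono power_mono) simp_all
    finally show ?thesis .
  qed
  have "computes_within (\<lambda>_. True) (\<lambda>x. foldd (g x) (l x) (a x))
      (\<lambda>x. T x + U x + 6 + length (to_list (l x)) * (M x + 6))"
    by (rule computes_within_foldd[OF T(1) U(1) V(1), where Inv = Inv])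
      (use Inv_0 Inv_Suc step in auto)
  moreover have "poly_bounded (\<lambda>x. length (to_list (l x)))"
    using T(3) length_to_list_le by (rule poly_bounded_mono)
  then have "poly_bounded (\<lambda>x. T x + U x + 6 + length (to_list (l x)) * (M x + 6))"
    by (intro poly_bounded_add poly_bounded_mult poly_bounded_const T U M)
  moreover have "poly_bounded (\<lambda>x. data_size (foldd (g x) (l x) (a x)))"
  proof (rule poly_bounded_mono[OF B])
    fix x
    have "Inv x (length (to_list (l x))) (fold (g x) (to_list (l x)) (a x))"
      by (rule fold_invariant_nth) (use Inv_0 Inv_Suc in auto)
    then show "data_size (foldd (g x) (l x) (a x)) \<le> B x"
      unfolding foldd_def by (rule size[OF order.refl])
  qed
  ultimately show ?thesis by (rule poly_timeI)
qed

text \<open>The usual case: the growth per round is additive and independent of the accumulator, so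
  it sums up to a polynomial.\<close>

lemma poly_time_foldd:
  assumes l: "poly_time l" and a: "poly_time a"
    and g: "poly_time (\<lambda>z. g (left z) (left (right z)) (right (right z)))"
    and grow: "\<And>x y r. y \<in> set (to_list (l x)) \<Longrightarrow> data_size (g x y r) \<le> data_size r + K x"
    and K: "poly_bounded K"
  shows "poly_time (\<lambda>x. foldd (g x) (l x) (a x))"
proof (rule poly_time_foldd_invariant[where Inv = "\<lambda>x i r. data_size r \<le> data_size (a x) + i * K x"
      and B = "\<lambda>x. data_size (a x) + data_size (l x) * K x", OF l a g])
  fix x i r assume "i < length (to_list (l x))" "data_size r \<le> data_size (a x) + i * K x"
  then show "data_size (g x (to_list (l x) ! i) r) \<le> data_size (a x) + Suc i * K x"
    using grow[of "to_list (l x) ! i" x r] by simp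
next
  fix x i r assume i: "i \<le> length (to_list (l x))" and r: "data_size r \<le> data_size (a x) + i * K x"
  have "i * K x \<le> data_size (l x) * K x"
    using i length_to_list_le[of "l x"] by (intro mult_right_mono) auto
  with r show "data_size r \<le> data_size (a x) + data_size (l x) * K x" by linarith
qed (auto intro!: poly_bounded_add poly_bounded_mult K poly_time_size l a)


subsection \<open>List processing\<close>

definition from_list :: "data list \<Rightarrow> data" where
  "from_list xs = foldr Node xs Leaf"

lemma from_list_simps [simp]:
  "from_list [] = Leaf" "from_list (x # xs) = Node x (from_list xs)"
  by (simp_all add: from_list_def)

lemma to_list_from_list [simp]: "to_list (from_list xs) = xs"
  by (induction xs) auto

lemma from_list_to_list [simp]: "from_list (to_list d) = d"
  by (induction d) auto

lemma from_list_eq_Leaf_iff [simp]: "from_list xs = Leaf \<longleftrightarrow> xs = []"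
  by (cases xs) auto

lemma enc_list_conv: "enc_list f xs = from_list (map f xs)"
  by (induction xs) (auto simp: enc_list_def)

lemma data_size_from_list: "data_size (from_list xs) = 1 + (\<Sum>x\<leftarrow>xs. 1 + data_size x)"
  by (induction xs) auto

lemma size_mem_to_list: "y \<in> set (to_list l) \<Longrightarrow> data_size y \<le> data_size l"
  by (metis in_set_conv_nth less_imp_le size_nth_to_list)

definition rev_append :: "data \<Rightarrow> data \<Rightarrow> data" where
  "rev_append l a = foldd Node l a"

lemma rev_append_simps [simp]:
  "rev_append Leaf a = a" "rev_append (Node y l) a = rev_append l (Node y a)"
  by (simp_all add: rev_append_def)

lemma rev_append_conv: "rev_append l a = from_list (rev (to_list l) @ to_list a)"
  by (induction l arbitrary: a) auto

lemma data_size_rev_append: "data_size (rev_append l a) + 1 = data_size l + data_size a"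
  by (induction l arbitrary: a) auto

lemma poly_time_rev_append:
  assumes "poly_time l" "poly_time a"
  shows "poly_time (\<lambda>x. rev_append (l x) (a x))"
  unfolding rev_append_def
proof (rule poly_time_foldd[OF assms, where K = "\<lambda>x. 1 + data_size (l x)"])
  show "poly_time (\<lambda>z. Node (left (right z)) (right (right z)))"
    by (intro poly_time_Node poly_time_left poly_time_right poly_time_id)
next
  show "poly_bounded (\<lambda>x. 1 + data_size (l x))"
    by (intro poly_bounded_add poly_bounded_const poly_time_size assms)
qed (auto dest: size_mem_to_list)

definition flat_map :: "(data \<Rightarrow> data) \<Rightarrow> data \<Rightarrow> data" where
  "flat_map h l = from_list (concat (map (\<lambda>y. to_list (h y)) (to_list l)))"

text \<open>The fold pushes results to the front and thus builds the list backwards, hence the final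
  reversal.\<close>

lemma flat_map_conv_foldd:
  "flat_map h l = rev_append (foldd (\<lambda>y r. rev_append (h y) r) l Leaf) Leaf"
proof -
  have "rev_append (foldd (\<lambda>y r. rev_append (h y) r) l a) Leaf =
      from_list (rev (to_list a) @ concat (map (\<lambda>y. to_list (h y)) (to_list l)))" for a
    by (induction l arbitrary: a) (auto simp: rev_append_conv)
  from this[of Leaf] show ?thesis by (simp add: flat_map_def)
qed

lemma poly_time_flat_map:
  assumes h: "poly_time (\<lambda>z. h (left z) (right z))" and l: "poly_time l"
  shows "poly_time (\<lambda>x. flat_map (h x) (l x))"
proof -
  obtain c where c: "\<And>z. data_size (h (left z) (right z)) \<le> c * data_size z ^ c"
    using poly_time_size[OF h] unfolding poly_bounded_def by blast
  have "poly_time (\<lambda>x. foldd (\<lambda>y r. rev_append (h x y) r) (l x) Leaf)"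
  proof (rule poly_time_foldd[OF l poly_time_const,
        where K = "\<lambda>x. c * (1 + data_size x + data_size (l x)) ^ c"])
    have "poly_time (\<lambda>z. h (left (Node (left z) (left (right z)))) (right (Node (left z) (left (right z)))))"
      by (rule poly_time_comp[OF h]) (intro poly_time_Node poly_time_left poly_time_right poly_time_id)
    then show "poly_time (\<lambda>z. rev_append (h (left z) (left (right z))) (right (right z)))"
      by (intro poly_time_rev_append poly_time_right poly_time_id) simp
  next
    fix x y r assume y: "y \<in> set (to_list (l x))"
    have "data_size (h x y) \<le> c * data_size (Node x y) ^ c"
      using c[of "Node x y"] by simp
    also have "\<dots> \<le> c * (1 + data_size x + data_size (l x)) ^ c"
      using size_mem_to_list[OF y] by (intro mult_mono power_mono) simp_all
    finally show "data_size (rev_append (h x y) r) \<le>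
        data_size r + c * (1 + data_size x + data_size (l x)) ^ c"
      using data_size_rev_append[of "h x y" r] by linarith
  next
    show "poly_bounded (\<lambda>x. c * (1 + data_size x + data_size (l x)) ^ c)"
      by (intro poly_bounded_mult poly_bounded_const poly_bounded_power poly_bounded_add
        poly_bounded_size poly_time_size l)
  qed
  then show ?thesis unfolding flat_map_conv_foldd
    by (intro poly_time_rev_append poly_time_const)
qed

abbreviation tt :: data where "tt \<equiv> Node Leaf Leaf"

definition map_data :: "(data \<Rightarrow> data) \<Rightarrow> data \<Rightarrow> data" where
  "map_data h l = flat_map (\<lambda>y. Node (h y) Leaf) l"

definition filter_data :: "(data \<Rightarrow> data) \<Rightarrow> data \<Rightarrow> data" where
  "filter_data P l = flat_map (\<lambda>y. cond (P y) (Node y Leaf) Leaf) l"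

definition ex_data :: "(data \<Rightarrow> data) \<Rightarrow> data \<Rightarrow> data" where
  "ex_data P l = flat_map (\<lambda>y. cond (P y) tt Leaf) l"

lemma map_data_conv: "map_data h l = from_list (map h (to_list l))"
  by (simp add: map_data_def flat_map_def)

lemma filter_data_conv: "filter_data P l = from_list (filter (\<lambda>y. P y \<noteq> Leaf) (to_list l))"
proof -
  have "concat (map (\<lambda>y. to_list (cond (P y) (Node y Leaf) Leaf)) ys) = filter (\<lambda>y. P y \<noteq> Leaf) ys"
    for ys by (induction ys) (auto simp: cond_def)
  then show ?thesis by (simp add: filter_data_def flat_map_def)
qed

lemma ex_data_iff: "ex_data P l \<noteq> Leaf \<longleftrightarrow> (\<exists>y \<in> set (to_list l). P y \<noteq> Leaf)"
  by (auto simp: ex_data_def flat_map_def cond_def split: if_splits)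

lemma poly_time_map_data:
  assumes "poly_time (\<lambda>z. h (left z) (right z))" "poly_time l"
  shows "poly_time (\<lambda>x. map_data (h x) (l x))"
  unfolding map_data_def
  by (intro poly_time_flat_map poly_time_Node poly_time_const assms)

lemma poly_time_filter_data:
  assumes "poly_time (\<lambda>z. P (left z) (right z))" "poly_time l"
  shows "poly_time (\<lambda>x. filter_data (P x) (l x))"
  unfolding filter_data_def
  by (intro poly_time_flat_map poly_time_cond poly_time_Node poly_time_const poly_time_right
      poly_time_id assms)

lemma poly_time_ex_data:
  assumes "poly_time (\<lambda>z. P (left z) (right z))" "poly_time l"
  shows "poly_time (\<lambda>x. ex_data (P x) (l x))"
  unfolding ex_data_def
  by (intro poly_time_flat_map poly_time_cond poly_time_const assms)

lemmas poly_time_intros = poly_time_id poly_time_const poly_time_left poly_time_right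
  poly_time_Node poly_time_cond poly_time_rev_append poly_time_flat_map poly_time_map_data
  poly_time_filter_data poly_time_ex_data

lemma poly_time_comp2:
  assumes "poly_time (\<lambda>z. h (left z) (right z))" "poly_time f" "poly_time g"
  shows "poly_time (\<lambda>x. h (f x) (g x))"
  using poly_time_comp[OF assms(1) poly_time_Node[OF assms(2,3)]] by simp

subsection \<open>Binary numbers\<close>

lemma enc_nat_0 [simp]: "enc_nat 0 = Leaf"
  by (simp add: enc_nat.simps)

lemma enc_nat_pos: "0 < n \<Longrightarrow> enc_nat n = Node (enc_bool (odd n)) (enc_nat (n div 2))"
  by (simp add: enc_nat.simps)

lemma enc_nat_eq_Leaf_iff [simp]: "enc_nat n = Leaf \<longleftrightarrow> n = 0"
  by (subst enc_nat.simps) simp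

lemma enc_bool_eq_Leaf_iff [simp]: "enc_bool b = Leaf \<longleftrightarrow> \<not> b"
  by (simp add: enc_bool_def)

text \<open>The accumulator pairs the pending carry with the output bits so far, the latest one
  first.\<close>

definition incr_step :: "data \<Rightarrow> data \<Rightarrow> data" where
  "incr_step b r = cond (left r)
     (cond b (Node tt (Node Leaf (right r))) (Node Leaf (Node tt (right r))))
     (Node Leaf (Node b (right r)))"

definition incr_finish :: "data \<Rightarrow> data" where
  "incr_finish r = rev_append (cond (left r) (Node tt (right r)) (right r)) Leaf"

definition incr :: "data \<Rightarrow> data" where
  "incr d = incr_finish (foldd incr_step d (Node tt Leaf))"

lemma incr_step_Leaf: "foldd incr_step d (Node Leaf a) = Node Leaf (rev_append d a)"
  by (induction d arbitrary: a) (auto simp: incr_step_def cond_def)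

text \<open>An odd \<open>n\<close> hands the carry on to \<open>n div 2\<close>; an even one
  absorbs it, after which the remaining bits are copied.\<close>

lemma incr_finish_enc_nat:
  "incr_finish (foldd incr_step (enc_nat n) (Node tt a)) = rev_append a (enc_nat (Suc n))"
proof (induction n arbitrary: a rule: less_induct)
  case (less n)
  have split: "rev_append (rev_append d a) Leaf = rev_append a d" for d a
    by (simp add: rev_append_conv)
  consider "n = 0" | "0 < n" "even n" | "0 < n" "odd n" by blast
  then show ?case
  proof cases
    case 1
    then show ?thesis by (simp add: incr_finish_def cond_def enc_nat_pos enc_bool_def split)
  next
    case 2
    then have "Suc n div 2 = n div 2" by presburger
    with 2 show ?thesis
      by (simp add: enc_nat_pos[of n] enc_nat_pos[of "Suc n"] incr_step_def[of _ "Node tt a"]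
          cond_def[of tt] cond_def[of Leaf] enc_bool_def incr_step_Leaf)
        (simp add: incr_finish_def cond_def split)
  next
    case 3
    then have "Suc n div 2 = Suc (n div 2)" by presburger
    with 3 less.IH[of "n div 2"] show ?thesis
      by (simp add: enc_nat_pos[of n] enc_nat_pos[of "Suc n"] incr_step_def[of _ "Node tt a"]
          cond_def[of tt] enc_bool_def)
  qed
qed

lemma incr_enc_nat [simp]: "incr (enc_nat n) = enc_nat (Suc n)"
  using incr_finish_enc_nat[of n Leaf] by (simp add: incr_def)

text \<open>The 4 is a new leading cell with the bit \<open>tt\<close>. The bound covers arbitrary
  trees, because \<open>poly_time\<close> speaks about all inputs, and its being additive keeps
  repeated counting polynomial.\<close>

lemma data_size_incr: "data_size (incr d) \<le> data_size d + 4"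
proof -
  have "left r \<noteq> Leaf \<and> data_size (right r) + 1 \<le> data_size a + data_size d \<or>
      left r = Leaf \<and> data_size (right r) \<le> data_size a + data_size d + 1"
    if "r = foldd incr_step d (Node tt a)" for r a
    using that
  proof (induction d arbitrary: a)
    case (Node b d)
    show ?case
    proof (cases "b = Leaf")
      case True
      then have "r = Node Leaf (rev_append d (Node tt a))"
        using Node.prems by (simp add: incr_step_def[of _ "Node tt a"] cond_def incr_step_Leaf)
      with True data_size_rev_append[of d "Node tt a"] show ?thesis by simp
    next
      case False
      then have "r = foldd incr_step d (Node tt (Node Leaf a))"
        using Node.prems by (simp add: incr_step_def[of _ "Node tt a"] cond_def)
      from Node.IH(2)[OF this] data_size_pos[of b] show ?thesis by (simp; arith)
    qed
  qed simp
  from this[OF refl, of Leaf] show ?thesis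
    using data_size_rev_append[of "right (foldd incr_step d (Node tt Leaf))" Leaf]
      data_size_rev_append[of "Node tt (right (foldd incr_step d (Node tt Leaf)))" Leaf]
    by (auto simp: incr_def incr_finish_def cond_def)
qed

lemma poly_time_incr: "poly_time f \<Longrightarrow> poly_time (\<lambda>x. incr (f x))"
proof (rule poly_time_comp[of incr])
  have "poly_time (\<lambda>x. foldd incr_step x (Node tt Leaf))"
  proof (rule poly_time_foldd[OF poly_time_id poly_time_const, where K = "\<lambda>x. data_size x + 5"])
    show "poly_time (\<lambda>z. incr_step (left (right z)) (right (right z)))"
      unfolding incr_step_def by (intro poly_time_intros)
    fix x y r assume "y \<in> set (to_list x)"
    then show "data_size (incr_step y r) \<le> data_size r + (data_size x + 5)"
      using size_mem_to_list[of y x] by (cases r) (auto simp: incr_step_def cond_def)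
  qed (intro poly_bounded_add poly_bounded_const poly_bounded_size)
  then show "poly_time incr"
    unfolding incr_def incr_finish_def by (intro poly_time_intros)
qed

text \<open>The accumulator is \<open>Node tt e\<close> with the unread bits \<open>e\<close> of the
  second number, and \<open>Leaf\<close> once a mismatch has been found.\<close>

definition eq_step :: "data \<Rightarrow> data \<Rightarrow> data" where
  "eq_step b r = cond (left r) (cond (right r)
     (cond (cond b (left (right r)) (cond (left (right r)) Leaf tt))
       (Node tt (right (right r))) Leaf) Leaf) Leaf"

definition eq_nat :: "data \<Rightarrow> data \<Rightarrow> data" where
  "eq_nat d e = cond (left (foldd eq_step d (Node tt e)))
     (cond (right (foldd eq_step d (Node tt e))) Leaf tt) Leaf"

lemma foldd_eq_step_Leaf: "foldd eq_step d Leaf = Leaf"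
  by (induction d) (auto simp: eq_step_def cond_def)

lemma eq_nat_iff [simp]: "eq_nat (enc_nat m) (enc_nat n) \<noteq> Leaf \<longleftrightarrow> m = n"
proof (induction m arbitrary: n rule: less_induct)
  case (less m)
  show ?case
  proof (cases "m = 0 \<or> n = 0")
    case True
    then show ?thesis
      by (cases "m = 0"; cases "n = 0")
        (simp_all add: eq_nat_def enc_nat_pos eq_step_def[of _ "Node tt Leaf"] cond_def foldd_eq_step_Leaf)
  next
    case False
    have parity: "m = n \<longleftrightarrow> odd m = odd n \<and> m div 2 = n div 2" by presburger
    have "eq_nat (enc_nat m) (enc_nat n) =
        (if odd m = odd n then eq_nat (enc_nat (m div 2)) (enc_nat (n div 2)) else Leaf)"
      using False
      by (simp add: eq_nat_def enc_nat_pos[of m] enc_nat_pos[of n] eq_step_def[of _ "Node tt (Node _ _)"]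
        enc_bool_def foldd_eq_step_Leaf) (simp add: cond_def foldd_eq_step_Leaf)
    with less.IH[of "m div 2" "n div 2"] parity False show ?thesis by simp
  qed
qed

lemma poly_time_eq_nat:
  assumes "poly_time f" "poly_time g"
  shows "poly_time (\<lambda>x. eq_nat (f x) (g x))"
proof -
  have "poly_time (\<lambda>x. foldd eq_step (f x) (Node tt (g x)))"
  proof (rule poly_time_foldd[OF assms(1) _ , where K = "\<lambda>x. 3"])
    show "poly_time (\<lambda>z. eq_step (left (right z)) (right (right z)))"
      unfolding eq_step_def by (intro poly_time_intros)
    have *: "data_size (right d) \<le> data_size d" for d by (cases d) auto
    fix x y r show "data_size (eq_step y r) \<le> data_size r + 3"
      using *[of "right r"] by (cases r) (auto simp: eq_step_def cond_def)
  qed (intro poly_bounded_const poly_time_intros assms)+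
  then show ?thesis unfolding eq_nat_def by (intro poly_time_intros)
qed

text \<open>One pass gives both the binary length, in \<open>left\<close>, and the entries tagged
  with their indices, in reverse order. The length later serves as the encoded parameter and as a
  bit width.\<close>

definition number :: "data \<Rightarrow> data" where
  "number l = foldd (\<lambda>y r. Node (incr (left r)) (Node (Node (left r) y) (right r))) l tt"

lemma number_from_list:
  "number (from_list ys) = Node (enc_nat (length ys))
     (from_list (rev (map (\<lambda>i. Node (enc_nat i) (ys ! i)) [0..<length ys])))"
proof (induction ys rule: rev_induct)
  case Nil
  show ?case by (simp add: number_def)
next
  case (snoc y ys)
  have "number (from_list (ys @ [y])) = Node (incr (left (number (from_list ys))))
      (Node (Node (left (number (from_list ys))) y) (right (number (from_list ys))))"
    by (simp add: number_def foldd_def)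
  also have "\<dots> = Node (enc_nat (length (ys @ [y])))
     (from_list (rev (map (\<lambda>i. Node (enc_nat i) ((ys @ [y]) ! i)) [0..<length (ys @ [y])])))"
    by (auto simp: snoc nth_append intro!: arg_cong[where f = from_list])
  finally show ?case .
qed

lemma poly_time_number: "poly_time f \<Longrightarrow> poly_time (\<lambda>x. number (f x))"
proof (rule poly_time_comp[of number])
  \<comment> \<open>A round adds two cells, a counter of size at most
    \<open>1 + 4 * data_size x\<close> and an entry of size at most
    \<open>data_size x\<close>.\<close>
  define K where "K x = 3 + 5 * data_size x" for x
  have K: "poly_bounded K" unfolding K_def
    by (intro poly_bounded_add poly_bounded_mult poly_bounded_const poly_bounded_size)
  let ?I = "\<lambda>x i r. data_size (left r) \<le> 1 + 4 * i \<and>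
    data_size (right r) \<le> 1 + i * K x \<and> r \<noteq> Leaf"
  show "poly_time number" unfolding number_def
  proof (rule poly_time_foldd_invariant[where Inv = ?I
      and B = "\<lambda>x. 3 + 4 * data_size x + data_size x * K x",
      OF poly_time_id poly_time_const])
    fix x i r assume i: "i < length (to_list x)" and r: "?I x i r"
    have "data_size (incr (left r)) \<le> 1 + 4 * Suc i"
      using data_size_incr[of "left r"] r by simp
    moreover have "i \<le> data_size x" using i length_to_list_le[of x] by simp
    then have "data_size (left r) \<le> 1 + 4 * data_size x" using r by linarith
    ultimately show "?I x (Suc i) (Node (incr (left r)) (Node (Node (left r) (to_list x ! i)) (right r)))"
      using r size_nth_to_list[OF i] by (simp add: K_def)
  next
    fix x i r assume i: "i \<le> length (to_list x)" and r: "?I x i r"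
    have ix: "i \<le> data_size x" using i length_to_list_le[of x] by simp
    then have "i * K x \<le> data_size x * K x" by (rule mult_right_mono) simp
    moreover obtain p q where pq: "r = Node p q" using r by (cases r) auto
    ultimately show "data_size r \<le> 3 + 4 * data_size x + data_size x * K x"
      using r ix unfolding pq data_size.simps left.simps right.simps by linarith
  qed (auto intro!: poly_time_intros poly_time_incr poly_bounded_add poly_bounded_mult
      poly_bounded_const poly_bounded_size K)
qed

subsection \<open>Computable functions\<close>

text \<open>Used for the function of the parameter only, where termination counts and the time may
  be astronomical.\<close>

definition total_computable :: "(data \<Rightarrow> data) \<Rightarrow> bool" where
  "total_computable f \<longleftrightarrow> (\<exists>T. computes_within (\<lambda>_. True) f T)"

lemma poly_time_total_computable: "poly_time f \<Longrightarrow> total_computable f"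
  unfolding poly_time_def total_computable_def by blast

lemma total_computable_comp:
  "total_computable g \<Longrightarrow> total_computable f \<Longrightarrow> total_computable (\<lambda>x. g (f x))"
  unfolding total_computable_def by (blast intro: computes_within_comp)

lemma total_computable_Node:
  "total_computable f \<Longrightarrow> total_computable g \<Longrightarrow> total_computable (\<lambda>x. Node (f x) (g x))"
  unfolding total_computable_def by (blast intro: computes_within_Node)

text \<open>A terminating body makes a terminating fold: the total cost of all rounds, at the
  accumulators actually reached, bounds the cost of each single round.\<close>

lemma total_computable_foldd:
  assumes "total_computable l" "total_computable a"
    and "total_computable (\<lambda>z. g (left z) (left (right z)) (right (right z)))"
  shows "total_computable (\<lambda>x. foldd (g x) (l x) (a x))"
proof -
  obtain T where T: "computes_within (\<lambda>_. True) l T" using assms unfolding total_computable_def by blast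
  obtain U where U: "computes_within (\<lambda>_. True) a U" using assms unfolding total_computable_def by blast
  obtain V where V: "computes_within (\<lambda>_. True) (\<lambda>z. g (left z) (left (right z)) (right (right z))) V"
    using assms unfolding total_computable_def by blast
  define r where "r x i = fold (g x) (take i (to_list (l x))) (a x)" for x i
  define B where "B x = (\<Sum>i<length (to_list (l x)). V (Node x (Node (to_list (l x) ! i) (r x i))))" for x
  have "computes_within (\<lambda>_. True) (\<lambda>x. foldd (g x) (l x) (a x))
      (\<lambda>x. T x + U x + 6 + length (to_list (l x)) * (B x + 6))"
  proof (rule computes_within_foldd[OF T U V, where Inv = "\<lambda>x i s. s = r x i"])
    fix x i s assume i: "i < length (to_list (l x))" and s: "s = r x i"
    have "V (Node x (Node (to_list (l x) ! i) (r x i))) \<le> B x"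
      unfolding B_def by (rule member_le_sum) (use i in auto)
    moreover have "g x (to_list (l x) ! i) (r x i) = r x (Suc i)"
      using i by (simp add: r_def take_Suc_conv_app_nth)
    ultimately show "True \<and> V (Node x (Node (to_list (l x) ! i) s)) \<le> B x \<and>
        g x (to_list (l x) ! i) s = r x (Suc i)" using s by simp
  qed (simp add: r_def)
  then show ?thesis unfolding total_computable_def by blast
qed

lemma length_foldd_invariant:
  assumes "\<And>y r. length (to_list (g y r)) = F (length (to_list r))"
  shows "length (to_list (foldd g l a)) = (F ^^ length (to_list l)) (length (to_list a))"
  using assms by (induction l arbitrary: a) (simp_all add: funpow_swap1)

text \<open>Running through the bits, \<open>left\<close> is a list whose length is the current
  power of two, and \<open>right\<close> collects these lists for the bits that are set.\<close>

definition unary :: "data \<Rightarrow> data" where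
  "unary d = right (foldd (\<lambda>b r. Node (rev_append (left r) (left r))
     (cond b (rev_append (left r) (right r)) (right r))) d (Node tt Leaf))"

lemma length_rev_append [simp]:
  "length (to_list (rev_append l a)) = length (to_list l) + length (to_list a)"
  by (simp add: rev_append_conv)

lemma length_unary: "length (to_list (unary (enc_nat n))) = n"
proof -
  let ?g = "\<lambda>b r. Node (rev_append (left r) (left r))
     (cond b (rev_append (left r) (right r)) (right r))"
  have "length (to_list (right (foldd ?g (enc_nat n) (Node l a)))) =
      length (to_list a) + n * length (to_list l)" for l a
  proof (induction n arbitrary: l a rule: less_induct)
    case (less n)
    show ?case
    proof (cases "n = 0")
      case False
      have "n = 2 * (n div 2) \<or> n = 2 * (n div 2) + 1" by presburger
      then obtain m where "n = 2 * m \<or> n = 2 * m + 1" by blast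
      with False less.IH[of m] show ?thesis
        by (auto simp: enc_nat_pos cond_def algebra_simps)
    qed simp
  qed
  then show ?thesis by (simp add: unary_def)
qed

lemma total_computable_unary: "total_computable unary"
proof -
  have "total_computable (\<lambda>x. foldd (\<lambda>b r. Node (rev_append (left r) (left r))
     (cond b (rev_append (left r) (right r)) (right r))) x (Node tt Leaf))"
    by (intro total_computable_foldd poly_time_total_computable poly_time_intros)
  from total_computable_comp[OF poly_time_total_computable this, of right]
  show ?thesis
    unfolding unary_def using poly_time_right[OF poly_time_id] by simp
qed

text \<open>Starts from a list of length 2, and each round squares the length. Doubly exponential
  numbers thus arise as lengths without arithmetic, and \<open>number\<close> converts them to
  binary.\<close>

definition squarings :: "data \<Rightarrow> data" where
  "squarings u = foldd (\<lambda>_ r. flat_map (\<lambda>_. r) r) u (Node Leaf tt)"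

lemma length_squarings: "length (to_list (squarings u)) = 2 ^ 2 ^ length (to_list u)"
proof -
  have "length (to_list (flat_map (\<lambda>_. r) r)) = length (to_list r) ^ 2" for r
    by (simp add: flat_map_def length_concat comp_def sum_list_triv power2_eq_square)
  then have "length (to_list (squarings u)) = ((\<lambda>n. n\<^sup>2) ^^ length (to_list u)) 2"
    using length_foldd_invariant[of "\<lambda>_ r. flat_map (\<lambda>_. r) r" "\<lambda>n. n\<^sup>2" u "Node Leaf tt"]
    by (simp add: squarings_def flip: numeral_2_eq_2)
  also have "((\<lambda>n::nat. n\<^sup>2) ^^ m) 2 = 2 ^ 2 ^ m" for m
    by (induction m) (simp_all add: power_mult[symmetric] mult.commute)
  finally show ?thesis .
qed

lemma total_computable_squarings: "total_computable squarings"
  unfolding squarings_def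
  by (intro total_computable_foldd poly_time_total_computable poly_time_intros)

lemma computable_double_exponential:
  assumes "computable f"
  shows "computable (\<lambda>k. 2 ^ 2 ^ (c * (k + f k + 1)))"
proof -
  obtain p where p: "\<And>n. \<exists>t. runs p (enc_nat n) t (enc_nat (f n))"
    using assms unfolding computable_def by blast
  obtain g T m where g: "computes_within (\<lambda>d. \<exists>t out. runs p d t out) g (\<lambda>d. T d + m)"
    "\<forall>d t out. runs p d t out \<longrightarrow> g d = out \<and> T d = t"
    using computes_within_runs by blast
  have gf: "g (enc_nat n) = enc_nat (f n)" for n using p[of n] g(2) by blast
  \<comment> \<open>The final \<open>tt\<close> is a list with one entry and contributes the
    \<open>+ 1\<close>.\<close>
  let ?sum = "\<lambda>z. rev_append (left z) (rev_append (right z) tt)"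
  let ?mult = "\<lambda>u. flat_map (\<lambda>_. u) (from_list (replicate c Leaf))"
  let ?q = "\<lambda>z. left (number (squarings (?mult (?sum (Node (unary (left z)) (unary (right z)))))))"
  have "total_computable ?q"
  proof -
    have unary: "total_computable (\<lambda>z. Node (unary (left z)) (unary (right z)))"
      by (intro total_computable_Node total_computable_comp[OF total_computable_unary]
          poly_time_total_computable poly_time_intros)
    have "total_computable ?sum" "total_computable ?mult" "total_computable (\<lambda>x. left (number x))"
      by (intro poly_time_total_computable poly_time_intros poly_time_number)+
    note this(3)[THEN total_computable_comp, OF total_computable_squarings[THEN total_computable_comp,
      OF this(2)[THEN total_computable_comp, OF this(1)[THEN total_computable_comp, OF unary]]]]
    then show ?thesis .
  qed
  then obtain U where U: "computes_within (\<lambda>_. True) ?q U"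
    unfolding total_computable_def by blast
  \<comment> \<open>The program for \<open>f\<close> is known to halt on encoded numbers
    only.\<close>
  have "computes_within (\<lambda>d. d \<in> range enc_nat) g (\<lambda>d. T d + m)"
    by (rule computes_within_mono[OF g(1)]) (use p in blast)+
  from computes_within_comp[OF U computes_within_Node[OF computes_within_id this] TrueI]
  have "computes_within (\<lambda>d. d \<in> range enc_nat) (\<lambda>d. ?q (Node d (g d)))
    (\<lambda>d. 1 + (T d + m) + 4 + U (Node d (g d)))" .
  from runs_computes_within[OF this] obtain q where
    q: "\<And>n. \<exists>t. runs q (enc_nat n) t (?q (Node (enc_nat n) (g (enc_nat n))))" by blast
  have "?q (Node (enc_nat n) (g (enc_nat n))) = enc_nat (2 ^ 2 ^ (c * (n + f n + 1)))" for n
  proof -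
    have number: "left (number d) = enc_nat (length (to_list d))" for d
      using number_from_list[of "to_list d"] by simp
    have "length (to_list (?mult u)) = c * length (to_list u)" for u
      by (simp add: flat_map_def length_concat comp_def sum_list_triv sum_list_replicate)
    then show ?thesis by (simp add: number length_squarings gf length_unary)
  qed
  with q show ?thesis unfolding computable_def by metis
qed

subsection \<open>Token sliding and matchings\<close>

abbreviation slide_rel :: "('x \<Rightarrow> 'x \<Rightarrow> bool) \<Rightarrow> ('x set \<times> 'x set) set" where
  "slide_rel adj \<equiv> {(A, B). slide adj A B}"

lemma discovery_iff_relpow:
  "(\<exists>l C. l \<le> b \<and> discovery_sequence adj sol S l C) \<longleftrightarrow>
   (\<exists>l C. l \<le> b \<and> sol C \<and> (S, C) \<in> slide_rel adj ^^ l)"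
  unfolding discovery_sequence_def relpow_fun_conv by (auto; metis)

text \<open>\<open>d s\<close> is the length of some walk, not the distance. So tokens can exchange
  targets by splicing walks, without comparing shortest ones.\<close>

definition matching_cost ::
  "('x \<Rightarrow> 'x \<Rightarrow> bool) \<Rightarrow> 'x set \<Rightarrow> 'x set \<Rightarrow> ('x \<Rightarrow> 'x) \<Rightarrow> ('x \<Rightarrow> nat) \<Rightarrow> bool" where
  "matching_cost adj S C \<sigma> d \<longleftrightarrow>
     bij_betw \<sigma> S C \<and> (\<forall>s\<in>S. (s, \<sigma> s) \<in> {(y, x). adj y x} ^^ d s)"

text \<open>Serves both directions: with \<open>y = s\<close> a token gets a new target, with
  \<open>x = \<sigma> s\<close> it gets a new starting place.\<close>

lemma bij_betw_redirect:
  assumes "bij_betw \<sigma> S C" "s \<in> S" "y = s \<or> y \<notin> S" "x = \<sigma> s \<or> x \<notin> C"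
  shows "bij_betw (\<sigma>(y := x)) (insert y (S - {s})) (insert x (C - {\<sigma> s}))"
proof -
  have inj: "inj_on \<sigma> S" and C: "C = \<sigma> ` S" using assms(1) by (auto simp: bij_betw_def)
  have y: "y \<notin> S - {s}" using assms(3) by auto
  have x: "x \<noteq> \<sigma> z" if "z \<in> S" "z \<noteq> s" for z
    using that assms(2,4) inj by (auto simp: C inj_on_def)
  have "inj_on (\<sigma>(y := x)) (insert y (S - {s}))"
    using inj x y by (auto simp: inj_on_def)
  moreover have "\<sigma> ` S - {\<sigma> s} = \<sigma> ` (S - {s})"
    using inj assms(2) by (auto simp: inj_on_def)
  then have "(\<sigma>(y := x)) ` (insert y (S - {s})) = insert x (C - {\<sigma> s})"
    using y by (auto simp: C)
  ultimately show ?thesis by (simp add: bij_betw_def)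
qed

text \<open>Following the tokens, the last slide prolongs the walk of exactly one of them by one
  step.\<close>

lemma slides_matching:
  assumes "(S, C) \<in> slide_rel adj ^^ l" "finite S"
  shows "\<exists>\<sigma> d. matching_cost adj S C \<sigma> d \<and> sum d S = l"
  using assms(1)
proof (induction l arbitrary: C)
  case 0
  then show ?case
    by (intro exI[of _ id] exI[of _ "\<lambda>_. 0"]) (auto simp: matching_cost_def bij_betw_def)
next
  case (Suc l)
  then obtain D where D: "(S, D) \<in> slide_rel adj ^^ l" "slide adj D C" by auto
  then obtain \<sigma> d where \<sigma>: "bij_betw \<sigma> S D" "\<forall>s\<in>S. (s, \<sigma> s) \<in> {(y, x). adj y x} ^^ d s" "sum d S = l"
    using Suc.IH unfolding matching_cost_def by blast
  obtain y x where yx: "y \<in> D" "x \<notin> D" "adj y x" "C = insert x (D - {y})"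
    using D(2) unfolding slide_def by blast
  obtain s where s: "s \<in> S" "\<sigma> s = y" using \<sigma>(1) yx(1) by (auto simp: bij_betw_def)
  let ?\<sigma> = "\<sigma>(s := x)" and ?d = "d(s := Suc (d s))"
  have "bij_betw ?\<sigma> (insert s (S - {s})) (insert x (D - {\<sigma> s}))"
    by (rule bij_betw_redirect[OF \<sigma>(1) s(1)]) (use yx in auto)
  then have "bij_betw ?\<sigma> S C" using s yx by (simp add: insert_absorb)
  moreover have "\<forall>r\<in>S. (r, ?\<sigma> r) \<in> {(y, x). adj y x} ^^ ?d r"
    using \<sigma>(2) s yx(3) by auto
  moreover have "sum ?d S = Suc l"
    using \<sigma>(3) s assms(2) by (simp add: sum.remove[of S s])
  ultimately show ?case unfolding matching_cost_def by blast
qed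

text \<open>
  A token whose walk starts at an unoccupied neighbour slides there. If the neighbour is occupied,
  the two tokens exchange their targets at no extra cost and the token standing on the neighbour is
  now closer to the free target \<open>t\<close>; repeating this brings a token next to an unoccupied element.
\<close>

lemma matching_slides:
  assumes "finite S" "matching_cost adj S C \<sigma> d"
  shows "\<exists>l\<le>sum d S. (S, C) \<in> slide_rel adj ^^ l"
  using assms
proof (induction "sum d S" arbitrary: S \<sigma> d rule: less_induct)
  case outer: less
  let ?R = "{(y, x). adj y x}"
  have bij: "bij_betw \<sigma> S C" using outer.prems by (simp add: matching_cost_def)
  show ?case
  proof (cases "S = C")
    case True
    then show ?thesis by (intro exI[of _ 0]) simp
  next
    case False
    have "finite C" "card C = card S"
      using bij outer.prems(1) by (auto simp: bij_betw_finite bij_betw_same_card)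
    then obtain t where t: "t \<in> C" "t \<notin> S"
      using False outer.prems(1) by (metis card_subset_eq subsetI)
    obtain s where s: "s \<in> S" "\<sigma> s = t" using bij t by (auto simp: bij_betw_def)
    \<comment> \<open>The inner induction is on \<open>m\<close>, the remaining walk of the token
      that is bound for \<open>t\<close>. An exchange keeps the total \<open>n\<close> and lowers
      \<open>m\<close>; a slide lowers the total, and then the outer induction applies.\<close>
    have "\<exists>l\<le>n. (S, C) \<in> slide_rel adj ^^ l"
      if "matching_cost adj S C \<tau> e" "sum e S = n" "n = sum d S" "r \<in> S" "\<tau> r = t" "e r = m" for \<tau> e r m n
      using that
    proof (induction m arbitrary: \<tau> e r)
      case 0
      then have "(r, t) \<in> ?R ^^ 0" unfolding matching_cost_def by metis
      with 0 t show ?case by simp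
    next
      case (Suc m)
      have bij: "bij_betw \<tau> S C" and walk: "\<And>s. s \<in> S \<Longrightarrow> (s, \<tau> s) \<in> ?R ^^ e s"
        using Suc.prems by (auto simp: matching_cost_def)
      have "(r, t) \<in> ?R ^^ Suc m" using walk[of r] Suc.prems by metis
      from relpow_Suc_D2[OF this] obtain y where y: "adj r y" "(y, t) \<in> ?R ^^ m" by blast
      have sum_r: "n = Suc m + sum e (S - {r})"
        using Suc.prems outer.prems(1) by (simp add: sum.remove[of S r])
      have tau_ne: "\<tau> x \<noteq> t" if "x \<in> S" "x \<noteq> r" for x
        using that bij Suc.prems by (auto simp: bij_betw_def inj_on_def)
      consider "y \<notin> S" | "y = r" | "y \<in> S" "y \<noteq> r" by blast
      then show ?case
      proof cases
        case 1
        let ?S = "insert y (S - {r})" and ?\<tau> = "\<tau>(y := t)" and ?e = "e(y := m)"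
        have "bij_betw ?\<tau> ?S (insert t (C - {\<tau> r}))"
          by (rule bij_betw_redirect[OF bij Suc.prems(4)]) (use 1 Suc.prems(5) in auto)
        then have "matching_cost adj ?S C ?\<tau> ?e"
          using t y walk 1 Suc.prems(5) by (auto simp: matching_cost_def insert_absorb)
        moreover have sum1: "sum ?e ?S = m + sum e (S - {r})"
        proof -
          have "sum ?e (S - {r}) = sum e (S - {r})" using 1 by (intro sum.cong) auto
          then show ?thesis using 1 outer.prems(1) by simp
        qed
        ultimately obtain l where l: "l \<le> m + sum e (S - {r})" "(?S, C) \<in> slide_rel adj ^^ l"
          using outer.hyps[of ?e ?S ?\<tau>] sum_r Suc.prems(3) outer.prems(1) by auto
        have "slide adj S ?S" unfolding slide_def using 1 y Suc.prems(4) by blast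
        then have "(S, C) \<in> slide_rel adj ^^ Suc l" using l(2) by (intro relpow_Suc_I2) auto
        with l(1) sum_r show ?thesis by (intro exI[of _ "Suc l"]) simp
      next
        \<comment> \<open>As \<open>adj\<close> is arbitrary here, a walk may begin with a loop.
          Dropping it lowers the total.\<close>
        case 2
        let ?e = "e(r := m)"
        have "matching_cost adj S C \<tau> ?e"
          using bij walk y 2 Suc.prems by (auto simp: matching_cost_def)
        moreover have sum1: "sum ?e S = m + sum e (S - {r})"
          using Suc.prems(4) outer.prems(1) by (simp add: sum.remove[of S r])
        ultimately obtain l where "l \<le> m + sum e (S - {r})" "(S, C) \<in> slide_rel adj ^^ l"
          using outer.hyps[of ?e S \<tau>] sum_r Suc.prems(3) outer.prems(1) by auto
        with sum_r show ?thesis by (intro exI[of _ l]) simp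
      next
        case 3
        let ?p = "\<lambda>x. if x = r then y else if x = y then r else x"
        \<comment> \<open>The token on \<open>y\<close> inherits the remaining \<open>m\<close>
          steps to \<open>t\<close>. The token on \<open>r\<close> steps to \<open>y\<close> and
          continues along the former walk of \<open>y\<close>, hence
          \<open>Suc (e y)\<close>.\<close>
        let ?\<tau> = "\<tau>(y := t, r := \<tau> y)" and ?e = "e(y := m, r := Suc (e y))"
        have "bij_betw ?p S S"
          by (rule bij_betw_byWitness[of _ ?p]) (use 3 Suc.prems(4) in auto)
        from bij_betw_trans[OF this bij] have "bij_betw (\<tau> \<circ> ?p) S C" .
        also have "\<tau> \<circ> ?p = ?\<tau>" using 3 Suc.prems(5) by (auto simp: fun_eq_iff)
        finally have bij': "bij_betw ?\<tau> S C" .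
        have "(r, \<tau> y) \<in> ?R ^^ Suc (e y)"
          using y(1) walk[OF 3(1)] by (intro relpow_Suc_I2) auto
        then have "matching_cost adj S C ?\<tau> ?e"
          using bij' walk y 3 by (auto simp: matching_cost_def)
        moreover have "sum ?e S = n"
        proof -
          have "sum ?e S = ?e r + (?e y + sum ?e (S - {r} - {y}))"
            using 3 Suc.prems(4) outer.prems(1) by (simp add: sum.remove[of S r] sum.remove[of "S - {r}" y])
          also have "sum ?e (S - {r} - {y}) = sum e (S - {r} - {y})"
            by (intro sum.cong) auto
          also have "?e r + (?e y + sum e (S - {r} - {y})) = Suc m + (e y + sum e (S - {r} - {y}))"
            using 3 by simp
          also have "e y + sum e (S - {r} - {y}) = sum e (S - {r})"
            using 3 outer.prems(1) by (simp add: sum.remove[of "S - {r}" y])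
          finally show ?thesis unfolding sum_r .
        qed
        ultimately show ?thesis
          by (rule Suc.IH[where r = y]) (use Suc.prems(3) 3 in simp_all)
      qed
    qed
    from this[OF outer.prems(2) refl refl s refl] show ?thesis .
  qed
qed

subsection \<open>Separating families\<close>

text \<open>The functions in \<open>F\<close> need not be constant: a row fixes a token, but the
  weight still varies with the element. Colour and weight are selected together.\<close>

primrec select_family :: "('x \<Rightarrow> bool) set \<Rightarrow> ('x \<Rightarrow> 'y) set \<Rightarrow> nat \<Rightarrow> ('x \<Rightarrow> 'y) set" where
  "select_family B F 0 = F"
| "select_family B F (Suc m) =
     {\<lambda>x. if \<beta> x then f x else g x | \<beta> f g. \<beta> \<in> B \<and> f \<in> select_family B F m \<and> g \<in> select_family B F m}"

text \<open>A selection only copies values, so facts about shape and size pass from the rows to all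
  candidates.\<close>

lemma select_family_pointwise: "f \<in> select_family B F m \<Longrightarrow> \<exists>g\<in>F. f x = g x"
  by (induction m arbitrary: f) (auto split: if_splits)

text \<open>A bit that separates two elements of \<open>A\<close> splits it into two proper subsets,
  and one round fewer suffices for each. \<open>\<tau> x\<close> is the base function wanted at
  \<open>x\<close>.\<close>

lemma select_family_complete:
  assumes "finite A" "card A \<le> Suc m" "\<And>x. x \<in> A \<Longrightarrow> \<tau> x \<in> F" "F \<noteq> {}" "0 < m \<Longrightarrow> B \<noteq> {}"
    and "\<And>x y. x \<in> A \<Longrightarrow> y \<in> A \<Longrightarrow> x \<noteq> y \<Longrightarrow> \<exists>\<beta>\<in>B. \<beta> x \<noteq> \<beta> y"
  shows "\<exists>f\<in>select_family B F m. \<forall>x\<in>A. f x = \<tau> x x"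
  using assms
proof (induction m arbitrary: A)
  case 0
  show ?case
  proof (cases "A = {}")
    case True
    with 0 show ?thesis by auto
  next
    case False
    with 0 have "card A = 1" by (simp add: card_gt_0_iff le_antisym Suc_leI)
    then obtain x where "A = {x}" by (auto simp: card_1_singleton_iff)
    with 0 show ?thesis by auto
  qed
next
  case (Suc m)
  have IH: "\<exists>f\<in>select_family B F m. \<forall>x\<in>A'. f x = \<tau> x x" if "A' \<subseteq> A" "card A' \<le> Suc m" for A'
  proof (rule Suc.IH[OF _ that(2)])
    show "finite A'" using that(1) Suc.prems(1) by (rule finite_subset)
    show "\<exists>\<beta>\<in>B. \<beta> x \<noteq> \<beta> y" if "x \<in> A'" "y \<in> A'" "x \<noteq> y" for x y
      using that \<open>A' \<subseteq> A\<close> by (intro Suc.prems(6)) auto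
  qed (use that(1) Suc.prems(3-5) in auto)
  show ?case
  proof (cases "card A \<le> Suc m")
    case True
    with IH[of A] obtain f where f: "f \<in> select_family B F m" "\<forall>x\<in>A. f x = \<tau> x x" by blast
    \<comment> \<open>A set that is already small enough still has to pass through the round, so
      \<open>f\<close> is combined with itself along any bit.\<close>
    obtain \<beta> where \<beta>: "\<beta> \<in> B" using Suc.prems(5) by blast
    have "(\<lambda>x. if \<beta> x then f x else f x) \<in> select_family B F (Suc m)"
      unfolding select_family.simps using f(1) \<beta> by blast
    with f(2) show ?thesis by auto
  next
    case False
    then have "\<exists>x\<in>A. \<exists>y\<in>A. x \<noteq> y"
      using card_le_Suc0_iff_eq[OF Suc.prems(1)] by (metis le_SucI le0 Suc_le_mono le_trans)
    then obtain x y where xy: "x \<in> A" "y \<in> A" "x \<noteq> y" by blast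
    with Suc.prems(6) obtain \<beta> where \<beta>: "\<beta> \<in> B" "\<beta> x \<noteq> \<beta> y" by blast
    let ?P = "{z \<in> A. \<beta> z}" and ?N = "{z \<in> A. \<not> \<beta> z}"
    have "card ?P < card A" "card ?N < card A"
      using \<beta> xy by (intro psubset_card_mono Suc.prems(1); auto)+
    then have "card ?P \<le> Suc m" "card ?N \<le> Suc m" using Suc.prems(2) by linarith+
    with IH[of ?P] IH[of ?N] obtain f g where
      "f \<in> select_family B F m" "\<forall>x\<in>?P. f x = \<tau> x x"
      "g \<in> select_family B F m" "\<forall>x\<in>?N. g x = \<tau> x x" by auto
    with \<beta>(1) show ?thesis
      by (intro bexI[of _ "\<lambda>x. if \<beta> x then f x else g x"]) (simp, auto)
  qed
qed

text \<open>With q = L div m, one has L \<le> m (q + 1) \<le> m 2^q; now take the m-th power. This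
  trades a power of log n, with exponent depending on the parameter, for a factor in the parameter
  times a polynomial in n.\<close>

lemma power_le_exp: "(L::nat) ^ m \<le> m ^ m * 2 ^ L"
proof (cases "m = 0")
  case False
  have "L \<le> m * Suc (L div m)"
    using dividend_less_times_div[of m L] False by simp
  also have "\<dots> \<le> m * 2 ^ (L div m)"
    by (intro mult_left_mono) (simp_all add: Suc_leI)
  finally have "L ^ m \<le> (m * 2 ^ (L div m)) ^ m" by (rule power_mono) simp
  also have "\<dots> = m ^ m * 2 ^ (L div m * m)"
    by (simp add: power_mult_distrib power_mult)
  also have "\<dots> \<le> m ^ m * 2 ^ L"
    by (intro mult_left_mono power_increasing) simp_all
  finally show ?thesis .
qed simp

subsection \<open>Bit columns\<close>

text \<open>Transposes a list of binary numbers: each round splits off the lowest bits as a column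
  and shifts the rest, with \<open>c\<close> as round counter. Since \<open>left Leaf\<close> and
  \<open>right Leaf\<close> are \<open>Leaf\<close>, short numbers are padded with zeros.\<close>

definition bit_columns :: "data \<Rightarrow> data \<Rightarrow> data" where
  "bit_columns c l = right (foldd (\<lambda>_ r. Node (map_data right (left r))
     (Node (map_data left (left r)) (right r))) c (Node l Leaf))"

text \<open>The binary length of \<open>l\<close> has enough digits for all indices, so it can count
  the rounds. The reversal restores the order of the elements.\<close>

definition separators :: "data \<Rightarrow> data" where
  "separators l = bit_columns (left (number l)) (rev_append (map_data left (right (number l))) Leaf)"

lemma data_size_left_right: "data_size (left d) + data_size (right d) \<le> data_size d + 1"
  by (cases d) auto

lemma data_size_left: "data_size (left d) \<le> data_size d"
  by (cases d) auto

lemma data_size_right: "data_size (right d) \<le> data_size d"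
  by (cases d) auto

lemma data_size_map_data_le:
  assumes "\<And>y. data_size (h y) \<le> data_size y"
  shows "data_size (map_data h l) \<le> data_size l"
proof (induction l)
  case (Node a b)
  then show ?case using assms[of a] by (simp add: map_data_conv)
qed (simp add: map_data_conv)

lemma data_size_filter_data_le: "data_size (filter_data P l) \<le> data_size l"
  by (induction l) (auto simp: filter_data_conv)

lemma poly_time_bit_columns:
  assumes "poly_time f" "poly_time g"
  shows "poly_time (\<lambda>x. bit_columns (f x) (g x))"
proof -
  let ?M = "\<lambda>x. data_size (g x)"
  have "poly_time (\<lambda>x. foldd (\<lambda>_ r. Node (map_data right (left r))
     (Node (map_data left (left r)) (right r))) (f x) (Node (g x) Leaf))"
  proof (rule poly_time_foldd_invariant[where
      Inv = "\<lambda>x i r. data_size (left r) \<le> ?M x \<and> data_size (right r) \<le> 1 + i * (?M x + 1)"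
      and B = "\<lambda>x. 2 + ?M x + data_size (f x) * (?M x + 1)"])
    fix x i r
    assume r: "data_size (left r) \<le> ?M x \<and> data_size (right r) \<le> 1 + i * (?M x + 1)"
    have "data_size (map_data right (left r)) \<le> ?M x"
      "data_size (map_data left (left r)) \<le> ?M x"
      using data_size_map_data_le[of right "left r"] data_size_map_data_le[of left "left r"]
        data_size_left data_size_right r by force+
    with r show "data_size (left (Node (map_data right (left r)) (Node (map_data left (left r)) (right r))))
        \<le> ?M x \<and>
      data_size (right (Node (map_data right (left r)) (Node (map_data left (left r)) (right r))))
        \<le> 1 + Suc i * (?M x + 1)" by simp
  next
    fix x i r
    assume i: "i \<le> length (to_list (f x))"
      and r: "data_size (left r) \<le> ?M x \<and> data_size (right r) \<le> 1 + i * (?M x + 1)"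
    have "i * (?M x + 1) \<le> data_size (f x) * (?M x + 1)"
      using i length_to_list_le[of "f x"] by (intro mult_right_mono) auto
    moreover have "data_size r \<le> 1 + data_size (left r) + data_size (right r)" by (cases r) auto
    ultimately show "data_size r \<le> 2 + ?M x + data_size (f x) * (?M x + 1)" using r by linarith
  next
    show "poly_bounded (\<lambda>x. 2 + ?M x + data_size (f x) * (?M x + 1))"
      by (intro poly_bounded_add poly_bounded_mult poly_bounded_const poly_time_size assms)
    show "poly_time (\<lambda>z. Node (map_data right (left (right (right z))))
       (Node (map_data left (left (right (right z)))) (right (right (right z)))))"
      by (intro poly_time_intros)
  qed (auto intro: poly_time_intros assms)
  then show ?thesis unfolding bit_columns_def by (intro poly_time_intros)
qed

lemma poly_time_separators:
  assumes "poly_time f"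
  shows "poly_time (\<lambda>x. separators (f x))"
  unfolding separators_def
  by (intro poly_time_bit_columns poly_time_intros poly_time_number assms)

lemma upt_Suc_map: "[0..<Suc n] = 0 # map Suc [0..<n]"
  by (simp add: upt_conv_Cons map_Suc_upt del: upt_Suc)

lemma to_list_bit_columns:
  "to_list (bit_columns c l) =
     rev (map (\<lambda>j. map_data left ((map_data right ^^ j) l)) [0..<length (to_list c)])"
proof -
  have "to_list (right (foldd (\<lambda>_ r. Node (map_data right (left r))
     (Node (map_data left (left r)) (right r))) c (Node l a))) =
     rev (map (\<lambda>j. map_data left ((map_data right ^^ j) l)) [0..<length (to_list c)]) @ to_list a" for a
  proof (induction c arbitrary: l a)
    case (Node y c)
    then show ?case by (simp add: upt_Suc_map funpow_swap1 del: upt_Suc)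
  qed simp
  from this[of Leaf] show ?thesis by (simp add: bit_columns_def)
qed

lemma left_funpow_right_enc_nat: "left ((right ^^ j) (enc_nat n)) = enc_bool (odd (n div 2 ^ j))"
proof (induction j arbitrary: n)
  case 0
  show ?case by (cases "n = 0") (auto simp: enc_nat_pos enc_bool_def)
next
  case (Suc j)
  have "right (enc_nat n) = enc_nat (n div 2)" by (cases "n = 0") (auto simp: enc_nat_pos)
  with Suc[of "n div 2"] show ?case by (simp add: funpow_swap1 div_mult2_eq)
qed

lemma funpow_map_data_right: "(map_data right ^^ j) (from_list ys) = from_list (map (right ^^ j) ys)"
  by (induction j) (auto simp: map_data_conv comp_def)

definition position :: "'a list \<Rightarrow> 'a \<Rightarrow> nat" where
  "position ys y = (THE i. i < length ys \<and> ys ! i = y)"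

lemma position_nth: "distinct ys \<Longrightarrow> i < length ys \<Longrightarrow> position ys (ys ! i) = i"
  unfolding position_def by (rule the_equality) (auto simp: nth_eq_iff_index_eq)

lemma map_position: "distinct ys \<Longrightarrow> map (\<lambda>y. g (position ys y)) ys = map g [0..<length ys]"
  by (rule nth_equalityI) (auto simp: position_nth)

abbreviation bit_length :: "nat \<Rightarrow> nat" where
  "bit_length n \<equiv> length (to_list (enc_nat n))"

definition separating_bits :: "'a list \<Rightarrow> ('a \<Rightarrow> bool) set" where
  "separating_bits ys = (\<lambda>j y. odd (position ys y div 2 ^ j)) ` {..<bit_length (length ys)}"

definition tabulate :: "data list \<Rightarrow> (data \<Rightarrow> data) \<Rightarrow> data" where
  "tabulate ys f = from_list (map f ys)"

lemma to_list_separators: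
  assumes "distinct ys"
  shows "to_list (separators (from_list ys)) =
    rev (map (\<lambda>j. tabulate ys (\<lambda>y. enc_bool (odd (position ys y div 2 ^ j)))) [0..<bit_length (length ys)])"
proof -
  have "rev_append (map_data left (right (number (from_list ys)))) Leaf =
      from_list (map enc_nat [0..<length ys])"
    by (simp add: number_from_list map_data_conv rev_append_conv rev_map comp_def)
  then show ?thesis
    unfolding separators_def to_list_bit_columns
    by (simp add: number_from_list funpow_map_data_right map_data_conv tabulate_def comp_def
        left_funpow_right_enc_nat map_position[OF assms, of "\<lambda>i. enc_bool (odd (i div 2 ^ _))"])
qed

text \<open>The first bound guarantees enough bits to separate all indices; the second makes 2 to
  the number of bits linear in the input size.\<close>

lemma bit_length_bounds: "n < 2 ^ bit_length n \<and> (0 < n \<longrightarrow> 2 ^ bit_length n \<le> 2 * n)"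
proof (induction n rule: less_induct)
  case (less n)
  show ?case
  proof (cases "n \<le> 1")
    case True
    then show ?thesis by (cases n) (auto simp: enc_nat_pos)
  next
    case False
    then have "0 < n div 2" by simp
    with less.IH[of "n div 2"] False have
      "n div 2 < 2 ^ bit_length (n div 2)" "2 ^ bit_length (n div 2) \<le> 2 * (n div 2)" by auto
    then have "n < 2 * 2 ^ bit_length (n div 2)" "2 * 2 ^ bit_length (n div 2) \<le> 2 * n" by linarith+
    with False show ?thesis by (simp add: enc_nat_pos)
  qed
qed

lemma ex_bit_neq:
  "m < 2 ^ l \<Longrightarrow> n < 2 ^ l \<Longrightarrow> m \<noteq> n \<Longrightarrow> \<exists>j<l. odd (m div 2 ^ j) \<noteq> odd (n div 2 ^ j)" for m n :: nat
proof (induction l arbitrary: m n)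
  case (Suc l)
  show ?case
  proof (cases "odd m = odd n")
    case False
    then show ?thesis by (intro exI[of _ 0]) auto
  next
    case True
    with Suc.prems(3) have "m div 2 \<noteq> n div 2" by presburger
    moreover have "m div 2 < 2 ^ l" "n div 2 < 2 ^ l" using Suc.prems(1,2) by auto
    ultimately obtain j where
      "j < l" "odd (m div 2 div 2 ^ j) \<noteq> odd (n div 2 div 2 ^ j)" using Suc.IH by blast
    then show ?thesis by (intro exI[of _ "Suc j"]) (simp add: div_mult2_eq)
  qed
qed simp

lemma separating_bits_separate:
  assumes "distinct ys" "x \<in> set ys" "y \<in> set ys" "x \<noteq> y"
  shows "\<exists>\<beta>\<in>separating_bits ys. \<beta> x \<noteq> \<beta> y"
proof -
  obtain i j where ij: "i < length ys" "ys ! i = x" "j < length ys" "ys ! j = y"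
    using assms(2,3) by (auto simp: in_set_conv_nth)
  then have "i \<noteq> j" using assms(4) by auto
  moreover have "i < 2 ^ bit_length (length ys)" "j < 2 ^ bit_length (length ys)"
    using ij bit_length_bounds[of "length ys"] by linarith+
  ultimately obtain b where "b < bit_length (length ys)" "odd (i div 2 ^ b) \<noteq> odd (j div 2 ^ b)"
    using ex_bit_neq by blast
  with ij position_nth[OF assms(1)] show ?thesis unfolding separating_bits_def by force
qed

subsection \<open>Combining colourings\<close>

text \<open>A zip of three lists: the fold runs along the bits, and the accumulator holds the
  reversed output and the unread parts of both rows.\<close>

definition select_step :: "data \<Rightarrow> data \<Rightarrow> data" where
  "select_step b r = Node (Node (cond b (left (left (right r))) (left (right (right r)))) (left r))
     (Node (right (left (right r))) (right (right (right r))))"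

definition select :: "data \<Rightarrow> data \<Rightarrow> data \<Rightarrow> data" where
  "select b f g = rev_append (left (foldd select_step b (Node Leaf (Node f g)))) Leaf"

lemma select_tabulate:
  "select (tabulate ys b) (tabulate ys f) (tabulate ys g) = tabulate ys (\<lambda>y. cond (b y) (f y) (g y))"
proof -
  have "left (foldd select_step (tabulate ys b) (Node a (Node (tabulate ys f) (tabulate ys g)))) =
     from_list (rev (map (\<lambda>y. cond (b y) (f y) (g y)) ys) @ to_list a)" for a
    by (induction ys arbitrary: a) (auto simp: tabulate_def select_step_def)
  then show ?thesis by (simp add: select_def rev_append_conv tabulate_def)
qed

text \<open>The chosen head moves from a row to the output, so the total hardly changes. The 10
  leaves room for malformed accumulators, where \<open>left\<close> and \<open>right\<close> create
  additional leaves.\<close>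

lemma poly_time_select:
  assumes "poly_time b" "poly_time f" "poly_time g"
  shows "poly_time (\<lambda>x. select (b x) (f x) (g x))"
proof -
  have "poly_time (\<lambda>x. foldd select_step (b x) (Node Leaf (Node (f x) (g x))))"
  proof (rule poly_time_foldd[where K = "\<lambda>_. 10"])
    show "poly_time (\<lambda>z. select_step (left (right z)) (right (right z)))"
      unfolding select_step_def by (intro poly_time_intros)
    fix x y r
    show "data_size (select_step y r) \<le> data_size r + 10"
      using data_size_left_right[of r] data_size_left_right[of "right r"]
        data_size_left_right[of "left (right r)"] data_size_left_right[of "right (right r)"]
        data_size_left[of "left (right r)"] data_size_left[of "right (right r)"]
        data_size_right[of "left (right r)"] data_size_right[of "right (right r)"]
      by (simp add: select_step_def cond_def)
  qed (intro poly_time_intros assms poly_bounded_const)+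
  then show ?thesis unfolding select_def by (intro poly_time_intros)
qed

definition select_all :: "data \<Rightarrow> data \<Rightarrow> data" where
  "select_all bs fs = flat_map (\<lambda>b. flat_map (\<lambda>f. map_data (select b f) fs) fs) bs"

lemma poly_time_select_all:
  assumes "poly_time f" "poly_time g"
  shows "poly_time (\<lambda>x. select_all (f x) (g x))"
  unfolding select_all_def
  by (intro poly_time_intros poly_time_select poly_time_comp[OF assms(1)] poly_time_comp[OF assms(2)] assms)

lemma to_list_select_all:
  "to_list (select_all bs fs) = concat (map (\<lambda>b. concat (map (\<lambda>f. map (select b f) (to_list fs))
     (to_list fs))) (to_list bs))"
  by (simp add: select_all_def flat_map_def map_data_conv)

lemma length_select_all:
  "length (to_list (select_all bs fs)) = length (to_list bs) * length (to_list fs) ^ 2"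
  by (simp add: to_list_select_all length_concat comp_def sum_list_triv sum_list_replicate power2_eq_square)

lemma set_select_all:
  assumes ys: "distinct ys" and fs: "set (to_list fs) = tabulate ys ` \<F>"
  shows "set (to_list (select_all (separators (from_list ys)) fs)) =
    tabulate ys ` {\<lambda>x. if \<beta> x then f x else g x | \<beta> f g. \<beta> \<in> separating_bits ys \<and> f \<in> \<F> \<and> g \<in> \<F>}"
    (is "_ = tabulate ys ` ?G")
proof -
  have seps: "set (to_list (separators (from_list ys))) =
      (\<lambda>\<beta>. tabulate ys (\<lambda>y. enc_bool (\<beta> y))) ` separating_bits ys"
    by (auto simp: to_list_separators[OF ys] separating_bits_def)
  have sel: "select (tabulate ys (\<lambda>y. enc_bool (\<beta> y))) (tabulate ys f) (tabulate ys g) =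
      tabulate ys (\<lambda>x. if \<beta> x then f x else g x)" for \<beta> f g
    by (simp add: select_tabulate cond_def)
  have mem: "z \<in> set (to_list (select_all bs fs)) \<longleftrightarrow>
      (\<exists>b\<in>set (to_list bs). \<exists>f\<in>set (to_list fs). \<exists>g\<in>set (to_list fs). z = select b f g)" for z bs
    by (auto simp: to_list_select_all)
  show ?thesis
  proof (intro equalityI subsetI)
    fix z assume "z \<in> set (to_list (select_all (separators (from_list ys)) fs))"
    then obtain \<beta> f g where "\<beta> \<in> separating_bits ys" "f \<in> \<F>" "g \<in> \<F>"
      "z = tabulate ys (\<lambda>x. if \<beta> x then f x else g x)"
      by (auto simp: mem seps fs sel)
    then show "z \<in> tabulate ys ` ?G" by blast
  next
    fix z assume "z \<in> tabulate ys ` ?G"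
    then obtain \<beta> f g where "\<beta> \<in> separating_bits ys" "f \<in> \<F>" "g \<in> \<F>"
      "z = tabulate ys (\<lambda>x. if \<beta> x then f x else g x)" by blast
    then show "z \<in> set (to_list (select_all (separators (from_list ys)) fs))"
      unfolding mem seps fs by (auto simp: sel[symmetric])
  qed
qed

lemma select_all_iterate:
  assumes "distinct ys" "set (to_list fs) = tabulate ys ` \<F>"
  shows "set (to_list ((select_all (separators (from_list ys)) ^^ m) fs)) =
    tabulate ys ` select_family (separating_bits ys) \<F> m"
proof (induction m)
  case 0
  show ?case by (simp add: assms(2))
next
  case (Suc m)
  show ?case by (simp add: set_select_all[OF assms(1) Suc.IH])
qed

text \<open>The recurrence a' = l a^2 becomes pure squaring for the product l a.\<close>

lemma length_select_all_iterate:
  assumes "length (to_list bs) = l"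
  shows "l * length (to_list ((select_all bs ^^ m) fs)) = (l * length (to_list fs)) ^ 2 ^ m"
proof (induction m)
  case (Suc m)
  have "l * length (to_list ((select_all bs ^^ Suc m) fs)) =
      (l * length (to_list ((select_all bs ^^ m) fs))) ^ 2"
    by (simp add: length_select_all assms power2_eq_square mult_ac)
  then show ?case by (simp add: Suc power_mult[symmetric] mult.commute)
qed simp

lemma foldd_const: "foldd (\<lambda>_. g) l a = (g ^^ length (to_list l)) a"
  by (induction l arbitrary: a) (auto simp: funpow_swap1)

subsection \<open>Distances\<close>

lemma foldd_history:
  "to_list (foldd (\<lambda>_ r. Node (h (left r)) r) l (Node a Leaf)) =
     rev (map (\<lambda>i. (h ^^ i) a) [0..<Suc (length (to_list l))])"
proof -
  have *: "foldd (\<lambda>_ r. Node (h (left r)) r) l (Node a Leaf) =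
      ((\<lambda>r. Node (h (left r)) r) ^^ length (to_list l)) (Node a Leaf)"
    by (rule foldd_const)
  have "left (((\<lambda>r. Node (h (left r)) r) ^^ n) (Node a Leaf)) = (h ^^ n) a \<and>
      to_list (((\<lambda>r. Node (h (left r)) r) ^^ n) (Node a Leaf)) = rev (map (\<lambda>i. (h ^^ i) a) [0..<Suc n])" for n
    by (induction n) auto
  with * show ?thesis by simp
qed

text \<open>The value is the index of the first hit. Without a hit it is
  \<open>Suc b + length ys\<close>, so a value within the budget certifies a hit.\<close>

lemma weight_foldr:
  "\<exists>v. foldr (\<lambda>y w. cond (hit y) Leaf (incr w)) ys (enc_nat (Suc b)) = enc_nat v \<and>
     (v \<le> b \<longrightarrow> v < length ys \<and> hit (ys ! v) \<noteq> Leaf) \<and> (\<forall>j<length ys. hit (ys ! j) \<noteq> Leaf \<longrightarrow> v \<le> j)"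
proof (induction ys)
  case Nil
  show ?case by (intro exI[of _ "Suc b"]) simp
next
  case (Cons y ys)
  then obtain v where v: "foldr (\<lambda>y w. cond (hit y) Leaf (incr w)) ys (enc_nat (Suc b)) = enc_nat v"
    "v \<le> b \<longrightarrow> v < length ys \<and> hit (ys ! v) \<noteq> Leaf" "\<forall>j<length ys. hit (ys ! j) \<noteq> Leaf \<longrightarrow> v \<le> j"
    by blast
  show ?case
  proof (cases "hit y = Leaf")
    case True
    with v show ?thesis
      by (intro exI[of _ "Suc v"]) (auto simp: cond_def less_Suc_eq_0_disj)
  next
    case False
    then show ?thesis by (intro exI[of _ 0]) (auto simp: cond_def)
  qed
qed

subsection \<open>The reduction\<close>

lemma poly_time_comp3:
  assumes "poly_time (\<lambda>z. h (left z) (left (right z)) (right (right z)))"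
    "poly_time e" "poly_time f" "poly_time g"
  shows "poly_time (\<lambda>x. h (e x) (f x) (g x))"
  using poly_time_comp[OF assms(1) poly_time_Node[OF assms(2) poly_time_Node[OF assms(3,4)]]] by simp

text \<open>The encoded pair of a colour and the rational w/1: the two \<open>Leaf\<close>s after
  \<open>Node\<close> are signs and \<open>Node tt Leaf\<close> is the denominator 1.\<close>

definition entry :: "data \<Rightarrow> data \<Rightarrow> data" where
  "entry c w = Node c (Node (Node Leaf w) (Node Leaf (Node tt Leaf)))"

lemma entry_eq_iff [simp]: "entry c w = entry c' w' \<longleftrightarrow> c = c' \<and> w = w'"
  by (auto simp: entry_def)

lemma entry_conv: "entry (enc_nat c) (enc_nat w) = enc_prod enc_nat enc_rat (c, of_nat w)"
proof -
  have "quotient_of (of_nat w) = (int w, 1)"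
    by (simp add: of_nat_rat quotient_of_Fract Rat.normalize_def)
  moreover have "enc_nat 1 = Node tt Leaf" by (simp add: enc_nat_pos enc_bool_def)
  ultimately show ?thesis
    by (simp add: entry_def enc_prod_def enc_rat_def enc_int_def enc_bool_def)
qed

lemma enc_nat_eq_iff [simp]: "enc_nat m = enc_nat n \<longleftrightarrow> m = n"
  using eq_nat_iff[of m n] eq_nat_iff[of m m] by metis

text \<open>The last \<open>Leaf\<close> is the sign that turns the natural budget into an integer;
  the count of the tokens supplies the parameter.\<close>

definition rainbow_input :: "data \<Rightarrow> data \<Rightarrow> data" where
  "rainbow_input x f = Node (left x) (Node f
     (Node (left (number (left (right x)))) (Node Leaf (right (right x)))))"

lemma poly_time_rainbow_input:
  assumes "poly_time f" "poly_time g"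
  shows "poly_time (\<lambda>x. rainbow_input (f x) (g x))"
  unfolding rainbow_input_def by (intro poly_time_intros poly_time_number assms)

text \<open>
  An input is \<open>Node graph (Node tokens budget)\<close>. \<open>same x\<close> decides whether two trees denote the same
  vertex or edge of the input \<open>x\<close>, \<open>near x\<close> whether they denote equal or adjacent ones.
\<close>

locale element_access =
  fixes elements :: "data \<Rightarrow> data" and same near :: "data \<Rightarrow> data \<Rightarrow> data \<Rightarrow> data"
  assumes poly_time_elements: "poly_time elements"
    and data_size_elements: "data_size (elements x) \<le> data_size x"
    and poly_time_same: "poly_time (\<lambda>z. same (left z) (left (right z)) (right (right z)))"
    and poly_time_near: "poly_time (\<lambda>z. near (left z) (left (right z)) (right (right z)))"
begin

definition enlarge :: "data \<Rightarrow> data \<Rightarrow> data" where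
  "enlarge x B = filter_data (\<lambda>p. ex_data (\<lambda>q. near x q p) B) (elements x)"

text \<open>The balls around \<open>s\<close> by decreasing radius; the square of the number of elements is a radius
  from which on they are constant.\<close>

definition balls :: "data \<Rightarrow> data \<Rightarrow> data" where
  "balls x s = foldd (\<lambda>_ r. Node (enlarge x (left r)) r)
     (flat_map (\<lambda>_. elements x) (elements x)) (Node (Node s Leaf) Leaf)"

text \<open>
  The counter restarts at every ball that contains \<open>p\<close>. As the largest ball comes first, the result
  is the distance from \<open>s\<close> to \<open>p\<close>, and it exceeds the budget if \<open>p\<close> is not reachable.
\<close>

definition weight :: "data \<Rightarrow> data \<Rightarrow> data \<Rightarrow> data" where
  "weight x s p = foldd (\<lambda>B w. cond (ex_data (\<lambda>q. same x q p) B) Leaf (incr w)) (balls x s)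
     (incr (right (right x)))"

text \<open>The first row only serves inputs without tokens: its weights exceed the budget.\<close>

definition rows :: "data \<Rightarrow> data" where
  "rows x = Node (map_data (\<lambda>p. entry Leaf (incr (right (right x)))) (elements x))
     (map_data (\<lambda>t. map_data (\<lambda>p. entry (left t) (weight x (right t) p)) (elements x))
       (right (number (left (right x)))))"

definition candidates :: "data \<Rightarrow> data" where
  "candidates x = foldd (\<lambda>_. select_all (separators (elements x))) (left (right x)) (rows x)"

text \<open>Every enlarged ball is a sublist of the elements, so each round adds a bounded amount to
  the history.\<close>

lemma poly_time_balls:
  assumes "poly_time f" "poly_time g"
  shows "poly_time (\<lambda>x. balls (f x) (g x))"
proof (rule poly_time_comp2[OF _ assms])
  show "poly_time (\<lambda>z. balls (left z) (right z))"
    unfolding balls_def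
  proof (rule poly_time_foldd[where K = "\<lambda>z. 1 + data_size (elements (left z))"])
    show "poly_time (\<lambda>z. Node (enlarge (left (left z)) (left (right (right z)))) (right (right z)))"
      unfolding enlarge_def
      by (intro poly_time_intros poly_time_comp[OF poly_time_elements] poly_time_comp3[OF poly_time_near])
    show "poly_bounded (\<lambda>z. 1 + data_size (elements (left z)))"
      by (intro poly_bounded_add poly_bounded_const poly_time_size
          poly_time_comp[OF poly_time_elements] poly_time_intros)
    fix x y r
    show "data_size (Node (enlarge (left x) (left r)) r) \<le> data_size r + (1 + data_size (elements (left x)))"
      using data_size_filter_data_le by (simp add: enlarge_def)
  qed (intro poly_time_intros poly_time_comp[OF poly_time_elements])+
qed

lemma poly_time_weight:
  assumes "poly_time e" "poly_time f" "poly_time g"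
  shows "poly_time (\<lambda>x. weight (e x) (f x) (g x))"
proof (rule poly_time_comp3[OF _ assms])
  show "poly_time (\<lambda>z. weight (left z) (left (right z)) (right (right z)))"
    unfolding weight_def
  proof (rule poly_time_foldd[where K = "\<lambda>z. 4"])
    fix x y r
    show "data_size (cond (ex_data (\<lambda>q. same (left x) q (right (right x))) y) Leaf (incr r))
       \<le> data_size r + 4"
      using data_size_incr[of r] by (simp add: cond_def)
  qed (intro poly_time_intros poly_time_balls poly_time_incr poly_time_comp3[OF poly_time_same]
      poly_bounded_const)+
qed

lemma poly_time_rows: "poly_time rows"
  unfolding rows_def entry_def
  by (intro poly_time_intros poly_time_incr poly_time_number poly_time_weight
      poly_time_comp[OF poly_time_elements])

lemma set_rows:
  assumes "elements x = from_list ds" "left (right x) = from_list ts"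
  shows "set (to_list (rows x)) = tabulate ds ` insert (\<lambda>p. entry Leaf (incr (right (right x))))
     ((\<lambda>i p. entry (enc_nat i) (weight x (ts ! i) p)) ` {..<length ts})"
  by (auto simp: rows_def map_data_conv assms number_from_list tabulate_def image_image lessThan_atLeast0)

lemma length_rows: "length (to_list (rows x)) = Suc (length (to_list (left (right x))))"
proof -
  have "length (to_list (right (number (from_list ts)))) = length ts" for ts
    by (simp add: number_from_list)
  from this[of "to_list (left (right x))"] show ?thesis by (simp add: rows_def map_data_conv)
qed

lemma candidates_conv:
  "candidates x = (select_all (separators (elements x)) ^^ length (to_list (left (right x)))) (rows x)"
  unfolding candidates_def by (rule foldd_const)

end

text \<open>\<open>rep\<close> yields the vertex or edge that a tree denotes. It is injective on
  \<open>ds\<close> and on \<open>ts\<close> separately, but a token may list an edge with its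
  endpoints swapped, so elements and tokens are compared through \<open>rep\<close>.\<close>

locale presented_instance = element_access +
  fixes x :: data and rep :: "data \<Rightarrow> 'x" and ds ts :: "data list" and b :: nat
    and adj :: "'x \<Rightarrow> 'x \<Rightarrow> bool" and X S :: "'x set"
  assumes elements: "elements x = from_list ds" and distinct_elements: "distinct (map rep ds)"
    and X: "X = rep ` set ds"
    and tokens: "left (right x) = from_list ts" and distinct_tokens: "distinct (map rep ts)"
    and S: "S = rep ` set ts" "S \<subseteq> X"
    and budget: "right (right x) = enc_nat b"
    and same_iff: "\<And>p q. p \<in> set ds \<Longrightarrow> q \<in> set ds \<union> set ts \<Longrightarrow> same x q p \<noteq> Leaf \<longleftrightarrow> rep q = rep p"
    and near_iff: "\<And>p q. p \<in> set ds \<Longrightarrow> q \<in> set ds \<union> set ts \<Longrightarrow>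
      near x q p \<noteq> Leaf \<longleftrightarrow> rep q = rep p \<or> adj (rep q) (rep p)"
    and adj: "\<And>y z. adj y z \<Longrightarrow> y \<in> X \<and> z \<in> X"
begin

abbreviation R :: "('x \<times> 'x) set" where
  "R \<equiv> {(y, z). adj y z}"

lemma walk_in_X: "(y, z) \<in> R ^^ j \<Longrightarrow> y \<in> X \<Longrightarrow> z \<in> X"
  using adj by (cases j) auto

text \<open>The initial ball holds the tree of the token itself, which may differ from the tree in
  \<open>ds\<close> for the same element; hence the union with \<open>set ts\<close>.\<close>

lemma enlarge_iterate:
  assumes "s \<in> set ts"
  shows "set (to_list ((enlarge x ^^ i) (Node s Leaf))) \<subseteq> set ds \<union> set ts \<and>
    rep ` set (to_list ((enlarge x ^^ i) (Node s Leaf))) = {y. \<exists>j\<le>i. (rep s, y) \<in> R ^^ j}"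
proof (induction i)
  case 0
  show ?case using assms by auto
next
  case (Suc i)
  let ?B = "set (to_list ((enlarge x ^^ i) (Node s Leaf)))"
  have sub: "?B \<subseteq> set ds \<union> set ts" and rep: "rep ` ?B = {y. \<exists>j\<le>i. (rep s, y) \<in> R ^^ j}"
    using Suc by auto
  have sX: "rep s \<in> X" using assms S by auto
  have eq: "set (to_list ((enlarge x ^^ Suc i) (Node s Leaf))) =
      {p \<in> set ds. \<exists>q\<in>?B. rep q = rep p \<or> adj (rep q) (rep p)}"
    using near_iff sub by (auto simp: enlarge_def filter_data_conv ex_data_iff elements)
  have "rep ` {p \<in> set ds. \<exists>q\<in>?B. rep q = rep p \<or> adj (rep q) (rep p)} =
      {y. \<exists>j\<le>Suc i. (rep s, y) \<in> R ^^ j}" (is "?L = ?R")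
  proof (intro equalityI subsetI)
    fix y assume "y \<in> ?L"
    then obtain q where q: "q \<in> ?B" "rep q = y \<or> adj (rep q) y" by auto
    then obtain j where j: "j \<le> i" "(rep s, rep q) \<in> R ^^ j" using rep by blast
    from q(2) show "y \<in> ?R"
    proof
      assume "rep q = y"
      with j show ?thesis by (auto intro: exI[of _ j])
    next
      assume "adj (rep q) y"
      with j(2) have "(rep s, y) \<in> R ^^ Suc j" by auto
      with j(1) show ?thesis by (intro CollectI exI[of _ "Suc j"]) simp
    qed
  next
    fix y assume "y \<in> ?R"
    then obtain j where j: "j \<le> Suc i" "(rep s, y) \<in> R ^^ j" by blast
    have "y \<in> X" using walk_in_X[OF j(2) sX] .
    then obtain p where p: "p \<in> set ds" "rep p = y" using X by auto
    have "\<exists>z\<in>rep ` ?B. z = y \<or> adj z y"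
    proof (cases "j = Suc i")
      case True
      with j(2) obtain z where "(rep s, z) \<in> R ^^ i" "adj z y" by auto
      then show ?thesis unfolding rep by blast
    next
      case False
      with j show ?thesis unfolding rep by (auto simp: le_Suc_eq)
    qed
    with p show "y \<in> ?L" by blast
  qed
  with eq show ?case by auto
qed

text \<open>Characterises the distance by two inequalities, so that unreachable elements, with
  \<open>v\<close> beyond the budget, need no case of their own.\<close>

lemma weight_spec:
  assumes s: "s \<in> set ts" and p: "p \<in> set ds"
  shows "\<exists>v. weight x s p = enc_nat v \<and> (v \<le> b \<longrightarrow> (\<exists>j\<le>v. (rep s, rep p) \<in> R ^^ j)) \<and>
    (\<forall>j. (rep s, rep p) \<in> R ^^ j \<longrightarrow> v \<le> j)"
proof -
  define B where "B i = (enlarge x ^^ i) (Node s Leaf)" for i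
  define M where "M = length ds * length ds"
  let ?hit = "\<lambda>B. ex_data (\<lambda>q. same x q p) B"
  have balls: "to_list (balls x s) = rev (map B [0..<Suc M])"
    unfolding balls_def foldd_history B_def M_def
    by (simp add: elements flat_map_def length_concat comp_def sum_list_triv)
  have hit: "?hit (B i) \<noteq> Leaf \<longleftrightarrow> (\<exists>j\<le>i. (rep s, rep p) \<in> R ^^ j)" for i
  proof -
    have sub: "set (to_list (B i)) \<subseteq> set ds \<union> set ts" using enlarge_iterate[OF s, of i] by (simp add: B_def)
    have "?hit (B i) \<noteq> Leaf \<longleftrightarrow> (\<exists>q\<in>set (to_list (B i)). rep q = rep p)"
      unfolding ex_data_iff by (intro bex_cong refl same_iff[OF p]) (use sub in blast)
    also have "\<dots> \<longleftrightarrow> rep p \<in> rep ` set (to_list (B i))" by (simp add: image_iff eq_commute)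
    finally have "?hit (B i) \<noteq> Leaf \<longleftrightarrow> rep p \<in> rep ` set (to_list (B i))" .
    then show ?thesis using enlarge_iterate[OF s, of i] by (simp add: B_def)
  qed
  have fold: "weight x s p = foldr (\<lambda>B w. cond (?hit B) Leaf (incr w)) (map B [0..<Suc M]) (enc_nat (Suc b))"
    by (simp add: weight_def foldd_def balls budget foldr_conv_fold del: upt_Suc)
  obtain v where v: "weight x s p = enc_nat v"
      "v \<le> b \<longrightarrow> v < Suc M \<and> ?hit (B v) \<noteq> Leaf" "\<forall>j<Suc M. ?hit (B j) \<noteq> Leaf \<longrightarrow> v \<le> j"
    using weight_foldr[of ?hit "map B [0..<Suc M]" b] unfolding fold
    by (auto simp del: upt_Suc)
  have "v \<le> j" if j: "(rep s, rep p) \<in> R ^^ j" for j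
  proof (cases "j \<le> M")
    case True
    with v(3) hit[of j] j show ?thesis by auto
  next
    case False
    \<comment> \<open>Any walk can be shortened to at most \<open>card R\<close> steps, and
      \<open>R\<close> has at most \<open>M\<close> pairs, so radius \<open>M\<close> misses
      nothing.\<close>
    have sub: "R \<subseteq> X \<times> X" using adj by auto
    have "finite X" "card X = length ds"
      using X distinct_elements by (auto simp: distinct_card[of "map rep ds", simplified])
    then have R: "finite R" "card R \<le> M"
      using finite_subset[OF sub] card_mono[OF _ sub] by (auto simp: M_def card_cartesian_product)
    obtain i where "i \<le> card R" "(rep s, rep p) \<in> R ^^ i"
      using subsetD[OF relpow_finite_bounded[OF R(1)] j] by blast
    with R(2) have "i \<le> M" "(rep s, rep p) \<in> R ^^ i" by auto
    with v(3) hit[of i] have "v \<le> i" by auto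
    with \<open>i \<le> M\<close> False show ?thesis by simp
  qed
  with v hit[of v] show ?thesis by blast
qed

lemma set_candidates:
  "set (to_list (candidates x)) = tabulate ds ` select_family (separating_bits ds)
     (insert (\<lambda>p. entry Leaf (enc_nat (Suc b)))
       ((\<lambda>i p. entry (enc_nat i) (weight x (ts ! i) p)) ` {..<length ts})) (length ts)"
proof -
  have "distinct ds" using distinct_elements by (simp add: distinct_map)
  from select_all_iterate[OF this set_rows[OF elements tokens]]
  show ?thesis by (simp add: candidates_conv elements tokens budget)
qed

text \<open>Each value comes from a row and therefore encodes natural numbers. Injectivity of
  \<open>rep\<close> on \<open>ds\<close> turns functions of trees into functions of elements, as an
  instance demands.\<close>

lemma candidate_shape:
  assumes "f \<in> set (to_list (candidates x))"
  shows "\<exists>colour wt. f = tabulate ds (\<lambda>p. entry (enc_nat (colour (rep p))) (enc_nat (wt (rep p))))"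
proof -
  obtain \<phi> where f: "f = tabulate ds \<phi>" and \<phi>: "\<phi> \<in> select_family (separating_bits ds)
     (insert (\<lambda>p. entry Leaf (enc_nat (Suc b)))
       ((\<lambda>i p. entry (enc_nat i) (weight x (ts ! i) p)) ` {..<length ts})) (length ts)"
    using assms unfolding set_candidates by blast
  have "\<exists>c w. \<phi> p = entry (enc_nat c) (enc_nat w)" if p: "p \<in> set ds" for p
  proof -
    from select_family_pointwise[OF \<phi>, of p]
    consider "\<phi> p = entry (enc_nat 0) (enc_nat (Suc b))"
      | i where "i < length ts" "\<phi> p = entry (enc_nat i) (weight x (ts ! i) p)" by auto
    then show ?thesis
    proof cases
      case (2 i)
      with weight_spec[OF nth_mem[OF 2(1)] p] show ?thesis by metis
    qed blast
  qed
  then obtain c w where cw: "\<And>p. p \<in> set ds \<Longrightarrow> \<phi> p = entry (enc_nat (c p)) (enc_nat (w p))"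
    by metis
  have inj: "inj_on rep (set ds)" using distinct_elements by (simp add: distinct_map)
  let ?inv = "the_inv_into (set ds) rep"
  have "f = tabulate ds (\<lambda>p. entry (enc_nat ((c \<circ> ?inv) (rep p))) (enc_nat ((w \<circ> ?inv) (rep p))))"
    unfolding f tabulate_def
    by (intro arg_cong[where f = from_list] map_cong refl) (simp add: cw the_inv_into_f_f[OF inj])
  then show ?thesis by blast
qed

lemma card_S: "card S = length ts"
  using distinct_card[OF distinct_tokens] S by simp

text \<open>From discovery to rainbow, colour each element of \<open>C\<close> by the token that
  arrives there; some candidate agrees with this on \<open>C\<close>. Conversely, distinct colours
  on as many elements as tokens give a bijection, and the weights bound its walks.\<close>

lemma candidates_correct:
  assumes shape: "\<And>f. f \<in> set (to_list (candidates x)) \<Longrightarrow>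
    f = tabulate ds (\<lambda>p. entry (enc_nat (colour f (rep p))) (enc_nat (wt f (rep p))))"
  shows "(\<exists>l C. l \<le> b \<and> discovery_sequence adj sol S l C) \<longleftrightarrow>
    (\<exists>f\<in>set (to_list (candidates x)). \<exists>C.
      rainbow_solution X sol (colour f) (\<lambda>v. real (wt f v)) (card S) (int b) C)"
    (is "?discovery \<longleftrightarrow> ?rainbow")
proof
  have finS: "finite S" and finX: "finite X" using S X by auto
  let ?F = "insert (\<lambda>p. entry Leaf (enc_nat (Suc b)))
       ((\<lambda>i p. entry (enc_nat i) (weight x (ts ! i) p)) ` {..<length ts})"
  have token_inj: "rep (ts ! i) = rep (ts ! j) \<longleftrightarrow> i = j" if "i < length ts" "j < length ts" for i j
    using nth_eq_iff_index_eq[OF distinct_tokens, of i j] that by simp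
  have shape': "\<phi> p = entry (enc_nat (colour f (rep p))) (enc_nat (wt f (rep p)))"
    if "f = tabulate ds \<phi>" "f \<in> set (to_list (candidates x))" "p \<in> set ds" for f \<phi> p
  proof -
    have "to_list (tabulate ds \<phi>) =
        to_list (tabulate ds (\<lambda>p. entry (enc_nat (colour f (rep p))) (enc_nat (wt f (rep p)))))"
      using shape[OF that(2)] that(1) by simp
    then show ?thesis using that(3) by (simp add: tabulate_def)
  qed
  show ?rainbow if ?discovery
  proof -
    obtain l C where l: "l \<le> b" "sol C" "(S, C) \<in> slide_rel adj ^^ l"
      using \<open>?discovery\<close> unfolding discovery_iff_relpow by blast
    from slides_matching[OF l(3) finS] obtain \<sigma> d where
      \<sigma>: "bij_betw \<sigma> S C" "\<And>s. s \<in> S \<Longrightarrow> (s, \<sigma> s) \<in> R ^^ d s" and d: "sum d S = l"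
      unfolding matching_cost_def by blast
    have CX: "C \<subseteq> X"
    proof
      fix v assume "v \<in> C"
      then obtain s where "s \<in> S" "v = \<sigma> s" using \<sigma>(1) by (auto simp: bij_betw_def)
      with walk_in_X[OF \<sigma>(2)] S(2) show "v \<in> X" by auto
    qed
    have "\<exists>i<length ts. \<sigma> (rep (ts ! i)) = v" if "v \<in> C" for v
      using that \<sigma>(1) S by (fastforce simp: bij_betw_def in_set_conv_nth)
    then obtain t where t: "\<And>v. v \<in> C \<Longrightarrow> t v < length ts" "\<And>v. v \<in> C \<Longrightarrow> \<sigma> (rep (ts ! t v)) = v"
      by metis
    let ?A = "{p \<in> set ds. rep p \<in> C}"
    have cardC: "card C = length ts" using bij_betw_same_card[OF \<sigma>(1)] card_S by simp
    have "card ?A \<le> card C"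
      using distinct_elements CX finX
      by (intro card_inj_on_le[of rep]) (auto simp: distinct_map intro: finite_subset inj_on_subset)
    then have "\<exists>f\<in>select_family (separating_bits ds) ?F (length ts). \<forall>p\<in>?A. f p =
        (\<lambda>q. entry (enc_nat (t (rep p))) (weight x (ts ! t (rep p)) q)) p"
    proof (intro select_family_complete[where \<tau> =
        "\<lambda>p q. entry (enc_nat (t (rep p))) (weight x (ts ! t (rep p)) q)"])
      show "separating_bits ds \<noteq> {}" if "0 < length ts"
      proof -
        have "ds \<noteq> []" using that S X by auto
        then have "0 < bit_length (length ds)" by (cases ds) (auto simp: enc_nat_pos)
        then show ?thesis by (auto simp: separating_bits_def)
      qed
      fix p q assume "p \<in> ?A" "q \<in> ?A" "p \<noteq> q"
      then show "\<exists>\<beta>\<in>separating_bits ds. \<beta> p \<noteq> \<beta> q"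
        using distinct_elements by (intro separating_bits_separate) (auto simp: distinct_map)
    qed (use t cardC in auto)
    then obtain \<phi> where \<phi>: "\<phi> \<in> select_family (separating_bits ds) ?F (length ts)"
      "\<And>p. p \<in> set ds \<Longrightarrow> rep p \<in> C \<Longrightarrow> \<phi> p = entry (enc_nat (t (rep p))) (weight x (ts ! t (rep p)) p)"
      by auto
    define f where "f = tabulate ds \<phi>"
    have f: "f \<in> set (to_list (candidates x))" unfolding set_candidates f_def using \<phi>(1) by blast
    have cw: "colour f v = t v \<and> wt f v \<le> d (rep (ts ! t v))" if v: "v \<in> C" for v
    proof -
      obtain p where p: "p \<in> set ds" "rep p = v" using v CX X by auto
      have eq: "entry (enc_nat (t v)) (weight x (ts ! t v) p) = entry (enc_nat (colour f v)) (enc_nat (wt f v))"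
        using trans[OF \<phi>(2)[OF p(1), symmetric] shape'[OF f_def f p(1)]] unfolding p(2) using v by blast
      have tv: "ts ! t v \<in> set ts" using t(1)[OF v] by simp
      then have "(rep (ts ! t v), rep p) \<in> R ^^ d (rep (ts ! t v))"
        using \<sigma>(2)[of "rep (ts ! t v)"] t(2)[OF v] p(2) S by simp
      with weight_spec[OF tv p(1)] eq show ?thesis by auto
    qed
    have "inj_on (colour f) C" using cw t by (metis inj_onI)
    moreover have "(\<Sum>v\<in>C. wt f v) \<le> b"
    proof -
      have "(\<Sum>v\<in>C. wt f v) = (\<Sum>s\<in>S. wt f (\<sigma> s))" by (rule sum.reindex_bij_betw[OF \<sigma>(1), symmetric])
      also have "\<dots> \<le> sum d S"
      proof (rule sum_mono)
        fix s assume s: "s \<in> S"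
        then have v: "\<sigma> s \<in> C" using \<sigma>(1) by (auto simp: bij_betw_def)
        have "rep (ts ! t (\<sigma> s)) = s"
          using t[OF v] s \<sigma>(1) S by (auto simp: bij_betw_def inj_on_def)
        with cw[OF v] show "wt f (\<sigma> s) \<le> d s" by simp
      qed
      finally show ?thesis using d l(1) by simp
    qed
    then have "real (\<Sum>v\<in>C. wt f v) \<le> real b" by (rule of_nat_mono)
    ultimately show ?thesis
      using f l(2) CX cardC card_S unfolding rainbow_solution_def by (auto intro!: bexI[of _ f] exI[of _ C])
  qed
  show ?discovery if ?rainbow
  proof -
    obtain f C where f: "f \<in> set (to_list (candidates x))" and CX: "C \<subseteq> X" and sol: "sol C"
      and card: "card C = length ts" and inj: "inj_on (colour f) C"
      and "(\<Sum>v\<in>C. real (wt f v)) \<le> real b"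
      using \<open>?rainbow\<close> card_S unfolding rainbow_solution_def by auto
    then have sum: "(\<Sum>v\<in>C. wt f v) \<le> b" by (simp flip: of_nat_sum)
    have finC: "finite C" using CX finX by (rule finite_subset)
    obtain \<phi> where \<phi>: "f = tabulate ds \<phi>" "\<phi> \<in> select_family (separating_bits ds) ?F (length ts)"
      using f unfolding set_candidates by blast
    have "colour f v < length ts \<and> (\<exists>j\<le>wt f v. (rep (ts ! colour f v), v) \<in> R ^^ j)" if v: "v \<in> C" for v
    proof -
      obtain p where p: "p \<in> set ds" "rep p = v" using v CX X by auto
      \<comment> \<open>Each single weight is within the budget, which rules out the extra row of
        weight \<open>b + 1\<close> and lets \<open>weight_spec\<close> provide a walk.\<close>
      have le: "wt f v \<le> b" using member_le_sum[OF v, of "wt f"] finC sum by simp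
      have "\<phi> p = entry (enc_nat (colour f v)) (enc_nat (wt f v))"
        using shape'[OF \<phi>(1) f p(1)] p(2) by simp
      with select_family_pointwise[OF \<phi>(2), of p] le obtain i where
        i: "i < length ts" "enc_nat (colour f v) = enc_nat i" "enc_nat (wt f v) = weight x (ts ! i) p"
        by auto
      with weight_spec[OF nth_mem[OF i(1)] p(1)] le p(2) show ?thesis by auto
    qed
    then obtain j where col: "\<And>v. v \<in> C \<Longrightarrow> colour f v < length ts"
      and j: "\<And>v. v \<in> C \<Longrightarrow> j v \<le> wt f v" "\<And>v. v \<in> C \<Longrightarrow> (rep (ts ! colour f v), v) \<in> R ^^ j v"
      by metis
    let ?h = "\<lambda>v. rep (ts ! colour f v)"
    have "inj_on ?h C" using inj col token_inj by (auto simp: inj_on_def)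
    moreover have "?h ` C \<subseteq> S" using col S by auto
    ultimately have h: "bij_betw ?h C S"
      using card card_S finS by (simp add: bij_betw_def card_subset_eq card_image)
    let ?\<sigma> = "the_inv_into C ?h"
    have \<sigma>: "bij_betw ?\<sigma> S C" by (rule bij_betw_the_inv_into[OF h])
    have "matching_cost adj S C ?\<sigma> (j \<circ> ?\<sigma>)"
      unfolding matching_cost_def
    proof (intro conjI \<sigma> ballI)
      fix s assume s: "s \<in> S"
      then have "?\<sigma> s \<in> C" using \<sigma> by (auto simp: bij_betw_def)
      moreover have "?h (?\<sigma> s) = s" using f_the_inv_into_f_bij_betw[OF h] s by blast
      ultimately show "(s, ?\<sigma> s) \<in> R ^^ (j \<circ> ?\<sigma>) s" using j(2)[of "?\<sigma> s"] by simp
    qed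
    from matching_slides[OF finS this] obtain l where l: "l \<le> sum (j \<circ> ?\<sigma>) S" "(S, C) \<in> slide_rel adj ^^ l"
      by blast
    have "sum (j \<circ> ?\<sigma>) S = sum j C" using sum.reindex_bij_betw[OF \<sigma>, of j] by simp
    also have "\<dots> \<le> sum (wt f) C" by (rule sum_mono) (rule j(1))
    finally have "l \<le> b" using l(1) sum by simp
    with l(2) sol show ?thesis unfolding discovery_iff_relpow by blast
  qed
qed

end

subsection \<open>Running time\<close>

lemma FPT_I:
  assumes "computes_within (\<lambda>d. \<exists>k a. (d, k, a) \<in> P) g T" "computable f"
    and "\<And>d k a. (d, k, a) \<in> P \<Longrightarrow> T d \<le> f k * data_size d ^ c \<and> (g d \<noteq> Leaf \<longleftrightarrow> a)"
  shows "FPT P"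
proof -
  obtain p where "\<And>d. \<exists>k a. (d, k, a) \<in> P \<Longrightarrow> \<exists>t. runs p d t (g d) \<and> t \<le> T d"
    using runs_computes_within[OF assms(1)] by blast
  then have "\<exists>t out. runs p d t out \<and> t \<le> f k * data_size d ^ c \<and> (out \<noteq> Leaf \<longleftrightarrow> a)"
    if "(d, k, a) \<in> P" for d k a
    using assms(3)[OF that] that by (meson le_trans)
  with assms(2) show ?thesis unfolding FPT_def by blast
qed

lemma FPT_E:
  assumes "FPT P"
  obtains g T n f c where "computes_within (\<lambda>d. \<exists>k a. (d, k, a) \<in> P) g (\<lambda>d. T d + n)" "computable f"
    "\<And>d k a. (d, k, a) \<in> P \<Longrightarrow> T d \<le> f k * data_size d ^ c \<and> (g d \<noteq> Leaf \<longleftrightarrow> a)"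
proof -
  obtain p f c where f: "computable f" and p: "\<forall>(d, k, answer) \<in> P. \<exists>t out. runs p d t out \<and>
      t \<le> f k * data_size d ^ c \<and> (out \<noteq> Leaf \<longleftrightarrow> answer)"
    using assms unfolding FPT_def by blast
  obtain g T n where g: "computes_within (\<lambda>d. \<exists>t out. runs p d t out) g (\<lambda>d. T d + n)"
      "\<forall>d t out. runs p d t out \<longrightarrow> g d = out \<and> T d = t"
    using computes_within_runs by blast
  show thesis
  proof (rule that[OF _ f])
    show "computes_within (\<lambda>d. \<exists>k a. (d, k, a) \<in> P) g (\<lambda>d. T d + n)"
      by (rule computes_within_mono[OF g(1)]) (use p in fast)+
    show "T d \<le> f k * data_size d ^ c \<and> (g d \<noteq> Leaf \<longleftrightarrow> a)" if "(d, k, a) \<in> P" for d k a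
      using p g(2) that by fast
  qed
qed

text \<open>\<open>N\<close> is the input size, \<open>L\<close> the bit length of the number of
  elements and \<open>F\<close> the value of the given bound at \<open>k\<close>. By
  \<open>power_le_exp\<close>, \<open>(L + 1) ^ M\<close> costs one factor \<open>4 * N\<close> and
  a term in \<open>M\<close>; all else depends on \<open>k\<close> and \<open>F\<close> and fits
  under the double exponential.\<close>

lemma parameter_bound:
  fixes c F k L N :: nat
  assumes L: "2 ^ Suc L \<le> 4 * N"
  shows "(F + 1) * (c * (5 * N * ((L + 1) * (k + 1)) ^ 2 ^ k) ^ c)
    \<le> 2 ^ 2 ^ ((4 * c * 5 ^ c + 3 + (2 + c) * c) * (k + F + 1)) * N ^ (c + 1)"
proof -
  define M where "M = c * 2 ^ k"
  define u where "u = k + F + 1"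
  define c0 where "c0 = 4 * c * 5 ^ c"
  have "(((L + 1) * (k + 1)) ^ 2 ^ k) ^ c = (L + 1) ^ M * (k + 1) ^ M"
    unfolding M_def power_mult[symmetric] power_mult_distrib[symmetric] by (simp only: mult.commute)
  also have "(L + 1) ^ M \<le> M ^ M * 2 ^ (L + 1)" by (rule power_le_exp)
  also have "\<dots> \<le> M ^ M * (4 * N)" using L by (intro mult_left_mono) simp_all
  finally have A: "(((L + 1) * (k + 1)) ^ 2 ^ k) ^ c \<le> M ^ M * (4 * N) * (k + 1) ^ M"
    by simp
  have "(F + 1) * (c * (5 * N * ((L + 1) * (k + 1)) ^ 2 ^ k) ^ c) =
      (F + 1) * (c * (5 ^ c * N ^ c * (((L + 1) * (k + 1)) ^ 2 ^ k) ^ c))"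
    by (simp only: power_mult_distrib)
  also have "\<dots> \<le> (F + 1) * (c * (5 ^ c * N ^ c * (M ^ M * (4 * N) * (k + 1) ^ M)))"
    using A by (intro mult_left_mono) simp_all
  also have "\<dots> = ((F + 1) * c0 * ((k + 1) * M) ^ M) * N ^ (c + 1)"
    unfolding c0_def power_mult_distrib power_add power_one_right by (simp only: mult_ac)
  also have "\<dots> \<le> 2 ^ 2 ^ ((c0 + 3 + (2 + c) * c) * u) * N ^ (c + 1)"
  proof (rule mult_right_mono)
    have "F + 1 \<le> u" by (simp add: u_def)
    also have "u \<le> 2 ^ u" by (rule less_imp_le[OF less_exp])
    finally have 1: "F + 1 \<le> 2 ^ u" .
    have 2: "c0 \<le> 2 ^ c0" by (rule less_imp_le[OF less_exp])
    have "(k + 1) * M \<le> 2 ^ k * (2 ^ c * 2 ^ k)"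
      unfolding M_def by (intro mult_mono less_imp_le[OF less_exp]) (simp_all add: Suc_leI)
    also have "\<dots> = 2 ^ (2 * k + c)" by (simp add: power_add[symmetric])
    finally have "((k + 1) * M) ^ M \<le> (2 ^ (2 * k + c)) ^ M" by (rule power_mono) simp
    then have 3: "((k + 1) * M) ^ M \<le> 2 ^ ((2 * k + c) * M)" by (simp only: power_mult)
    have "(F + 1) * c0 * ((k + 1) * M) ^ M \<le> 2 ^ u * 2 ^ c0 * 2 ^ ((2 * k + c) * M)"
      by (intro mult_mono 1 2 3) simp_all
    also have "\<dots> = 2 ^ (u + c0 + (2 * k + c) * M)" by (simp only: power_add)
    also have "\<dots> \<le> 2 ^ 2 ^ ((c0 + 3 + (2 + c) * c) * u)"
    proof (rule power_increasing)
      have u: "1 \<le> u" "k \<le> u" by (simp_all add: u_def)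
      have "c * 1 \<le> c * u" by (intro mult_left_mono u) simp
      then have "2 * k + c \<le> (2 + c) * u" using u unfolding add_mult_distrib by linarith
      moreover have "(2::nat) ^ k \<le> 2 ^ u" using u by (intro power_increasing) simp_all
      ultimately have "(2 * k + c) * M \<le> (2 + c) * u * (c * 2 ^ u)"
        unfolding M_def by (intro mult_mono) simp_all
      also have "\<dots> = (2 + c) * c * (u * 2 ^ u)" by (simp only: mult_ac)
      finally have 4: "(2 * k + c) * M \<le> (2 + c) * c * (u * 2 ^ u)" .
      have "c0 * 1 \<le> c0 * (u * 2 ^ u)" using u by (intro mult_left_mono) simp_all
      moreover have "u \<le> u * 2 ^ u" by simp
      ultimately have "u + c0 + (2 * k + c) * M \<le> (c0 + 1 + (2 + c) * c) * (u * 2 ^ u)"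
        using 4 unfolding add_mult_distrib by linarith
      also have "\<dots> \<le> 2 ^ (c0 + 1 + (2 + c) * c) * (2 ^ u * 2 ^ u)"
        by (intro mult_mono less_imp_le[OF less_exp]) simp_all
      also have "\<dots> = 2 ^ ((c0 + 1 + (2 + c) * c) + 2 * u)" by (simp only: power_add mult_2)
      \<comment> \<open>As \<open>1 \<le> u\<close>, the summand \<open>2 * u\<close> raises the
        coefficient 1 to 3.\<close>
      also have "\<dots> \<le> 2 ^ ((c0 + 3 + (2 + c) * c) * u)"
      proof (rule power_increasing)
        have "(c0 + 1 + (2 + c) * c) * 1 \<le> (c0 + 1 + (2 + c) * c) * u"
          by (intro mult_left_mono u) simp
        then have "(c0 + 1 + (2 + c) * c) + 2 * u \<le> (c0 + 1 + (2 + c) * c) * u + 2 * u" by simp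
        also have "\<dots> = (c0 + 3 + (2 + c) * c) * u" by (simp add: add_mult_distrib)
        finally show "(c0 + 1 + (2 + c) * c) + 2 * u \<le> (c0 + 3 + (2 + c) * c) * u" .
      qed simp
      finally show "u + c0 + (2 * k + c) * M \<le> 2 ^ ((c0 + 3 + (2 + c) * c) * u)" .
    qed simp
    finally show "(F + 1) * c0 * ((k + 1) * M) ^ M \<le> 2 ^ 2 ^ ((c0 + 3 + (2 + c) * c) * u)" .
  qed simp
  finally show ?thesis by (simp only: c0_def u_def)
qed

lemma sum_list_le_length_mult:
  fixes h :: "'a \<Rightarrow> nat"
  assumes "\<And>y. y \<in> set ys \<Longrightarrow> h y \<le> m"
  shows "sum_list (map h ys) \<le> length ys * m"
  using assms by (induction ys) (auto simp: add_mono)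

section \<open>Size of the candidate family and cost of the reduction\<close>

context element_access
begin

text \<open>There are \<open>k + 1\<close> initial rows. The \<open>+ 1\<close> at the bit length
  keeps the bound positive when there are no elements and hence no separators.\<close>

definition family_bound :: "data \<Rightarrow> nat" where
  "family_bound x = ((bit_length (length (to_list (elements x))) + 1) *
     (length (to_list (left (right x))) + 1)) ^ 2 ^ length (to_list (left (right x)))"

text \<open>Covers every intermediate round \<open>m\<close>, because the fold needs bounds for all
  its accumulators. Entries are copied from the rows and never enlarged, so one candidate stays
  below \<open>E\<close> in all rounds.\<close>

lemma candidates_size:
  assumes distinct: "distinct (to_list (elements x))"
    and nonempty: "left (right x) \<noteq> Leaf \<Longrightarrow> elements x \<noteq> Leaf"
    and m: "m \<le> length (to_list (left (right x)))"
  defines "F \<equiv> (select_all (separators (elements x)) ^^ m) (rows x)"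
    and "E \<equiv> 2 + data_size x * (1 + data_size (rows x))"
  shows "length (to_list F) \<le> family_bound x" "f \<in> set (to_list F) \<Longrightarrow> data_size f < E"
    "data_size F \<le> 1 + family_bound x * E"
proof -
  define ds where "ds = to_list (elements x)"
  define k where "k = length (to_list (left (right x)))"
  define l where "l = bit_length (length ds)"
  have els: "elements x = from_list ds" by (simp add: ds_def)
  have sep: "length (to_list (separators (elements x))) = l"
    using to_list_separators[of ds] distinct by (simp add: els l_def)
  have len: "l * length (to_list F) = (l * (k + 1)) ^ 2 ^ m"
    unfolding F_def using length_select_all_iterate[OF sep] by (simp add: length_rows k_def)
  show length_F: "length (to_list F) \<le> family_bound x"
  proof (cases "l = 0")
    case True
    \<comment> \<open>Without elements there are no tokens, so no round takes place and just the
      extra row is left.\<close>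
    then have "ds = []" using bit_length_bounds[of "length ds"] by (simp add: l_def)
    then have "k = 0" using nonempty els by (cases "left (right x)") (auto simp: k_def)
    then have "length (to_list F) = 1" using m by (simp add: F_def length_rows k_def)
    then show ?thesis by (simp add: family_bound_def)
  next
    case False
    then have "length (to_list F) \<le> (l * (k + 1)) ^ 2 ^ m" using len by (metis mult_le_cancel2 mult_1 Suc_leI neq0_conv One_nat_def)
    also have "\<dots> \<le> ((l + 1) * (k + 1)) ^ 2 ^ m" by (intro power_mono mult_right_mono) simp_all
    also have "\<dots> \<le> ((l + 1) * (k + 1)) ^ 2 ^ k"
      using m by (intro power_increasing) (simp_all add: k_def)
    finally show ?thesis by (simp add: family_bound_def l_def k_def ds_def)
  qed
  show size_F: "data_size f < E" if f: "f \<in> set (to_list F)" for f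
  proof -
    define \<F> where "\<F> = insert (\<lambda>p. entry Leaf (incr (right (right x))))
      ((\<lambda>i p. entry (enc_nat i) (weight x (to_list (left (right x)) ! i) p)) ` {..<k})"
    have rows: "set (to_list (rows x)) = tabulate ds ` \<F>"
      using set_rows[OF els from_list_to_list[symmetric]] by (simp add: \<F>_def k_def)
    obtain \<phi> where \<phi>: "f = tabulate ds \<phi>" "\<phi> \<in> select_family (separating_bits ds) \<F> m"
      using f unfolding F_def els select_all_iterate[OF distinct[folded ds_def] rows] by blast
    have "data_size (\<phi> p) \<le> data_size (rows x)" if p: "p \<in> set ds" for p
    proof -
      obtain \<rho> where \<rho>: "\<rho> \<in> \<F>" "\<phi> p = \<rho> p" using select_family_pointwise[OF \<phi>(2)] by blast
      then have "tabulate ds \<rho> \<in> set (to_list (rows x))" using rows by blast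
      then have "data_size (tabulate ds \<rho>) \<le> data_size (rows x)" by (rule size_mem_to_list)
      moreover have "data_size (\<rho> p) \<le> data_size (tabulate ds \<rho>)"
        using p by (intro size_mem_to_list) (simp add: tabulate_def)
      ultimately show ?thesis using \<rho>(2) by simp
    qed
    then have "(\<Sum>p\<leftarrow>ds. 1 + data_size (\<phi> p)) \<le> length ds * (1 + data_size (rows x))"
      by (intro sum_list_le_length_mult) simp
    also have "\<dots> \<le> data_size x * (1 + data_size (rows x))"
      using length_to_list_le[of "elements x"] data_size_elements[of x]
      by (intro mult_right_mono) (simp_all add: ds_def)
    finally show ?thesis by (simp add: \<phi>(1) tabulate_def data_size_from_list comp_def E_def)
  qed
  have "data_size F = 1 + (\<Sum>f\<leftarrow>to_list F. 1 + data_size f)"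
    using data_size_from_list[of "to_list F"] by simp
  also have "(\<Sum>f\<leftarrow>to_list F. 1 + data_size f) \<le> length (to_list F) * E"
    using size_F by (intro sum_list_le_length_mult) (simp add: Suc_leI)
  also have "\<dots> \<le> family_bound x * E" using length_F by (rule mult_right_mono) simp
  finally show "data_size F \<le> 1 + family_bound x * E" by simp
qed

text \<open>A disjunctive reduction with many queries, all with the parameter of the input.\<close>

definition admissible :: "param_problem \<Rightarrow> data \<Rightarrow> nat \<Rightarrow> bool \<Rightarrow> bool" where
  "admissible W x k a \<longleftrightarrow> distinct (to_list (elements x)) \<and> length (to_list (left (right x))) = k \<and>
     (left (right x) \<noteq> Leaf \<longrightarrow> elements x \<noteq> Leaf) \<and>
     (\<exists>ans. (\<forall>f\<in>set (to_list (candidates x)). (rainbow_input x f, k, ans f) \<in> W) \<and>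
        (a \<longleftrightarrow> (\<exists>f\<in>set (to_list (candidates x)). ans f)))"

text \<open>
  Only the size of the family of candidates is not polynomial in the input. Its bound \<open>A\<close> is
  carried along as a second, unary component of the input, so that all running times become
  polynomial in \<open>Node x (from_list (replicate A Leaf))\<close>, up to the factor contributed by the
  given algorithm.
\<close>

theorem FPT_reduction:
  assumes W: "FPT W" and adm: "\<And>x k a. (x, k, a) \<in> D \<Longrightarrow> admissible W x k a"
  shows "FPT D"
proof -
  obtain g T n f c where g: "computes_within (\<lambda>d. \<exists>k a. (d, k, a) \<in> W) g (\<lambda>d. T d + n)"
    and f: "computable f"
    and gW: "\<And>d k a. (d, k, a) \<in> W \<Longrightarrow> T d \<le> f k * data_size d ^ c \<and> (g d \<noteq> Leaf \<longleftrightarrow> a)"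
    using FPT_E[OF W] by blast
  let ?P = "\<lambda>x. \<exists>k a. (x, k, a) \<in> D"
  let ?tokens = "\<lambda>x. left (right x)"
  let ?step = "\<lambda>x. select_all (separators (elements x))"
  let ?in = "\<lambda>z. rainbow_input (left z) (left (right z))"
  have P: "distinct (to_list (elements x))" "left (right x) \<noteq> Leaf \<Longrightarrow> elements x \<noteq> Leaf" if "?P x" for x
    using that adm unfolding admissible_def by blast+

  obtain Tt where Tt: "computes_within (\<lambda>_. True) ?tokens Tt" "poly_bounded Tt"
    by (rule poly_timeE[of ?tokens]) (intro poly_time_intros)
  obtain Tr where Tr: "computes_within (\<lambda>_. True) rows Tr" "poly_bounded Tr"
    by (rule poly_timeE[OF poly_time_rows])
  have "poly_time (\<lambda>z. ?step (left z) (right (right z)))"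
    by (intro poly_time_select_all poly_time_separators poly_time_comp[OF poly_time_elements] poly_time_intros)
  then obtain Ts where Ts: "computes_within (\<lambda>_. True) (\<lambda>z. ?step (left z) (right (right z))) Ts"
    "poly_bounded Ts" by (rule poly_timeE)
  obtain Ti where Ti: "computes_within (\<lambda>_. True) ?in Ti" "poly_bounded Ti"
    by (rule poly_timeE[of ?in]) (intro poly_time_intros poly_time_rainbow_input)
  obtain Tc where Tc: "computes_within (\<lambda>_. True) (\<lambda>z. tt) Tc" "poly_bounded Tc"
    by (rule poly_timeE[OF poly_time_const])
  obtain Ta where Ta: "computes_within (\<lambda>_. True) (\<lambda>z. right (right z)) Ta" "poly_bounded Ta"
    by (rule poly_timeE[of "\<lambda>z. right (right z)"]) (intro poly_time_intros)
  have "poly_bounded (\<lambda>z. data_size (rainbow_input (left z) (right z)))"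
    by (intro poly_time_size poly_time_rainbow_input poly_time_intros)
  then obtain ci where ci: "\<And>z. data_size (rainbow_input (left z) (right z)) \<le> ci * data_size z ^ ci"
    unfolding poly_bounded_def by blast
  obtain cs where cs: "\<And>z. Ts z \<le> cs * data_size z ^ cs"
    using Ts(2) unfolding poly_bounded_def by blast
  have "poly_bounded (\<lambda>z. Ti z + n + Tc z + Ta z + 4)"
    by (intro poly_bounded_add poly_bounded_const Ti Tc Ta)
  then obtain cb where cb: "\<And>z. Ti z + n + Tc z + Ta z + 4 \<le> cb * data_size z ^ cb"
    unfolding poly_bounded_def by blast

  define E where "E x = 2 + data_size x * (1 + data_size (rows x))" for x
  define G where "G x = 1 + family_bound x * E x" for x
  define B1 where "B1 x = cs * (2 + 2 * data_size x + G x) ^ cs" for x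
  define T1 where "T1 x = Tt x + Tr x + 6 + length (to_list (?tokens x)) * (B1 x + 6)" for x
  \<comment> \<open>Polynomial in the input size; the factor \<open>f k\<close> enters only through
    \<open>B2\<close>. The 5 stands for two cells of the triple and an accumulator \<open>tt\<close>
    of size 3.\<close>
  define b2 where "b2 x = cb * (5 + data_size x + E x) ^ cb + (ci * (1 + data_size x + E x) ^ ci) ^ c" for x
  define B2 where "B2 x = (f (length (to_list (?tokens x))) + 1) * b2 x" for x

  have cand: "computes_within ?P candidates T1"
    unfolding candidates_def T1_def
  proof (rule computes_within_foldd[where Inv = "\<lambda>x i F. F = (?step x ^^ i) (rows x)",
        OF _ _ Ts(1)])
    show "computes_within ?P ?tokens Tt" "computes_within ?P rows Tr"
      by (rule computes_within_mono[OF Tt(1)] computes_within_mono[OF Tr(1)]; simp)+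
    fix x i F assume x: "?P x" and i: "i < length (to_list (?tokens x))" and F: "F = (?step x ^^ i) (rows x)"
    let ?z = "Node x (Node (to_list (?tokens x) ! i) F)"
    have "data_size F \<le> G x"
      using candidates_size(3)[OF P[OF x], of i] i F by (simp add: G_def E_def)
    moreover have "data_size (to_list (?tokens x) ! i) \<le> data_size x"
      using size_nth_to_list[OF i] data_size_left[of "right x"] data_size_right[of x] by simp
    ultimately have "cs * data_size ?z ^ cs \<le> B1 x"
      unfolding B1_def by (intro mult_left_mono power_mono) simp_all
    with cs[of ?z] have "Ts ?z \<le> B1 x" by (rule order.trans)
    then show "True \<and> Ts ?z \<le> B1 x \<and> ?step x F = (?step x ^^ Suc i) (rows x)" using F by simp
  qed simp

  \<comment> \<open>The query must be a genuine instance, since nothing is known about the given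
    algorithm elsewhere.\<close>
  let ?Q = "\<lambda>z. \<exists>k a. (?in z, k, a) \<in> W"
  have "computes_within ?Q (\<lambda>z. g (?in z)) (\<lambda>z. Ti z + (T (?in z) + n))"
    by (rule computes_within_comp[OF g]) (rule computes_within_mono[OF Ti(1)]; simp)
  moreover have "computes_within ?Q (\<lambda>z. tt) Tc" "computes_within ?Q (\<lambda>z. right (right z)) Ta"
    by (rule computes_within_mono[OF Tc(1)] computes_within_mono[OF Ta(1)]; simp)+
  ultimately have body: "computes_within ?Q (\<lambda>z. cond (g (?in z)) tt (right (right z)))
      (\<lambda>z. Ti z + (T (?in z) + n) + Tc z + Ta z + 4)"
    by (rule computes_within_cond)

  have main: "computes_within ?P (\<lambda>x. foldd (\<lambda>y r. cond (g (rainbow_input x y)) tt r) (candidates x) Leaf)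
      (\<lambda>x. T1 x + 1 + 6 + length (to_list (candidates x)) * (B2 x + 6))"
  proof (rule computes_within_foldd[where Inv = "\<lambda>x i r. r = Leaf \<or> r = tt",
        OF cand computes_within_Leaf body])
    fix x i r assume x: "?P x" and i: "i < length (to_list (candidates x))" and r: "r = Leaf \<or> r = tt"
    let ?y = "to_list (candidates x) ! i"
    let ?z = "Node x (Node ?y r)"
    obtain k a where ka: "(x, k, a) \<in> D" using x by blast
    have y: "?y \<in> set (to_list (candidates x))" using i by simp
    obtain e where e: "(rainbow_input x ?y, k, e) \<in> W" and k: "length (to_list (?tokens x)) = k"
      using adm[OF ka] y unfolding admissible_def by blast
    have size_y: "data_size ?y \<le> E x"
      using candidates_size(2)[OF P[OF x] order.refl, of ?y] y
      by (simp add: E_def candidates_conv)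
    have "data_size (rainbow_input x ?y) \<le> ci * data_size (Node x ?y) ^ ci"
      using ci[of "Node x ?y"] by simp
    also have "\<dots> \<le> ci * (1 + data_size x + E x) ^ ci"
      using size_y by (intro mult_left_mono power_mono) simp_all
    finally have "data_size (rainbow_input x ?y) ^ c \<le> (ci * (1 + data_size x + E x) ^ ci) ^ c"
      by (rule power_mono) simp
    then have "f k * data_size (rainbow_input x ?y) ^ c \<le> f k * (ci * (1 + data_size x + E x) ^ ci) ^ c"
      by (rule mult_left_mono) simp
    with gW[OF e] have T: "T (rainbow_input x ?y) \<le> f k * (ci * (1 + data_size x + E x) ^ ci) ^ c"
      by linarith
    have "cb * data_size ?z ^ cb \<le> cb * (5 + data_size x + E x) ^ cb"
      using size_y r by (intro mult_left_mono power_mono) auto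
    with cb[of ?z] have rest: "Ti ?z + n + Tc ?z + Ta ?z + 4 \<le> cb * (5 + data_size x + E x) ^ cb"
      by (rule order.trans)
    have "B2 x = f k * (cb * (5 + data_size x + E x) ^ cb) +
        f k * (ci * (1 + data_size x + E x) ^ ci) ^ c + b2 x"
      unfolding B2_def b2_def k by (simp only: distrib_left distrib_right mult_1)
    then have "T (rainbow_input x ?y) + (Ti ?z + n + Tc ?z + Ta ?z + 4) \<le> B2 x"
      using T rest unfolding b2_def by linarith
    then have "Ti ?z + (T (?in ?z) + n) + Tc ?z + Ta ?z + 4 \<le> B2 x" by simp
    with e show "?Q ?z \<and> Ti ?z + (T (?in ?z) + n) + Tc ?z + Ta ?z + 4 \<le> B2 x \<and>
        (cond (g (rainbow_input x ?y)) tt r = Leaf \<or> cond (g (rainbow_input x ?y)) tt r = tt)"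
      using r by (auto simp: cond_def)
  qed simp

  define G' where "G' z = 1 + data_size (right z) * E (left z)" for z
  define B1' where "B1' z = cs * (2 + 2 * data_size (left z) + G' z) ^ cs" for z
  \<comment> \<open>The 13 collects the 6 inside \<open>T1\<close> and the 1 + 6 of the outer
    fold.\<close>
  define Q where "Q z = Tt (left z) + Tr (left z) + 13 + data_size (left z) * (B1' z + 6) +
    data_size (right z) * (b2 (left z) + 6)" for z
  have left: "poly_bounded (\<lambda>z. data_size (left z))" and right: "poly_bounded (\<lambda>z. data_size (right z))"
    by (intro poly_time_size poly_time_intros)+
  have E: "poly_bounded (\<lambda>z. E (left z))" unfolding E_def
    by (intro poly_bounded_add poly_bounded_mult poly_bounded_const left poly_time_size
        poly_time_comp[OF poly_time_rows] poly_time_intros)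
  have "poly_bounded Q" unfolding Q_def B1'_def G'_def b2_def
    by (intro poly_bounded_add poly_bounded_mult poly_bounded_const poly_bounded_power left right E
        poly_bounded_comp[OF Tt(2)] poly_bounded_comp[OF Tr(2)])
  then obtain q where q: "\<And>z. Q z \<le> q * data_size z ^ q" unfolding poly_bounded_def by blast

  have bound: "T1 x + 1 + 6 + length (to_list (candidates x)) * (B2 x + 6)
      \<le> 2 ^ 2 ^ ((4 * q * 5 ^ q + 3 + (2 + q) * q) * (k + f k + 1)) * data_size x ^ (q + 1)"
    if x: "(x, k, a) \<in> D" for x k a
  proof -
    have Px: "?P x" using x by blast
    have k: "length (to_list (?tokens x)) = k" using adm[OF x] unfolding admissible_def by blast
    define A where "A = family_bound x"
    let ?z = "Node x (from_list (replicate A Leaf))"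
    have size_A: "data_size (from_list (replicate A Leaf)) = 1 + 2 * A"
      by (simp add: data_size_from_list sum_list_replicate)
    have "B1 x \<le> B1' ?z" unfolding B1_def B1'_def G_def G'_def
      by (intro mult_left_mono power_mono add_mono mult_mono) (simp_all add: A_def size_A[unfolded A_def])
    moreover have "length (to_list (?tokens x)) \<le> data_size x"
      using length_to_list_le[of "?tokens x"] data_size_left[of "right x"] data_size_right[of x] by linarith
    ultimately have t1: "length (to_list (?tokens x)) * (B1 x + 6) \<le> data_size x * (B1' ?z + 6)"
      by (intro mult_mono) simp_all
    have "length (to_list (candidates x)) \<le> 1 + 2 * A"
      using candidates_size(1)[OF P[OF Px] order.refl] by (simp add: candidates_conv A_def)
    moreover have "B2 x + 6 \<le> (f k + 1) * (b2 x + 6)" by (simp add: B2_def k)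
    ultimately have "length (to_list (candidates x)) * (B2 x + 6) \<le> (1 + 2 * A) * ((f k + 1) * (b2 x + 6))"
      by (intro mult_mono) simp_all
    then have t2: "length (to_list (candidates x)) * (B2 x + 6) \<le> (f k + 1) * ((1 + 2 * A) * (b2 x + 6))"
      by (simp only: mult.left_commute)
    have "T1 x + 1 + 6 + length (to_list (candidates x)) * (B2 x + 6)
        \<le> (Tt x + Tr x + 13 + data_size x * (B1' ?z + 6)) + (f k + 1) * ((1 + 2 * A) * (b2 x + 6))"
      using t1 t2 unfolding T1_def by linarith
    also have "\<dots> \<le> (f k + 1) * Q ?z"
      unfolding Q_def left.simps right.simps size_A add_mult_distrib2[of "f k + 1" _ "(1 + 2 * A) * (b2 x + 6)"]
      by simp
    also have "\<dots> \<le> (f k + 1) * (q * data_size ?z ^ q)" by (intro mult_left_mono q) simp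
    also have "\<dots> \<le> (f k + 1) * (q * (5 * data_size x * A) ^ q)"
    proof (intro mult_left_mono power_mono)
      \<comment> \<open>The size of the pair is \<open>2 + data_size x + 2 * A\<close>, and each of
        its five units is at most \<open>data_size x * A\<close>.\<close>
      have "1 \<le> A" by (simp add: A_def family_bound_def Suc_leI)
      moreover have "1 \<le> data_size x" by (simp add: Suc_leI)
      ultimately have "1 * 1 \<le> data_size x * A" "data_size x * 1 \<le> data_size x * A" "1 * A \<le> data_size x * A"
        by (intro mult_mono; simp)+
      then show "data_size ?z \<le> 5 * data_size x * A"
        using size_A unfolding data_size.simps mult.assoc by linarith
    qed simp_all
    also have "\<dots> \<le> 2 ^ 2 ^ ((4 * q * 5 ^ q + 3 + (2 + q) * q) * (k + f k + 1)) * data_size x ^ (q + 1)"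
      unfolding A_def family_bound_def k
    proof (rule parameter_bound)
      let ?n = "length (to_list (elements x))"
      have "?n \<le> data_size x"
        using length_to_list_le[of "elements x"] data_size_elements[of x] by linarith
      moreover have "2 ^ bit_length ?n \<le> 2 * ?n \<or> ?n = 0" using bit_length_bounds[of ?n] by blast
      moreover have "1 \<le> data_size x" by (simp add: Suc_leI)
      ultimately show "2 ^ Suc (bit_length ?n) \<le> 4 * data_size x" by auto
    qed
    finally show ?thesis .
  qed

  have answer: "foldd (\<lambda>y r. cond (g (rainbow_input x y)) tt r) (candidates x) Leaf \<noteq> Leaf \<longleftrightarrow> a"
    if x: "(x, k, a) \<in> D" for x k a
  proof -
    have *: "foldd (\<lambda>y r. cond (g (rainbow_input x y)) tt r) l r \<noteq> Leaf \<longleftrightarrow>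
        r \<noteq> Leaf \<or> (\<exists>y\<in>set (to_list l). g (rainbow_input x y) \<noteq> Leaf)" for l r
      by (induction l arbitrary: r) (auto simp: cond_def)
    obtain ans where "\<forall>f\<in>set (to_list (candidates x)). (rainbow_input x f, k, ans f) \<in> W"
      "a \<longleftrightarrow> (\<exists>f\<in>set (to_list (candidates x)). ans f)"
      using adm[OF x] unfolding admissible_def by blast
    with gW show ?thesis unfolding * by blast
  qed
  show ?thesis
    by (rule FPT_I[OF main computable_double_exponential[OF f]]) (use bound answer in blast)
qed

end

subsection \<open>Vertices and edges\<close>

definition rep_nat :: "data \<Rightarrow> nat" where
  "rep_nat = the_inv enc_nat"

lemma rep_enc_nat [simp]: "rep_nat (enc_nat n) = n"
  unfolding rep_nat_def by (rule the_inv_f_f) (simp add: inj_def)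

definition or_data :: "data \<Rightarrow> data \<Rightarrow> data" where
  "or_data a b = cond a tt b"

definition and_data :: "data \<Rightarrow> data \<Rightarrow> data" where
  "and_data a b = cond a b Leaf"

lemma or_data_iff [simp]: "or_data a b \<noteq> Leaf \<longleftrightarrow> a \<noteq> Leaf \<or> b \<noteq> Leaf"
  by (simp add: or_data_def cond_def)

lemma and_data_iff [simp]: "and_data a b \<noteq> Leaf \<longleftrightarrow> a \<noteq> Leaf \<and> b \<noteq> Leaf"
  by (simp add: and_data_def cond_def)

definition incident :: "data \<Rightarrow> data \<Rightarrow> data" where
  "incident u e = or_data (eq_nat u (left e)) (eq_nat u (right e))"

lemma enc_edge_simps [simp]: "left (enc_edge e) = enc_nat (fst e)" "right (enc_edge e) = enc_nat (snd e)"
  by (simp_all add: enc_edge_def enc_prod_def case_prod_unfold)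

lemma incident_iff [simp]: "incident (enc_nat u) (enc_edge e) \<noteq> Leaf \<longleftrightarrow> u \<in> edge_of e"
  unfolding incident_def or_data_iff enc_edge_simps eq_nat_iff by (auto simp: edge_of_def case_prod_unfold)

lemma poly_time_or_data: "poly_time f \<Longrightarrow> poly_time g \<Longrightarrow> poly_time (\<lambda>x. or_data (f x) (g x))"
  unfolding or_data_def by (intro poly_time_intros)

lemma poly_time_and_data: "poly_time f \<Longrightarrow> poly_time g \<Longrightarrow> poly_time (\<lambda>x. and_data (f x) (g x))"
  unfolding and_data_def by (intro poly_time_intros)

lemma poly_time_incident: "poly_time f \<Longrightarrow> poly_time g \<Longrightarrow> poly_time (\<lambda>x. incident (f x) (g x))"
  unfolding incident_def by (intro poly_time_intros poly_time_or_data poly_time_eq_nat)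

interpretation vertices: element_access "\<lambda>x. left (left x)" "\<lambda>x p q. eq_nat p q"
  "\<lambda>x p q. or_data (eq_nat p q) (ex_data (\<lambda>e. and_data (incident p e) (incident q e)) (right (left x)))"
proof
  show "data_size (left (left x)) \<le> data_size x" for x
    using data_size_left[of x] data_size_left[of "left x"] by linarith
qed (intro poly_time_intros poly_time_or_data poly_time_and_data poly_time_incident poly_time_eq_nat)+

text \<open>Edges are stored with endpoints in either order. For two-element sets containment is
  equality, so the test is whether both endpoints of \<open>p\<close> lie on \<open>q\<close>;
  sharing an endpoint includes equality.\<close>

interpretation edges: element_access "\<lambda>x. right (left x)"
  "\<lambda>x p q. and_data (incident (left p) q) (incident (right p) q)"
  "\<lambda>x p q. or_data (incident (left p) q) (incident (right p) q)"
proof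
  show "data_size (right (left x)) \<le> data_size x" for x
    using data_size_left[of x] data_size_right[of "left x"] by linarith
qed (intro poly_time_intros poly_time_or_data poly_time_and_data poly_time_incident)+

lemma (in presented_instance) admissibleI:
  assumes W: "\<And>colour wt. (rainbow_input x (tabulate ds (\<lambda>p. entry (enc_nat (colour (rep p))) (enc_nat (wt (rep p))))),
      card S, \<exists>C. rainbow_solution X sol colour (\<lambda>v. real (wt v)) (card S) (int b) C) \<in> W"
  shows "admissible W x (card S) (\<exists>l C. l \<le> b \<and> discovery_sequence adj sol S l C)"
proof -
  obtain colour wt where shape: "\<And>f. f \<in> set (to_list (candidates x)) \<Longrightarrow>
      f = tabulate ds (\<lambda>p. entry (enc_nat (colour f (rep p))) (enc_nat (wt f (rep p))))"
    using candidate_shape by metis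
  have "distinct ds" using distinct_elements by (simp add: distinct_map)
  moreover have "ts = []" if "ds = []" using that S X by auto
  moreover have "(rainbow_input x f, card S,
      \<exists>C. rainbow_solution X sol (colour f) (\<lambda>v. real (wt f v)) (card S) (int b) C) \<in> W"
    if f: "f \<in> set (to_list (candidates x))" for f
    using W[of "colour f" "wt f"] unfolding shape[OF f, symmetric] .
  ultimately show ?thesis
    unfolding admissible_def
    by (intro conjI exI[of _ "\<lambda>f. \<exists>C. rainbow_solution X sol (colour f) (\<lambda>v. real (wt f v)) (card S) (int b) C"]
        ballI candidates_correct[OF shape]) (auto simp: elements tokens card_S)
qed

lemma admissible_vertices:
  fixes b :: nat
  assumes G: "simple_graph G" "presents vs es G" and S: "S \<subseteq> verts G" "distinct ss" "set ss = S"
  defines "x \<equiv> enc_prod enc_graph (enc_prod (enc_list enc_nat) enc_nat) ((vs, es), ss, b)"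
  shows "vertices.admissible (weighted_rainbow (Vertex_Selection sol)) x (card S)
    (\<exists>l C. l \<le> b \<and> discovery_sequence (vertex_adj G) (sol G) S l C)"
proof -
  have x: "left (left x) = from_list (map enc_nat vs)" "right (left x) = from_list (map enc_edge es)"
    "left (right x) = from_list (map enc_nat ss)" "right (right x) = enc_nat b"
    by (simp_all add: x_def enc_prod_def enc_graph_def enc_list_conv)
  have vs: "distinct vs" "set vs = verts G" "edge_of ` set es = edges G"
    using G(2) by (auto simp: presents_def)
  have edge: "{u, v} \<in> edges G \<longleftrightarrow> (\<exists>e\<in>set es. u \<in> edge_of e \<and> v \<in> edge_of e)" if "u \<noteq> v" for u v
  proof
    assume "{u, v} \<in> edges G"
    then show "\<exists>e\<in>set es. u \<in> edge_of e \<and> v \<in> edge_of e" unfolding vs(3)[symmetric] by auto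
  next
    assume "\<exists>e\<in>set es. u \<in> edge_of e \<and> v \<in> edge_of e"
    then obtain e where e: "e \<in> set es" "u \<in> edge_of e" "v \<in> edge_of e" by blast
    then have "edge_of e = {u, v}" using that by (auto simp: edge_of_def case_prod_unfold)
    with e(1) vs(3) show "{u, v} \<in> edges G" by (metis imageI)
  qed
  interpret inst: presented_instance "\<lambda>x. left (left x)" "\<lambda>x p q. eq_nat p q"
    "\<lambda>x p q. or_data (eq_nat p q) (ex_data (\<lambda>e. and_data (incident p e) (incident q e)) (right (left x)))"
    x rep_nat "map enc_nat vs" "map enc_nat ss" b "vertex_adj G" "verts G" S
  proof
    fix p q assume "p \<in> set (map enc_nat vs)" "q \<in> set (map enc_nat vs) \<union> set (map enc_nat ss)"
    then obtain u v where uv: "p = enc_nat u" "q = enc_nat v" by auto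
    show "eq_nat q p \<noteq> Leaf \<longleftrightarrow> rep_nat q = rep_nat p" by (simp add: uv del: not_False_eq_True)
    have "ex_data (\<lambda>e. and_data (incident q e) (incident p e)) (right (left x)) \<noteq> Leaf \<longleftrightarrow>
        (\<exists>e\<in>set es. v \<in> edge_of e \<and> u \<in> edge_of e)"
      unfolding ex_data_iff x uv and_data_iff by simp
    then show "or_data (eq_nat q p) (ex_data (\<lambda>e. and_data (incident q e) (incident p e)) (right (left x))) \<noteq> Leaf \<longleftrightarrow>
        rep_nat q = rep_nat p \<or> vertex_adj G (rep_nat q) (rep_nat p)"
      unfolding or_data_iff uv eq_nat_iff rep_enc_nat vertex_adj_def using edge[of v u] by blast
  next
    fix u v assume "vertex_adj G u v"
    then show "u \<in> verts G \<and> v \<in> verts G"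
      using G(1) unfolding vertex_adj_def simple_graph_def by blast
  qed (use x vs S in \<open>auto simp: comp_def image_image\<close>)
  show ?thesis
  proof (rule inst.admissibleI)
    fix colour :: "nat \<Rightarrow> nat" and wt :: "nat \<Rightarrow> nat"
    have eq: "rainbow_input x (tabulate (map enc_nat vs)
        (\<lambda>p. entry (enc_nat (colour (rep_nat p))) (enc_nat (wt (rep_nat p))))) =
      enc_rainbow_input vs es (map (\<lambda>v. (colour v, of_nat (wt v))) vs) (card S) (int b)"
      using S number_from_list[of "map enc_nat ss"] distinct_card[OF S(2)]
      by (simp add: rainbow_input_def enc_rainbow_input_def enc_prod_def tabulate_def enc_list_conv x
          enc_int_def enc_bool_def comp_def entry_conv[unfolded enc_prod_def] x_def)
    show "(rainbow_input x (tabulate (map enc_nat vs)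
        (\<lambda>p. entry (enc_nat (colour (rep_nat p))) (enc_nat (wt (rep_nat p))))),
      card S, \<exists>C. rainbow_solution (verts G) (sol G) colour (\<lambda>v. real (wt v)) (card S) (int b) C)
      \<in> weighted_rainbow (Vertex_Selection sol)"
      unfolding weighted_rainbow.simps
      by (intro CollectI, rule exI[of _ G], rule exI[of _ vs], rule exI[of _ es],
          rule exI[of _ colour], rule exI[of _ "\<lambda>v. of_nat (wt v)"],
          rule exI[of _ "card S"], rule exI[of _ "int b"]) (simp add: G eq)
  qed
qed

lemma admissible_edges:
  fixes b :: nat
  assumes G: "simple_graph G" "presents vs es G"
    and S: "S \<subseteq> edges G" "distinct (map edge_of ss)" "set (map edge_of ss) = S"
  defines "x \<equiv> enc_prod enc_graph (enc_prod (enc_list enc_edge) enc_nat) ((vs, es), ss, b)"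
  shows "edges.admissible (weighted_rainbow (Edge_Selection sol)) x (card S)
    (\<exists>l C. l \<le> b \<and> discovery_sequence (edge_adj G) (sol G) S l C)"
proof -
  let ?rep = "\<lambda>d. {rep_nat (left d), rep_nat (right d)}"
  have x: "right (left x) = from_list (map enc_edge es)"
    "left (right x) = from_list (map enc_edge ss)" "right (right x) = enc_nat b"
    by (simp_all add: x_def enc_prod_def enc_graph_def enc_list_conv)
  have rep: "?rep (enc_edge e) = edge_of e" for e
    by (auto simp: edge_of_def case_prod_unfold)
  have es: "distinct (map edge_of es)" "edge_of ` set es = edges G"
    using G(2) by (auto simp: presents_def)
  interpret inst: presented_instance "\<lambda>x. right (left x)"
    "\<lambda>x p q. and_data (incident (left p) q) (incident (right p) q)"
    "\<lambda>x p q. or_data (incident (left p) q) (incident (right p) q)"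
    x ?rep "map enc_edge es" "map enc_edge ss" b "edge_adj G" "edges G" S
  proof
    fix p q assume "p \<in> set (map enc_edge es)" "q \<in> set (map enc_edge es) \<union> set (map enc_edge ss)"
    then obtain e e' where e: "p = enc_edge e" "q = enc_edge e'" "e \<in> set es" "e' \<in> set es \<union> set ss" by auto
    have edges: "edge_of e \<in> edges G" "edge_of e' \<in> edges G" using e es(2) S by auto
    then have "card (edge_of e) = 2" "card (edge_of e') = 2" using G(1) by (auto simp: simple_graph_def)
    then have ne: "fst e' \<noteq> snd e'" "finite (edge_of e)"
      by (auto simp: edge_of_def case_prod_unfold card_insert_if split: if_splits)
    have e': "edge_of e' = {fst e', snd e'}" by (simp add: edge_of_def case_prod_unfold)
    have "edge_of e' \<subseteq> edge_of e \<longleftrightarrow> edge_of e' = edge_of e"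
      using card_subset_eq[OF ne(2), of "edge_of e'"] \<open>card (edge_of e) = 2\<close> \<open>card (edge_of e') = 2\<close> by auto
    then show "and_data (incident (left q) p) (incident (right q) p) \<noteq> Leaf \<longleftrightarrow> ?rep q = ?rep p"
      unfolding e(1,2) unfolding rep unfolding and_data_iff enc_edge_simps incident_iff by (simp add: e')
    show "or_data (incident (left q) p) (incident (right q) p) \<noteq> Leaf \<longleftrightarrow>
        ?rep q = ?rep p \<or> edge_adj G (?rep q) (?rep p)"
      unfolding e(1,2) unfolding rep unfolding or_data_iff enc_edge_simps incident_iff edge_adj_def
      using edges e' by auto
  next
    show "edge_adj G y z \<Longrightarrow> y \<in> edges G \<and> z \<in> edges G" for y z by (simp add: edge_adj_def)
  qed (use x es S rep in \<open>auto simp: comp_def image_image\<close>)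
  show ?thesis
  proof (rule inst.admissibleI)
    fix colour :: "nat set \<Rightarrow> nat" and wt :: "nat set \<Rightarrow> nat"
    have eq: "rainbow_input x (tabulate (map enc_edge es)
        (\<lambda>p. entry (enc_nat (colour (?rep p))) (enc_nat (wt (?rep p))))) =
      enc_rainbow_input vs es (map (\<lambda>e. (colour e, of_nat (wt e))) (map edge_of es)) (card S) (int b)"
      using S number_from_list[of "map enc_edge ss"] distinct_card[OF S(2)]
      by (simp add: rainbow_input_def enc_rainbow_input_def enc_prod_def tabulate_def enc_list_conv x
          enc_int_def enc_bool_def comp_def entry_conv[unfolded enc_prod_def] x_def edge_of_def case_prod_unfold)
    show "(rainbow_input x (tabulate (map enc_edge es)
        (\<lambda>p. entry (enc_nat (colour (?rep p))) (enc_nat (wt (?rep p))))),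
      card S, \<exists>C. rainbow_solution (edges G) (sol G) colour (\<lambda>v. real (wt v)) (card S) (int b) C)
      \<in> weighted_rainbow (Edge_Selection sol)"
      unfolding weighted_rainbow.simps
      by (intro CollectI, rule exI[of _ G], rule exI[of _ vs], rule exI[of _ es],
          rule exI[of _ colour], rule exI[of _ "\<lambda>v. of_nat (wt v)"],
          rule exI[of _ "card S"], rule exI[of _ "int b"]) (simp add: G eq)
  qed
qed

theorem theorem7p1:
  fixes \<Pi> :: selection_problem
  assumes "FPT (weighted_rainbow \<Pi>)"
  shows "FPT (discovery \<Pi>)"
proof (cases \<Pi>)
  case (Vertex_Selection sol)
  have "vertices.admissible (weighted_rainbow \<Pi>) x k a" if "(x, k, a) \<in> discovery \<Pi>" for x k a
    using that admissible_vertices unfolding Vertex_Selection by auto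
  with assms show ?thesis by (rule vertices.FPT_reduction)
next
  case (Edge_Selection sol)
  have "edges.admissible (weighted_rainbow \<Pi>) x k a" if "(x, k, a) \<in> discovery \<Pi>" for x k a
    using that admissible_edges unfolding Edge_Selection by auto
  with assms show ?thesis by (rule edges.FPT_reduction)
qed

end
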